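(* Consider the stochastic heat equation $\partial_tX=\nabla\cdot\vartheta\nabla X+\sigma\dot W$ on $[0,T)\times\mathcal D$, $\mathcal D\subset\mathbb R^d$, the noisy observation $Y=X+\varepsilon\dot V$, a point $x_0\in\mathcal D$, and the estimator $\hat\vartheta_\varepsilon(x_0)$ with bandwidth $h=h_\varepsilon$, grids $\mathcal X_\varepsilon$, weights $w_\varepsilon^h$ and associated quantities $N_\varepsilon$, $I_{\varepsilon,N_\varepsilon}$, $\langle M_\varepsilon\rangle_{N_\varepsilon}$, $B_{\varepsilon,N_\varepsilon}$ as defined in the context. Suppose that for some $\gamma\ge1$ and $h\sim\varepsilon^{\frac{2+d}{4\gamma+2d}}$ it holds as $\varepsilon\to0$: (a) $\mathbb E I_{\varepsilon,N_\varepsilon}\sim N_\varepsilon$ and $\mathrm{Var}(I_{\varepsilon,N_\varepsilon})=o(N_\varepsilon^2)$; (b) $\mathbb E\langle M_\varepsilon\rangle_{N_\varepsilon}=\mathcal O(N_\varepsilon|\mathcal X_\varepsilon|^{-1}h^{-d})$; (c) $\mathbb E B_{\varepsilon,N_\varepsilon}^2=\mathcal O(h^{2\gamma}N_\varepsilon^2)$. Then $$\hat\vartheta_\varepsilon(x_0)-\vartheta(x_0)=\mathcal O_{\mathbb P}\left(\frac1{\sqrt{N_\varepsilon|\mathcal X_\varepsilon|h^d}}+h^\gamma\right).$$ In particular, with $N_\varepsilon\sim\varepsilon^{-1}$ and $|\mathcal X_\varepsilon|\sim\varepsilon^{-d/2}$, $$\hat\vartheta_\varepsilon(x_0)-\vartheta(x_0)=\mathcal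 O_{\mathbb P}(\varepsilon^{1/2+d/4}h^{-d/2})+\mathcal O_{\mathbb P}(h^\gamma),$$ and with the choice $h\sim\varepsilon^{\frac{2+d}{4\gamma+2d}}$, which optimizes this expression, $$\hat\vartheta_\varepsilon(x_0)=\vartheta(x_0)+\mathcal O_{\mathbb P}\left(\varepsilon^{\frac{(2+d)\gamma}{4\gamma+2d}}\right).$$
   Context: Asymptotic notation: $a_\varepsilon\sim b_\varepsilon$ means $a_\varepsilon=\mathcal O(b_\varepsilon)$ and $b_\varepsilon=\mathcal O(a_\varepsilon)$ as $\varepsilon\to0$. Model. $T,\sigma>0$; $\mathcal D\subset\mathbb R^d$ is a bounded domain with smooth boundary; $\vartheta\in C^1(\bar{\mathcal D})$ is bounded away from zero; $\Delta_\vartheta=\nabla\cdot\vartheta\nabla$ with domain $W^{2,2}(\mathcal D)\cap W^{1,2}_0(\mathcal D)$ generates the semigroup $(S(t))_{t\ge0}$ on $L^2(\mathcal D)$; $\xi\in L^2(\mathcal D)$ is the (deterministic) initial condition. $\langle\cdot,\cdot\rangle$ and $\langle\langle\cdot,\cdot\rangle\rangle$ denote the scalar products of $L^2(\mathcal D)$ and $L^2([0,T)\times\mathcal D)$, and $\langle\langle Z,\varphi\rangle\rangle$ the evaluation of a process $Z$ at a test function. An isonormal Gaussian process is a centered Gaussian process on $L^2([0,T)\times\mathcal D)$ with covariance $\langle\langle\varphi,\psi\rangle\rangle$. $X$ is the Gaussian process on $C_c^\infty([0,T)\times\mathcal D)$ with mean $\langle\langle S(\cdot)\xi,\varphi\rangle\rangle$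 and covariance $$\mathrm{Cov}(\langle\langle X,\varphi\rangle\rangle,\langle\langle X,\psi\rangle\rangle)=\frac{\sigma^2}{2}\int_0^\infty\int_0^\infty\int_{|t-s|}^{t+s}\langle\varphi(t,\cdot),S(r)\psi(s,\cdot)\rangle\,dr\,ds\,dt$$ (extended by the same formulas to functions such as $\Delta_\vartheta\varphi$), which satisfies $-\langle\langle X,\partial_t\varphi\rangle\rangle=\langle\xi,\varphi(0,\cdot)\rangle+\langle\langle X,\Delta_\vartheta\varphi\rangle\rangle+\sigma\langle\langle\dot W,\varphi\rangle\rangle$ for an isonormal process $\dot W$. Observation: $\langle\langle Y,\varphi\rangle\rangle=\langle\langle X,\varphi\rangle\rangle+\varepsilon\langle\langle\dot V,\varphi\rangle\rangle$ with $\dot V$ isonormal, independent of $(X,\dot W)$. Estimator. $K\in C^\infty(\mathbb R\times\mathbb R^d)$ has compact support in $(0,1)\times(-1,1)^d$; $K_{k,x}(t,y):=K(t-k,y-x)$ and $(K_{k,x})_{\varepsilon,x_0}(t,y):=\varepsilon^{-1/2-d/4}K_{k,x}(\varepsilon^{-1}t,\varepsilon^{-1/2}(y-x_0))$. $N_\varepsilon:=\lfloor T\varepsilon^{-1}\rfloor-1$, and $\mathcal X_\varepsilon\subset\mathbb R^d$ is a finite set such that $\mathrm{supp}((K_{0,x})_{\varepsilon,x_0})\subset[0,T)\times\mathcal D$ for $x\in\mathcal X_\varepsilon$, with pairwise disjoint supports for distinct $x$. The weights $w^h_\varepsilon(x)\in\mathbb R$, $x\in\mathcal X_\varepsilon$,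 depend on a bandwidth $h=h_\varepsilon>0$ with $\varepsilon=\mathcal O(h^2)$. Set $$\widehat X'_{\varepsilon,k,x}:=-\langle\langle Y,\partial_t(K_{k,x})_{\varepsilon,x_0}\rangle\rangle,\quad \widehat X^\Delta_{\varepsilon,k,x}:=\langle\langle Y,\Delta(K_{k,x})_{\varepsilon,x_0}\rangle\rangle,$$ $$I_{\varepsilon,N_\varepsilon}=\sum_{k=1}^{N_\varepsilon}\sum_{x\in\mathcal X_\varepsilon}w^h_\varepsilon(x)\widehat X^\Delta_{\varepsilon,k-1,x}\widehat X^\Delta_{\varepsilon,k,x},\quad \hat\vartheta_\varepsilon(x_0)=I_{\varepsilon,N_\varepsilon}^{-1}\sum_{k=1}^{N_\varepsilon}\sum_{x\in\mathcal X_\varepsilon}w^h_\varepsilon(x)\widehat X^\Delta_{\varepsilon,k-1,x}\widehat X'_{\varepsilon,k,x},$$ $$B_{\varepsilon,N_\varepsilon}=\sum_{k=1}^{N_\varepsilon}\sum_{x\in\mathcal X_\varepsilon}w^h_\varepsilon(x)\widehat X^\Delta_{\varepsilon,k-1,x}\langle\langle X,[\Delta_\vartheta-\vartheta(x_0)\Delta](K_{k,x})_{\varepsilon,x_0}\rangle\rangle,$$ $$\langle M_\varepsilon\rangle_{N_\varepsilon}=\sigma_K^2\sum_{k=1}^{N_\varepsilon}\sum_{x\in\mathcal X_\varepsilon}w^h_\varepsilon(x)^2(\widehat X^\Delta_{\varepsilon,k-1,x})^2,\quad \sigma_K^2=\sigma^2\|K\|_{L^2(\mathbb R\times\mathbb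 R^d)}^2+\|\partial_tK+\vartheta(x_0)\Delta K\|_{L^2(\mathbb R\times\mathbb R^d)}^2.$$ *)

theory Defs
  imports "HOL-Probability.Probability" "HOL-Library.Landau_Symbols"
begin

definition pd :: "'a::euclidean_space \<Rightarrow> ('a \<Rightarrow> real) \<Rightarrow> 'a \<Rightarrow> real" where
  "pd b f x = frechet_derivative f (at x) b"

primrec Ck :: "nat \<Rightarrow> ('a::euclidean_space \<Rightarrow> real) \<Rightarrow> bool" where
  "Ck 0 f \<longleftrightarrow> continuous_on UNIV f"
| "Ck (Suc n) f \<longleftrightarrow> (\<forall>x. f differentiable (at x)) \<and> (\<forall>b\<in>Basis. Ck n (pd b f))"

definition smooth :: "('a::euclidean_space \<Rightarrow> real) \<Rightarrow> bool" where
  "smooth f \<longleftrightarrow> (\<forall>n. Ck n f)"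

definition supp :: "('a::topological_space \<Rightarrow> real) \<Rightarrow> 'a set" where
  "supp f = closure {z. f z \<noteq> 0}"

definition C1_closure :: "'a::euclidean_space set \<Rightarrow> ('a \<Rightarrow> real) \<Rightarrow> bool" where
  "C1_closure D f \<longleftrightarrow> continuous_on (closure D) f \<and> (\<forall>x\<in>D. f differentiable (at x)) \<and>
     (\<forall>b\<in>Basis. \<exists>g. continuous_on (closure D) g \<and> (\<forall>x\<in>D. g x = pd b f x))"

definition laplacian :: "('a::euclidean_space \<Rightarrow> real) \<Rightarrow> 'a \<Rightarrow> real" where
  "laplacian f x = (\<Sum>b\<in>Basis. pd b (pd b f) x)"

definition div_grad :: "('a::euclidean_space \<Rightarrow> real) \<Rightarrow> ('a \<Rightarrow> real) \<Rightarrow> 'a \<Rightarrow> real" where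
  "div_grad \<theta> f x = (\<Sum>b\<in>Basis. pd b (\<lambda>y. \<theta> y * pd b f y) x)"

text \<open>Space-time functions live on \<open>real \<times> 'a\<close>. The spatial operators act at frozen time.\<close>

definition dt :: "(real \<times> 'a \<Rightarrow> real) \<Rightarrow> real \<times> 'a \<Rightarrow> real" where
  "dt f = (\<lambda>(t, x). deriv (\<lambda>s. f (s, x)) t)"

definition Lap :: "(real \<times> 'a::euclidean_space \<Rightarrow> real) \<Rightarrow> real \<times> 'a \<Rightarrow> real" where
  "Lap f = (\<lambda>(t, x). laplacian (\<lambda>y. f (t, y)) x)"

definition Div_grad :: "('a::euclidean_space \<Rightarrow> real) \<Rightarrow> (real \<times> 'a \<Rightarrow> real) \<Rightarrow> real \<times> 'a \<Rightarrow> real" where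
  "Div_grad \<theta> f = (\<lambda>(t, x). div_grad \<theta> (\<lambda>y. f (t, y)) x)"

text \<open>The boundary is locally the graph of a smooth function of the remaining coordinates, after
  relabelling (\<open>b\<close>) and reorienting (\<open>s\<close>) the axes; \<open>g\<close> does not depend on the coordinate \<open>b\<close>.\<close>

definition smooth_boundary :: "'a::euclidean_space set \<Rightarrow> bool" where
  "smooth_boundary D \<longleftrightarrow> (\<forall>p\<in>frontier D. \<exists>r>0. \<exists>b\<in>Basis. \<exists>s\<in>{-1, 1}. \<exists>g.
     smooth g \<and> (\<forall>x t. g (x + t *\<^sub>R b) = g x) \<and>
     D \<inter> ball p r = {x \<in> ball p r. g x < s * (x \<bullet> b)})"

definition bounded_smooth_domain :: "'a::euclidean_space set \<Rightarrow> bool" where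
  "bounded_smooth_domain D \<longleftrightarrow>
     open D \<and> connected D \<and> D \<noteq> {} \<and> bounded D \<and> smooth_boundary D"

text \<open>Elements of \<open>L\<^sup>2\<close> are represented by functions; all notions below are invariant under
  modification on null sets of the given set.\<close>

definition L2 :: "'a::euclidean_space set \<Rightarrow> ('a \<Rightarrow> real) set" where
  "L2 A = {f \<in> borel_measurable (lebesgue_on A). integrable (lebesgue_on A) (\<lambda>x. (f x)\<^sup>2)}"

definition ip :: "'a::euclidean_space set \<Rightarrow> ('a \<Rightarrow> real) \<Rightarrow> ('a \<Rightarrow> real) \<Rightarrow> real" where
  "ip A f g = (\<integral>x. f x * g x \<partial>(lebesgue_on A))"

definition nrm :: "'a::euclidean_space set \<Rightarrow> ('a \<Rightarrow> real) \<Rightarrow> real" where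
  "nrm A f = sqrt (ip A f f)"

definition Cc_smooth :: "'a::euclidean_space set \<Rightarrow> ('a \<Rightarrow> real) set" where
  "Cc_smooth D = {f. smooth f \<and> compact (supp f) \<and> supp f \<subseteq> D}"

definition weak_pd :: "'a::euclidean_space set \<Rightarrow> 'a \<Rightarrow> ('a \<Rightarrow> real) \<Rightarrow> ('a \<Rightarrow> real) \<Rightarrow> bool" where
  "weak_pd D b f g \<longleftrightarrow> (\<forall>\<eta>\<in>Cc_smooth D. ip D f (pd b \<eta>) = - ip D g \<eta>)"

definition W12 :: "'a::euclidean_space set \<Rightarrow> ('a \<Rightarrow> real) set" where
  "W12 D = {f \<in> L2 D. \<forall>b\<in>Basis. \<exists>g\<in>L2 D. weak_pd D b f g}"

definition W22 :: "'a::euclidean_space set \<Rightarrow> ('a \<Rightarrow> real) set" where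
  "W22 D = {f \<in> L2 D. \<forall>b\<in>Basis. \<exists>g\<in>W12 D. weak_pd D b f g}"

definition W12_0 :: "'a::euclidean_space set \<Rightarrow> ('a \<Rightarrow> real) set" where
  "W12_0 D = {f \<in> L2 D. \<exists>\<eta> :: nat \<Rightarrow> 'a \<Rightarrow> real. (\<forall>n. \<eta> n \<in> Cc_smooth D) \<and>
     (\<lambda>n. nrm D (\<lambda>x. \<eta> n x - f x)) \<longlonglongrightarrow> 0 \<and>
     (\<forall>b\<in>Basis. \<exists>g\<in>L2 D. weak_pd D b f g \<and> (\<lambda>n. nrm D (\<lambda>x. pd b (\<eta> n) x - g x)) \<longlonglongrightarrow> 0)}"

text \<open>Graph of \<open>\<nabla>\<cdot>\<theta>\<nabla>\<close> on \<open>W\<^sup>2\<^sup>,\<^sup>2 \<inter> W\<^sup>1\<^sup>,\<^sup>2\<^sub>0\<close>: \<open>G\<close> is the weak gradient of \<open>f\<close> and \<open>H b\<close> the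
  weak \<open>b\<close>-derivative of \<open>\<theta> * G b\<close>. On \<open>Cc_smooth D\<close> it coincides with \<^const>\<open>div_grad\<close>.\<close>

definition div_grad_graph ::
    "'a::euclidean_space set \<Rightarrow> ('a \<Rightarrow> real) \<Rightarrow> ('a \<Rightarrow> real) \<Rightarrow> ('a \<Rightarrow> real) \<Rightarrow> bool" where
  "div_grad_graph D \<theta> f u \<longleftrightarrow> f \<in> W22 D \<inter> W12_0 D \<and> u \<in> L2 D \<and>
     (\<exists>G H. (\<forall>b\<in>Basis. G b \<in> L2 D \<and> weak_pd D b f (G b) \<and>
                        H b \<in> L2 D \<and> weak_pd D b (\<lambda>x. \<theta> x * G b x) (H b)) \<and>
            (AE x in lebesgue_on D. u x = (\<Sum>b\<in>Basis. H b x)))"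

definition C0_semigroup ::
    "'a::euclidean_space set \<Rightarrow> (real \<Rightarrow> ('a \<Rightarrow> real) \<Rightarrow> 'a \<Rightarrow> real) \<Rightarrow> bool" where
  "C0_semigroup D S \<longleftrightarrow>
     (\<forall>t\<ge>0. \<forall>f\<in>L2 D. S t f \<in> L2 D) \<and>
     (\<forall>t\<ge>0. \<forall>f\<in>L2 D. \<forall>g\<in>L2 D. \<forall>a b.
        AE x in lebesgue_on D. S t (\<lambda>y. a * f y + b * g y) x = a * S t f x + b * S t g x) \<and>
     (\<forall>t\<ge>0. \<exists>C. \<forall>f\<in>L2 D. nrm D (S t f) \<le> C * nrm D f) \<and>
     (\<forall>f\<in>L2 D. AE x in lebesgue_on D. S 0 f x = f x) \<and>
     (\<forall>s\<ge>0. \<forall>t\<ge>0. \<forall>f\<in>L2 D. AE x in lebesgue_on D. S (s + t) f x = S s (S t f) x) \<and>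
     (\<forall>f\<in>L2 D. ((\<lambda>t. nrm D (\<lambda>x. S t f x - f x)) \<longlongrightarrow> 0) (at_right 0))"

definition generates ::
    "'a::euclidean_space set \<Rightarrow> (('a \<Rightarrow> real) \<Rightarrow> ('a \<Rightarrow> real) \<Rightarrow> bool)
     \<Rightarrow> (real \<Rightarrow> ('a \<Rightarrow> real) \<Rightarrow> 'a \<Rightarrow> real) \<Rightarrow> bool" where
  "generates D A S \<longleftrightarrow> C0_semigroup D S \<and>
     (\<forall>f\<in>L2 D. \<forall>u\<in>L2 D. A f u \<longleftrightarrow>
        ((\<lambda>t. nrm D (\<lambda>x. (S t f x - f x) / t - u x)) \<longlongrightarrow> 0) (at_right 0))"

text \<open>Degenerate (almost surely constant) variables count as Gaussian.\<close>

definition gaussian_rv :: "'w measure \<Rightarrow> ('w \<Rightarrow> real) \<Rightarrow> bool" where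
  "gaussian_rv M Z \<longleftrightarrow> Z \<in> borel_measurable M \<and>
     (\<exists>m s. (0 < s \<and> distributed M lborel Z (normal_density m s)) \<or> (AE \<omega> in M. Z \<omega> = m))"

definition gaussian_process :: "'w measure \<Rightarrow> 'i set \<Rightarrow> ('i \<Rightarrow> 'w \<Rightarrow> real) \<Rightarrow> bool" where
  "gaussian_process M J Z \<longleftrightarrow>
     (\<forall>F c. finite F \<and> F \<subseteq> J \<longrightarrow> gaussian_rv M (\<lambda>\<omega>. \<Sum>i\<in>F. c i * Z i \<omega>))"

definition covariance :: "'w measure \<Rightarrow> ('w \<Rightarrow> real) \<Rightarrow> ('w \<Rightarrow> real) \<Rightarrow> real" where
  "covariance M Y Z = (\<integral>\<omega>. (Y \<omega> - (\<integral>\<omega>'. Y \<omega>' \<partial>M)) * (Z \<omega> - (\<integral>\<omega>'. Z \<omega>' \<partial>M)) \<partial>M)"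

definition isonormal ::
    "'w measure \<Rightarrow> 'b::euclidean_space set \<Rightarrow> (('b \<Rightarrow> real) \<Rightarrow> 'w \<Rightarrow> real) \<Rightarrow> bool" where
  "isonormal M A W \<longleftrightarrow> gaussian_process M (L2 A) W \<and>
     (\<forall>\<phi>\<in>L2 A. (\<integral>\<omega>. W \<phi> \<omega> \<partial>M) = 0) \<and>
     (\<forall>\<phi>\<in>L2 A. \<forall>\<psi>\<in>L2 A. covariance M (W \<phi>) (W \<psi>) = ip A \<phi> \<psi>)"

definition process_events :: "'w measure \<Rightarrow> 'i set \<Rightarrow> ('i \<Rightarrow> 'w \<Rightarrow> real) \<Rightarrow> 'w set set" where
  "process_events M J Z = {Z i -` B \<inter> space M | i B. i \<in> J \<and> B \<in> sets borel}"

text \<open>\<open>C\<^sub>c\<close> and \<open>C\<^sub>c\<^sup>\<infinity>\<close> on \<open>[0,T) \<times> D\<close>. Functions may be nonzero at time 0, hence they are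
  given on all of \<open>real \<times> 'a\<close> and only the values at times \<open>t \<ge> 0\<close> carry information; these are
  zero off a compact subset of \<open>[0,T) \<times> D\<close>. Smoothness up to \<open>t = 0\<close> is smoothness of some extension
  to negative times.\<close>

definition vanishes_off :: "real \<Rightarrow> 'a::euclidean_space set \<Rightarrow> (real \<times> 'a \<Rightarrow> real) \<Rightarrow> bool" where
  "vanishes_off T D f \<longleftrightarrow> (\<exists>C. compact C \<and> C \<subseteq> {0..<T} \<times> D \<and>
     (\<forall>t x. 0 \<le> t \<and> (t, x) \<notin> C \<longrightarrow> f (t, x) = 0))"

definition Cc_st :: "real \<Rightarrow> 'a::euclidean_space set \<Rightarrow> (real \<times> 'a \<Rightarrow> real) set" where
  "Cc_st T D = {f. continuous_on ({0..} \<times> UNIV) f \<and> vanishes_off T D f}"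

definition Cc_smooth_st :: "real \<Rightarrow> 'a::euclidean_space set \<Rightarrow> (real \<times> 'a \<Rightarrow> real) set" where
  "Cc_smooth_st T D = {f. smooth f \<and> vanishes_off T D f}"

text \<open>The process is indexed by \<^const>\<open>Cc_st\<close> rather than \<^const>\<open>Cc_smooth_st\<close>, because the equation
  evaluates it at \<open>Div_grad \<theta> \<phi>\<close>, which is only continuous when \<open>\<theta>\<close> is \<open>C\<^sup>1\<close>.\<close>

definition heat_process ::
    "'w measure \<Rightarrow> real \<Rightarrow> 'a::euclidean_space set \<Rightarrow> (real \<Rightarrow> ('a \<Rightarrow> real) \<Rightarrow> 'a \<Rightarrow> real) \<Rightarrow> real
     \<Rightarrow> ('a \<Rightarrow> real) \<Rightarrow> ((real \<times> 'a \<Rightarrow> real) \<Rightarrow> 'w \<Rightarrow> real) \<Rightarrow> bool" where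
  "heat_process M T D S \<sigma> \<xi> X \<longleftrightarrow> gaussian_process M (Cc_st T D) X \<and>
     (\<forall>\<phi>\<in>Cc_st T D. (\<integral>\<omega>. X \<phi> \<omega> \<partial>M) =
        (LINT t:{0..<T}|lebesgue. ip D (S t \<xi>) (\<lambda>x. \<phi> (t, x)))) \<and>
     (\<forall>\<phi>\<in>Cc_st T D. \<forall>\<psi>\<in>Cc_st T D. covariance M (X \<phi>) (X \<psi>) = \<sigma>\<^sup>2 / 2 *
        (LINT t:{0..}|lebesgue. LINT s:{0..}|lebesgue. LINT r:{\<bar>t - s\<bar>..t + s}|lebesgue.
           ip D (\<lambda>x. \<phi> (t, x)) (S r (\<lambda>x. \<psi> (s, x)))))"

definition solves_heat_equation ::
    "'w measure \<Rightarrow> real \<Rightarrow> 'a::euclidean_space set \<Rightarrow> ('a \<Rightarrow> real) \<Rightarrow> real \<Rightarrow> ('a \<Rightarrow> real)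
     \<Rightarrow> ((real \<times> 'a \<Rightarrow> real) \<Rightarrow> 'w \<Rightarrow> real) \<Rightarrow> ((real \<times> 'a \<Rightarrow> real) \<Rightarrow> 'w \<Rightarrow> real) \<Rightarrow> bool" where
  "solves_heat_equation M T D \<theta> \<sigma> \<xi> X W \<longleftrightarrow> (\<forall>\<phi>\<in>Cc_smooth_st T D. AE \<omega> in M.
     - X (dt \<phi>) \<omega> = ip D \<xi> (\<lambda>x. \<phi> (0, x)) + X (Div_grad \<theta> \<phi>) \<omega> + \<sigma> * W \<phi> \<omega>)"

definition independent_of_pair ::
    "'w measure \<Rightarrow> real \<Rightarrow> 'a::euclidean_space set \<Rightarrow> ((real \<times> 'a \<Rightarrow> real) \<Rightarrow> 'w \<Rightarrow> real)
     \<Rightarrow> ((real \<times> 'a \<Rightarrow> real) \<Rightarrow> 'w \<Rightarrow> real) \<Rightarrow> ((real \<times> 'a \<Rightarrow> real) \<Rightarrow> 'w \<Rightarrow> real) \<Rightarrow> bool" where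
  "independent_of_pair M T D V X W \<longleftrightarrow> prob_space.indep_set M
     (sigma_sets (space M) (process_events M (L2 ({0..<T} \<times> D)) V))
     (sigma_sets (space M) (process_events M (Cc_st T D) X
                            \<union> process_events M (L2 ({0..<T} \<times> D)) W))"

definition shifted ::
    "(real \<times> 'a::euclidean_space \<Rightarrow> real) \<Rightarrow> nat \<Rightarrow> 'a \<Rightarrow> real \<times> 'a \<Rightarrow> real" where
  "shifted K k x = (\<lambda>(t, y). K (t - real k, y - x))"

definition rescaled ::
    "(real \<times> 'a::euclidean_space \<Rightarrow> real) \<Rightarrow> real \<Rightarrow> 'a \<Rightarrow> real \<times> 'a \<Rightarrow> real" where
  "rescaled f \<epsilon> x\<^sub>0 = (\<lambda>(t, y).
     \<epsilon> powr (- 1 / 2 - real DIM('a) / 4) * f (t / \<epsilon>, (\<epsilon> powr (- 1 / 2)) *\<^sub>R (y - x\<^sub>0)))"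

text \<open>\<open>Z \<epsilon> = O\<^sub>\<bbbP>(a \<epsilon>)\<close> as \<open>\<epsilon>\<close> decreases to 0. Measurability is demanded explicitly, because the
  probability of a non-measurable set would be 0 by convention.\<close>

definition bigo_prob :: "'w measure \<Rightarrow> (real \<Rightarrow> 'w \<Rightarrow> real) \<Rightarrow> (real \<Rightarrow> real) \<Rightarrow> bool" where
  "bigo_prob M Z a \<longleftrightarrow> (\<forall>\<^sub>F \<epsilon> in at_right 0. Z \<epsilon> \<in> borel_measurable M) \<and>
     (\<forall>\<delta>>0. \<exists>C>0. \<forall>\<^sub>F \<epsilon> in at_right 0.
        measure M {\<omega> \<in> space M. C * \<bar>a \<epsilon>\<bar> < \<bar>Z \<epsilon> \<omega>\<bar>} \<le> \<delta>)"

end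

theory Submission
  imports Defs
begin

text \<open>Where \<open>I \<noteq> 0\<close> the estimation error is \<open>(B + P) / I\<close>, where \<open>B\<close> is the bias term and \<open>P\<close> the weighted
  sum of the products of \<open>X\<Delta> \<epsilon> (k - 1) x\<close> with the noise in the \<open>k\<close>-th equation. Chebyshev's inequality
  keeps \<open>I\<close> away from 0, so it suffices to bound second moments of \<open>B\<close> and \<open>P\<close>. The noise at step \<open>k\<close> is
  uncorrelated with all earlier observations: for \<open>X\<close> this follows from its covariance, since the integral of
  \<open>\<langle>\<psi>\<^sub>t, S(r)(\<partial>\<^sub>s\<phi>\<^sub>s + \<Delta>\<phi>\<^sub>s)\<rangle>\<close> over \<open>s\<close> and \<open>r\<close> is that of an \<open>s\<close>-derivative when \<open>\<psi>\<close> lives before \<open>\<phi>\<close>. All variables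
  involved belong to one Gaussian space, where fourth moments are determined by covariances, hence
  \<open>E P\<^sup>2\<close> equals the expected quadratic variation.\<close>

section \<open>Gaussian variables and their moments\<close>

text \<open>The obstacle is that \<open>X\<close> and \<open>W\<close> are linked only through the
  equation: there is no filtration and no joint Gaussian law, so the martingale property cannot be
  read off from independent increments and has to come out of the covariance formula of
  \<open>X\<close>. That computation differentiates S(s + v) F_s in time. It therefore needs joint
  continuity of the semigroup in time and argument, hence a bound on its operator norms that is
  locally uniform in time, whereas \<open>C0_semigroup\<close> postulates a bound for each single
  time only; this is why a uniform boundedness argument precedes the probabilistic part. Similarly,
  \<open>X\<close> and \<open>V\<close> are not postulated to be linear in the test function; almost
  sure linearity is recovered from means and covariances. Finally, the noise variance is the same
  number \<sigma>_K^2 at every noise level because of parabolic scaling: applying \<partial>_t + a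
  \<Delta> to a rescaled kernel produces a factor 1 / \<epsilon>, which cancels the factor
  \<epsilon> in front of \<open>V\<close>.\<close>

lemma gaussian_rv_moments:
  assumes "prob_space M" and "gaussian_rv M Z"
  shows "integrable M (\<lambda>\<omega>. Z \<omega> ^ n)"
    and "\<exists>m v. (\<integral>\<omega>. Z \<omega> \<partial>M) = m \<and> (\<integral>\<omega>. (Z \<omega>)^2 \<partial>M) = m^2 + v \<and>
           (\<integral>\<omega>. (Z \<omega>)^4 \<partial>M) = m^4 + 6 * m^2 * v + 3 * v^2"
proof -
  interpret prob_space M by fact
  have Z[measurable]: "Z \<in> borel_measurable M"
    using assms(2) by (simp add: gaussian_rv_def)
  obtain m s where ms: "(0 < s \<and> distributed M lborel Z (normal_density m s)) \<or> (AE \<omega> in M. Z \<omega> = m)"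
    using assms(2) by (auto simp: gaussian_rv_def)
  have "(\<forall>n. integrable M (\<lambda>\<omega>. Z \<omega> ^ n)) \<and> (\<exists>m v. (\<integral>\<omega>. Z \<omega> \<partial>M) = m \<and> (\<integral>\<omega>. (Z \<omega>)^2 \<partial>M) = m^2 + v \<and>
           (\<integral>\<omega>. (Z \<omega>)^4 \<partial>M) = m^4 + 6 * m^2 * v + 3 * v^2)"
    using ms
  proof
    assume ae: "AE \<omega> in M. Z \<omega> = m"
    have e: "integrable M (\<lambda>\<omega>. Z \<omega> ^ n) \<and> (\<integral>\<omega>. Z \<omega> ^ n \<partial>M) = m ^ n" for n
    proof -
      have ae': "AE \<omega> in M. Z \<omega> ^ n = m ^ n" using ae by auto
      have "integrable M (\<lambda>\<omega>. Z \<omega> ^ n) \<longleftrightarrow> integrable M (\<lambda>\<omega>. m ^ n)"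
        by (rule integrable_cong_AE) (use ae' in auto)
      moreover have "(\<integral>\<omega>. Z \<omega> ^ n \<partial>M) = (\<integral>\<omega>. m ^ n \<partial>M)"
        by (rule integral_cong_AE) (use ae' in auto)
      ultimately show ?thesis by (simp add: prob_space)
    qed
    \<comment> \<open>The degenerate case satisfies the same formulas with variance v = 0.\<close>
    show ?thesis
      using e e[of 1] by (auto intro!: exI[of _ m] exI[of _ 0])
  next
    assume "0 < s \<and> distributed M lborel Z (normal_density m s)"
    hence s: "0 < s" and D: "distributed M lborel Z (normal_density m s)" by auto
    have ic: "integrable M (\<lambda>\<omega>. (Z \<omega> - m) ^ n)" for n
      using integrable_normal_moment[OF s, of m n]
      by (subst distributed_integrable[OF D, symmetric]) auto
    \<comment> \<open>Raw moments are expanded around \<open>m\<close>, because explicit formulas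
      are at hand for the central moments of a normal law.\<close>
    have zero: "Z \<omega> ^ n = (\<Sum>k\<le>n. of_nat (n choose k) * (Z \<omega> - m)^k * m^(n-k))" for \<omega> n
      using binomial_ring[of "Z \<omega> - m" m n] by simp
    have i: "integrable M (\<lambda>\<omega>. Z \<omega> ^ n)" for n
      unfolding zero by (intro Bochner_Integration.integrable_sum integrable_mult_left integrable_mult_right ic)
    have e: "(\<integral>\<omega>. (Z \<omega> - m) ^ n \<partial>M) = (\<integral>x. normal_density m s x * (x - m)^n \<partial>lborel)" for n
      by (subst distributed_integral[OF D, symmetric]) auto
    have c: "(\<integral>\<omega>. (Z \<omega> - m) \<partial>M) = 0" "(\<integral>\<omega>. (Z \<omega> - m)^2 \<partial>M) = s^2" 
        "(\<integral>\<omega>. (Z \<omega> - m)^3 \<partial>M) = 0" "(\<integral>\<omega>. (Z \<omega> - m)^4 \<partial>M) = 3 * s^4"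
      using e[of 1] e[of 2] e[of 3] e[of 4] integral_normal_moment_odd[OF s, of m 0] integral_normal_moment_odd[OF s, of m 1]
        integral_normal_moment_even[OF s, of m 1]  integral_normal_moment_even[OF s, of m 2] s
      by (simp_all add: fact_numeral power_divide field_simps eval_nat_numeral)
    have i1: "integrable M Z" using i[of 1] by simp
    have m1: "(\<integral>\<omega>. Z \<omega> \<partial>M) = m" using c(1) i1 by (simp add: prob_space)
    have m2: "(\<integral>\<omega>. (Z \<omega>)^2 \<partial>M) = m^2 + s^2"
    proof -
      have "(\<integral>\<omega>. (Z \<omega>)^2 \<partial>M) = (\<integral>\<omega>. (Z \<omega> - m)^2 + 2 * m * (Z \<omega> - m) + m^2 \<partial>M)"
        by (rule Bochner_Integration.integral_cong) (auto simp: power2_eq_square algebra_simps)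
      also have "\<dots> = s^2 + 2 * m * (\<integral>\<omega>. (Z \<omega> - m) \<partial>M) + m^2"
        using ic[of 1] ic[of 2] by (subst Bochner_Integration.integral_add | simp add: prob_space c(2) del: Bochner_Integration.integral_diff)+
      finally show ?thesis using c(1) by simp
    qed
    have m4: "(\<integral>\<omega>. (Z \<omega>)^4 \<partial>M) = m^4 + 6 * m^2 * s^2 + 3 * (s^2)^2"
    proof -
      have "(\<integral>\<omega>. (Z \<omega>)^4 \<partial>M) = (\<integral>\<omega>. (Z \<omega> - m)^4 + 4 * m * (Z \<omega> - m)^3 + 6 * m^2 * (Z \<omega> - m)^2 + 4 * m^3 * (Z \<omega> - m) + m^4 \<partial>M)"
        by (rule Bochner_Integration.integral_cong) (auto simp: eval_nat_numeral algebra_simps)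
      also have "\<dots> = 3 * s^4 + 4 * m * (\<integral>\<omega>. (Z \<omega> - m)^3 \<partial>M) + 6 * m^2 * s^2 + 4 * m^3 * (\<integral>\<omega>. (Z \<omega> - m) \<partial>M) + m^4"
        using ic[of 1] ic[of 2] ic[of 3] ic[of 4] by (subst Bochner_Integration.integral_add | simp add: prob_space c(2,4) del: Bochner_Integration.integral_diff)+
      finally show ?thesis using c(1,3) by simp
    qed
    show ?thesis using i m1 m2 m4 by blast
  qed
  thus "integrable M (\<lambda>\<omega>. Z \<omega> ^ n)" "\<exists>m v. (\<integral>\<omega>. Z \<omega> \<partial>M) = m \<and> (\<integral>\<omega>. (Z \<omega>)^2 \<partial>M) = m^2 + v \<and>
           (\<integral>\<omega>. (Z \<omega>)^4 \<partial>M) = m^4 + 6 * m^2 * v + 3 * v^2"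
    by blast+
qed

lemma gaussian_rv_AE_cong:
  assumes "gaussian_rv M Z" "Z' \<in> borel_measurable M" "AE \<omega> in M. Z' \<omega> = Z \<omega>"
  shows "gaussian_rv M Z'"
proof -
  have Z: "Z \<in> borel_measurable M" using assms(1) by (simp add: gaussian_rv_def)
  have d: "distr M lborel Z = distr M lborel Z'"
    by (rule distr_cong_AE) (use assms Z in auto)
  from assms(1) obtain m s where "(0 < s \<and> distributed M lborel Z (normal_density m s)) \<or> (AE \<omega> in M. Z \<omega> = m)"
    by (auto simp: gaussian_rv_def)
  thus ?thesis
  proof
    assume "0 < s \<and> distributed M lborel Z (normal_density m s)"
    hence "0 < s \<and> distributed M lborel Z' (normal_density m s)"
      using assms(2) d by (auto simp: distributed_def)
    thus ?thesis using assms(2) by (auto simp: gaussian_rv_def)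
  next
    assume "AE \<omega> in M. Z \<omega> = m"
    hence "AE \<omega> in M. Z' \<omega> = m" using assms(3) by eventually_elim auto
    thus ?thesis using assms(2) by (auto simp: gaussian_rv_def)
  qed
qed

lemma gaussian_rv_add_const:
  assumes "prob_space M" "gaussian_rv M Z"
  shows "gaussian_rv M (\<lambda>\<omega>. Z \<omega> + c)"
proof -
  interpret prob_space M by fact
  have Z[measurable]: "Z \<in> borel_measurable M" using assms(2) by (simp add: gaussian_rv_def)
  obtain m s where "(0 < s \<and> distributed M lborel Z (normal_density m s)) \<or> (AE \<omega> in M. Z \<omega> = m)"
    using assms(2) by (auto simp: gaussian_rv_def)
  thus ?thesis
  proof
    assume "0 < s \<and> distributed M lborel Z (normal_density m s)"
    hence "0 < s \<and> distributed M lborel (\<lambda>\<omega>. c + 1 * Z \<omega>) (normal_density (c + 1 * m) (\<bar>1\<bar> * s))"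
      by (intro conjI normal_density_affine) auto
    hence "\<exists>m s. 0 < s \<and> distributed M lborel (\<lambda>\<omega>. Z \<omega> + c) (normal_density m s)"
      by (intro exI[of _ "c + m"] exI[of _ s]) (simp add: add.commute)
    thus ?thesis by (auto simp: gaussian_rv_def)
  next
    assume "AE \<omega> in M. Z \<omega> = m"
    hence "AE \<omega> in M. Z \<omega> + c = m + c" by auto
    thus ?thesis unfolding gaussian_rv_def by (intro conjI exI disjI2) auto
  qed
qed

text \<open>The convolution of normal densities covers two nondegenerate summands; if one summand is
  almost surely constant, the sum is a shift of the other.\<close>

lemma gaussian_rv_add_indep:
  assumes "prob_space M" "gaussian_rv M Z" "gaussian_rv M Z'"
    and indep: "prob_space.indep_var M borel Z borel Z'"
  shows "gaussian_rv M (\<lambda>\<omega>. Z \<omega> + Z' \<omega>)"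
proof -
  interpret prob_space M by fact
  have Z[measurable]: "Z \<in> borel_measurable M" "Z' \<in> borel_measurable M"
    using assms by (simp_all add: gaussian_rv_def)
  obtain m s where A: "(0 < s \<and> distributed M lborel Z (normal_density m s)) \<or> (AE \<omega> in M. Z \<omega> = m)"
    using assms(2) by (auto simp: gaussian_rv_def)
  obtain m' s' where B: "(0 < s' \<and> distributed M lborel Z' (normal_density m' s')) \<or> (AE \<omega> in M. Z' \<omega> = m')"
    using assms(3) by (auto simp: gaussian_rv_def)
  consider "AE \<omega> in M. Z \<omega> = m" | "AE \<omega> in M. Z' \<omega> = m'" |
    "0 < s" "distributed M lborel Z (normal_density m s)" "0 < s'" "distributed M lborel Z' (normal_density m' s')"
    using A B by blast
  thus ?thesis
  proof cases
    case 1
    have "AE \<omega> in M. Z \<omega> + Z' \<omega> = Z' \<omega> + m" using 1 by eventually_elim auto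
    thus ?thesis by (intro gaussian_rv_AE_cong[OF gaussian_rv_add_const[OF assms(1,3), of m]]) auto
  next
    case 2
    have "AE \<omega> in M. Z \<omega> + Z' \<omega> = Z \<omega> + m'" using 2 by eventually_elim auto
    thus ?thesis by (intro gaussian_rv_AE_cong[OF gaussian_rv_add_const[OF assms(1,2), of m']]) auto
  next
    case 3
    have "distributed M lborel (\<lambda>\<omega>. Z \<omega> + Z' \<omega>) (normal_density (m + m') (sqrt (s^2 + s'^2)))"
      by (rule add_indep_normal[OF indep 3(1,3,2,4)])
    moreover have "0 < sqrt (s^2 + s'^2)" using 3 by (simp add: add_pos_pos)
    ultimately show ?thesis unfolding gaussian_rv_def by (intro conjI exI disjI1) auto
  qed
qed

text \<open>Joint Gaussianity is encoded in Cramer-Wold form: a family is jointly Gaussian when all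
  its linear combinations are Gaussian. Elements are plain functions, not classes modulo null
  sets.\<close>

locale gaussian_space = prob_space M for M :: "'w measure" +
  fixes G :: "('w \<Rightarrow> real) set"
  assumes gaussian: "Z \<in> G \<Longrightarrow> gaussian_rv M Z"
    and lincomb: "Z \<in> G \<Longrightarrow> Z' \<in> G \<Longrightarrow> (\<lambda>\<omega>. a * Z \<omega> + b * Z' \<omega>) \<in> G"
begin

lemma measurable_G: "Z \<in> G \<Longrightarrow> Z \<in> borel_measurable M"
  using gaussian by (auto simp: gaussian_rv_def)

lemma integrable_power_G: "Z \<in> G \<Longrightarrow> integrable M (\<lambda>\<omega>. Z \<omega> ^ n)"
  using gaussian_rv_moments(1)[OF prob_space_axioms gaussian] by blast

lemma integrable_prod4:
  assumes "A \<in> G" "B \<in> G" "C \<in> G" "E \<in> G"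
  shows "integrable M (\<lambda>\<omega>. A \<omega> * B \<omega> * (C \<omega> * E \<omega>))"
proof (rule Bochner_Integration.integrable_bound)
  show "integrable M (\<lambda>\<omega>. A \<omega> ^ 4 + B \<omega> ^ 4 + C \<omega> ^ 4 + E \<omega> ^ 4)"
    using assms by (intro Bochner_Integration.integrable_add integrable_power_G)
  show "(\<lambda>\<omega>. A \<omega> * B \<omega> * (C \<omega> * E \<omega>)) \<in> borel_measurable M"
    using assms[THEN measurable_G] by measurable
  have "\<bar>a * b * (c * e)\<bar> \<le> a ^ 4 + b ^ 4 + c ^ 4 + e ^ 4" for a b c e :: real
  proof -
    have y: "2 * \<bar>x * y\<bar> \<le> x^2 + y^2" for x y :: real
      using sum_squares_bound[of "\<bar>x\<bar>" "\<bar>y\<bar>"] by (simp add: abs_mult)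
    have "2 * \<bar>a * b * (c * e)\<bar> \<le> (a * b)^2 + (c * e)^2" by (rule y)
    moreover have "2 * \<bar>a^2 * b^2\<bar> \<le> (a^2)^2 + (b^2)^2" "2 * \<bar>c^2 * e^2\<bar> \<le> (c^2)^2 + (e^2)^2" by (rule y)+
    moreover have "a ^ 4 \<ge> 0" "b ^ 4 \<ge> 0" "c ^ 4 \<ge> 0" "e ^ 4 \<ge> 0" by auto
    ultimately have "2 * \<bar>a * b * (c * e)\<bar> \<le> 2 * (a ^ 4 + b ^ 4 + c ^ 4 + e ^ 4)"
      by (simp add: power_mult_distrib)
    thus ?thesis
      using abs_ge_zero[of "a * b * (c * e)"] by (simp only: mult_le_cancel_left_pos zero_less_numeral)
  qed
  thus "AE \<omega> in M. norm (A \<omega> * B \<omega> * (C \<omega> * E \<omega>)) \<le> norm (A \<omega> ^ 4 + B \<omega> ^ 4 + C \<omega> ^ 4 + E \<omega> ^ 4)"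
    by (auto intro!: AE_I2 order_trans[OF _ abs_ge_self])
qed

lemma integrable_prod2:
  assumes "A \<in> G" "B \<in> G"
  shows "integrable M (\<lambda>\<omega>. A \<omega> * B \<omega>)"
proof (rule Bochner_Integration.integrable_bound)
  show "integrable M (\<lambda>\<omega>. A \<omega> ^ 2 + B \<omega> ^ 2)"
    using assms by (intro Bochner_Integration.integrable_add integrable_power_G)
  show "(\<lambda>\<omega>. A \<omega> * B \<omega>) \<in> borel_measurable M"
    using assms[THEN measurable_G] by measurable
  have "\<bar>a * b\<bar> \<le> a ^ 2 + b ^ 2" for a b :: real
    using sum_squares_bound[of "\<bar>a\<bar>" "\<bar>b\<bar>"] mult_nonneg_nonneg[of "\<bar>a\<bar>" "\<bar>b\<bar>"]
    by (simp add: abs_mult mult.assoc del: mult_nonneg_nonneg)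
  thus "AE \<omega> in M. norm (A \<omega> * B \<omega>) \<le> norm (A \<omega> ^ 2 + B \<omega> ^ 2)"
    by (auto intro!: AE_I2 order_trans[OF _ abs_ge_self])
qed

lemma integrable_G: "Z \<in> G \<Longrightarrow> integrable M Z"
  using integrable_power_G[of Z 1] by simp

lemma add_G: "Z \<in> G \<Longrightarrow> Z' \<in> G \<Longrightarrow> (\<lambda>\<omega>. Z \<omega> + Z' \<omega>) \<in> G"
  using lincomb[of Z Z' 1 1] by simp

text \<open>All mixed moments used below are read off from the fourth moment of \<open>a U + b Z\<close>, a
  polynomial in \<open>a\<close> and \<open>b\<close> which is even in \<open>b\<close> when \<open>Z\<close> is centred and uncorrelated with \<open>U\<close>.\<close>

lemma fourth_moment:
  assumes U: "U \<in> G" and Z: "Z \<in> G" and Z0: "expectation Z = 0" and UZ: "expectation (\<lambda>\<omega>. U \<omega> * Z \<omega>) = 0"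
  obtains m u z where "expectation (\<lambda>\<omega>. (U \<omega>)^2) = m^2 + u" "expectation (\<lambda>\<omega>. (Z \<omega>)^2) = z"
    "\<And>a b. expectation (\<lambda>\<omega>. (a * U \<omega> + b * Z \<omega>)^4)
       = (a*m)^4 + 6 * (a*m)^2 * (a^2*u + b^2*z) + 3 * (a^2*u + b^2*z)^2"
proof -
  define m where "m = expectation U"
  define z where "z = expectation (\<lambda>\<omega>. (Z \<omega>)^2)"
  define u where "u = expectation (\<lambda>\<omega>. (U \<omega>)^2) - m^2"
  have "expectation (\<lambda>\<omega>. (a * U \<omega> + b * Z \<omega>)^4)
       = (a*m)^4 + 6 * (a*m)^2 * (a^2*u + b^2*z) + 3 * (a^2*u + b^2*z)^2" for a b
  proof -
    obtain m' v' where h: "expectation (\<lambda>\<omega>. a * U \<omega> + b * Z \<omega>) = m'"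
      "expectation (\<lambda>\<omega>. (a * U \<omega> + b * Z \<omega>)^2) = m'^2 + v'"
      "expectation (\<lambda>\<omega>. (a * U \<omega> + b * Z \<omega>)^4) = m'^4 + 6 * m'^2 * v' + 3 * v'^2"
      using gaussian_rv_moments(2)[OF prob_space_axioms gaussian[OF lincomb[OF U Z, of a b]]] by blast
    have m': "m' = a * m"
      using h(1) Z0 integrable_G[OF U] integrable_G[OF Z] by (simp add: m_def)
    have "expectation (\<lambda>\<omega>. (a * U \<omega> + b * Z \<omega>)^2) =
      expectation (\<lambda>\<omega>. a^2 * (U \<omega>)^2 + (2*a*b) * (U \<omega> * Z \<omega>) + b^2 * (Z \<omega>)^2)"
      by (rule Bochner_Integration.integral_cong) (auto simp: power2_eq_square algebra_simps)
    also have "\<dots> = a^2 * expectation (\<lambda>\<omega>. (U \<omega>)^2) + (2*a*b) * expectation (\<lambda>\<omega>. U \<omega> * Z \<omega>) + b^2 * z"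
      using integrable_power_G[OF U, of 2] integrable_power_G[OF Z, of 2] integrable_prod2[OF U Z]
      by (simp add: z_def)
    finally have "v' = a^2 * u + b^2 * z"
      using h(2) UZ m' by (simp add: u_def algebra_simps power_mult_distrib)
    thus ?thesis using h(3) m' by simp
  qed
  thus thesis using that[of m u z] by (auto simp: u_def z_def)
qed

lemma uncorrelated_moments:
  assumes U: "U \<in> G" and Z: "Z \<in> G" and Z0: "expectation Z = 0" and UZ: "expectation (\<lambda>\<omega>. U \<omega> * Z \<omega>) = 0"
  shows "expectation (\<lambda>\<omega>. (U \<omega>)^3 * Z \<omega>) = 0"
    and "expectation (\<lambda>\<omega>. (U \<omega>)^2 * (Z \<omega>)^2) = expectation (\<lambda>\<omega>. (U \<omega>)^2) * expectation (\<lambda>\<omega>. (Z \<omega>)^2)"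
proof -
  obtain m u z where h: "expectation (\<lambda>\<omega>. (U \<omega>)^2) = m^2 + u" "expectation (\<lambda>\<omega>. (Z \<omega>)^2) = z"
    "\<And>a b. expectation (\<lambda>\<omega>. (a * U \<omega> + b * Z \<omega>)^4)
       = (a*m)^4 + 6 * (a*m)^2 * (a^2*u + b^2*z) + 3 * (a^2*u + b^2*z)^2"
    using fourth_moment[OF assms] by blast
  define p where "p = expectation (\<lambda>\<omega>. (U \<omega>)^3 * Z \<omega>)"
  define q where "q = expectation (\<lambda>\<omega>. (U \<omega>)^2 * (Z \<omega>)^2)"
  define r where "r = expectation (\<lambda>\<omega>. U \<omega> * (Z \<omega>)^3)"
  define e1 where "e1 = expectation (\<lambda>\<omega>. (U \<omega>)^4)"
  define e2 where "e2 = expectation (\<lambda>\<omega>. (Z \<omega>)^4)"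
  have I: "integrable M (\<lambda>\<omega>. (U \<omega>)^4)" "integrable M (\<lambda>\<omega>. (Z \<omega>)^4)"
    "integrable M (\<lambda>\<omega>. (U \<omega>)^3 * Z \<omega>)" "integrable M (\<lambda>\<omega>. (U \<omega>)^2 * (Z \<omega>)^2)" "integrable M (\<lambda>\<omega>. U \<omega> * (Z \<omega>)^3)"
    using integrable_power_G[OF U, of 4] integrable_power_G[OF Z, of 4] integrable_prod4[OF U U U Z]
      integrable_prod4[OF U U Z Z] integrable_prod4[OF U Z Z Z]
    by (simp_all add: eval_nat_numeral mult_ac)
  have E: "expectation (\<lambda>\<omega>. (a * U \<omega> + b * Z \<omega>)^4) = a^4*e1 + 4*a^3*b*p + 6*a^2*b^2*q + 4*a*b^3*r + b^4*e2" for a b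
  proof -
    have "expectation (\<lambda>\<omega>. (a * U \<omega> + b * Z \<omega>)^4) = expectation (\<lambda>\<omega>. a^4 * (U \<omega>)^4 +
      (4*a^3*b) * ((U \<omega>)^3 * Z \<omega>) + (6*a^2*b^2) * ((U \<omega>)^2 * (Z \<omega>)^2) + (4*a*b^3) * (U \<omega> * (Z \<omega>)^3) + b^4 * (Z \<omega>)^4)"
      by (rule Bochner_Integration.integral_cong) (auto simp: eval_nat_numeral algebra_simps)
    thus ?thesis using I by (simp add: e1_def e2_def p_def q_def r_def)
  qed
  have X: "a^4*e1 + 4*a^3*b*p + 6*a^2*b^2*q + 4*a*b^3*r + b^4*e2 =
     (a*m)^4 + 6 * (a*m)^2 * (a^2*u + b^2*z) + 3 * (a^2*u + b^2*z)^2" for a b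
    using E[of a b] h(3)[of a b] by simp
  \<comment> \<open>Comparing b = 1 with b = -1 isolates the part odd in b, namely 4 a^3 p + 4 a r =
    0. The values a = 1 and a = 2 give two independent equations, which force p = 0.\<close>
  have "p + r = 0" using X[of 1 1] X[of 1 "-1"] by simp
  moreover have "4 * p + r = 0" using X[of 2 1] X[of 2 "-1"] by simp
  ultimately show "expectation (\<lambda>\<omega>. (U \<omega>)^3 * Z \<omega>) = 0" by (simp add: p_def)
  \<comment> \<open>The even part at a = b = 1, minus the pure fourth moments read off at (1, 0) and
    (0, 1), leaves 6 q.\<close>
  have "q = (m^2 + u) * z"
    using X[of 1 1] X[of 1 "-1"] X[of 1 0] X[of 0 1] by (simp add: power2_eq_square algebra_simps)
  thus "expectation (\<lambda>\<omega>. (U \<omega>)^2 * (Z \<omega>)^2) = expectation (\<lambda>\<omega>. (U \<omega>)^2) * expectation (\<lambda>\<omega>. (Z \<omega>)^2)"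
    using h by (simp add: q_def)
qed

text \<open>Polarization: 24 x y z is the signed sum of the cubes of x \<plusminus> y \<plusminus>
  z, and every combination of the \<open>U\<close>'s is itself uncorrelated with \<open>Z\<close>,
  so each cube contributes nothing.\<close>

lemma triple_uncorrelated:
  assumes U: "U1 \<in> G" "U2 \<in> G" "U3 \<in> G" and Z: "Z \<in> G" and Z0: "expectation Z = 0"
    and c: "expectation (\<lambda>\<omega>. U1 \<omega> * Z \<omega>) = 0" "expectation (\<lambda>\<omega>. U2 \<omega> * Z \<omega>) = 0" "expectation (\<lambda>\<omega>. U3 \<omega> * Z \<omega>) = 0"
  shows "expectation (\<lambda>\<omega>. U1 \<omega> * U2 \<omega> * (U3 \<omega> * Z \<omega>)) = 0"
proof -
  define V where "V = (\<lambda>a b \<omega>. U1 \<omega> + (a * U2 \<omega> + b * U3 \<omega>))"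
  have VG: "V a b \<in> G" for a b unfolding V_def using U by (intro add_G lincomb)
  have "expectation (\<lambda>\<omega>. V a b \<omega> * Z \<omega>) = 0" for a b
    using c integrable_prod2[OF U(1) Z] integrable_prod2[OF U(2) Z] integrable_prod2[OF U(3) Z]
    by (simp add: V_def algebra_simps)
  hence V3: "expectation (\<lambda>\<omega>. (V a b \<omega>)^3 * Z \<omega>) = 0" for a b
    by (intro uncorrelated_moments VG Z Z0)
  have i: "integrable M (\<lambda>\<omega>. (V a b \<omega>)^3 * Z \<omega>)" for a b
    using integrable_prod4[OF VG VG VG Z, of a b a b a b] by (simp add: eval_nat_numeral mult_ac)
  have "expectation (\<lambda>\<omega>. 24 * (U1 \<omega> * U2 \<omega> * (U3 \<omega> * Z \<omega>))) =
    expectation (\<lambda>\<omega>. (V 1 1 \<omega>)^3 * Z \<omega> - (V 1 (-1) \<omega>)^3 * Z \<omega> - (V (-1) 1 \<omega>)^3 * Z \<omega> + (V (-1) (-1) \<omega>)^3 * Z \<omega>)"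
    by (rule Bochner_Integration.integral_cong) (auto simp: V_def eval_nat_numeral algebra_simps)
  also have "\<dots> = 0" using i V3 by simp
  finally show ?thesis by simp
qed

text \<open>In a product of two different terms the noise with the later index is uncorrelated with
  the other three factors, so the expectation vanishes by \<open>triple_uncorrelated\<close>. Mere
  decorrelation takes the place of conditional expectations because everything lives in one Gaussian
  space. Indices with equal time are covered, since the condition on \<open>t\<close> is not
  strict.\<close>

lemma martingale_variance:
  fixes A \<xi> :: "'i \<Rightarrow> 'w \<Rightarrow> real" and t :: "'i \<Rightarrow> nat"
  assumes fin: "finite J" and A: "\<And>i. i \<in> J \<Longrightarrow> A i \<in> G" and \<xi>: "\<And>i. i \<in> J \<Longrightarrow> \<xi> i \<in> G"
    and \<xi>0: "\<And>i. i \<in> J \<Longrightarrow> expectation (\<xi> i) = 0"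
    and \<xi>2: "\<And>i. i \<in> J \<Longrightarrow> expectation (\<lambda>\<omega>. (\<xi> i \<omega>)^2) = s"
    and \<xi>\<xi>: "\<And>i j. i \<in> J \<Longrightarrow> j \<in> J \<Longrightarrow> i \<noteq> j \<Longrightarrow> expectation (\<lambda>\<omega>. \<xi> i \<omega> * \<xi> j \<omega>) = 0"
    and A\<xi>: "\<And>i j. i \<in> J \<Longrightarrow> j \<in> J \<Longrightarrow> t i \<le> t j \<Longrightarrow> expectation (\<lambda>\<omega>. A i \<omega> * \<xi> j \<omega>) = 0"
  shows "expectation (\<lambda>\<omega>. (\<Sum>i\<in>J. c i * A i \<omega> * \<xi> i \<omega>)^2) = s * (\<Sum>i\<in>J. (c i)^2 * expectation (\<lambda>\<omega>. (A i \<omega>)^2))"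
    and "integrable M (\<lambda>\<omega>. (\<Sum>i\<in>J. c i * A i \<omega> * \<xi> i \<omega>)^2)"
proof -
  have e: "(\<Sum>i\<in>J. c i * A i \<omega> * \<xi> i \<omega>)^2 = (\<Sum>i\<in>J. \<Sum>j\<in>J. c i * c j * (A i \<omega> * \<xi> i \<omega> * (A j \<omega> * \<xi> j \<omega>)))" for \<omega>
    by (simp add: power2_eq_square sum_product mult_ac)
  have i: "integrable M (\<lambda>\<omega>. A i \<omega> * \<xi> i \<omega> * (A j \<omega> * \<xi> j \<omega>))" if "i \<in> J" "j \<in> J" for i j
    using that by (intro integrable_prod4 A \<xi>)
  show "integrable M (\<lambda>\<omega>. (\<Sum>i\<in>J. c i * A i \<omega> * \<xi> i \<omega>)^2)"
    unfolding e by (intro Bochner_Integration.integrable_sum integrable_mult_right i)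
  have off: "expectation (\<lambda>\<omega>. A i \<omega> * \<xi> i \<omega> * (A j \<omega> * \<xi> j \<omega>)) = 0" if ij: "i \<in> J" "j \<in> J" "i \<noteq> j" "t i \<le> t j" for i j
    using ij by (intro triple_uncorrelated A \<xi> \<xi>0 \<xi>\<xi> A\<xi>) auto
  have "expectation (\<lambda>\<omega>. A i \<omega> * \<xi> i \<omega> * (A j \<omega> * \<xi> j \<omega>)) =
      (if i = j then s * expectation (\<lambda>\<omega>. (A i \<omega>)^2) else 0)" if ij: "i \<in> J" "j \<in> J" for i j
  proof (cases "i = j")
    case True
    have "expectation (\<lambda>\<omega>. (A i \<omega>)^2 * (\<xi> i \<omega>)^2) = expectation (\<lambda>\<omega>. (A i \<omega>)^2) * s"
      using ij uncorrelated_moments(2)[OF A \<xi> \<xi>0 A\<xi>, of i i] \<xi>2[of i] by simp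
    thus ?thesis using True by (simp add: power2_eq_square mult_ac)
  next
    case False
    show ?thesis
    proof (cases "t i \<le> t j")
      case True thus ?thesis using off[OF ij False] False by simp
    next
      case nle: False
      hence "expectation (\<lambda>\<omega>. A j \<omega> * \<xi> j \<omega> * (A i \<omega> * \<xi> i \<omega>)) = 0" using ij False by (intro off) auto
      thus ?thesis using False by (simp add: mult_ac)
    qed
  qed note cases = this
  have "expectation (\<lambda>\<omega>. (\<Sum>i\<in>J. c i * A i \<omega> * \<xi> i \<omega>)^2)
      = (\<Sum>i\<in>J. \<Sum>j\<in>J. c i * c j * expectation (\<lambda>\<omega>. A i \<omega> * \<xi> i \<omega> * (A j \<omega> * \<xi> j \<omega>)))"
    unfolding e using i
    by (subst Bochner_Integration.integral_sum, intro Bochner_Integration.integrable_sum integrable_mult_right, auto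
      simp: Bochner_Integration.integral_sum)
  also have "\<dots> = (\<Sum>i\<in>J. \<Sum>j\<in>J. if i = j then c i * c j * (s * expectation (\<lambda>\<omega>. (A i \<omega>)^2)) else 0)"
    by (intro sum.cong refl) (auto simp: cases)
  also have "\<dots> = s * (\<Sum>i\<in>J. (c i)^2 * expectation (\<lambda>\<omega>. (A i \<omega>)^2))"
    using fin by (simp add: sum.delta sum_distrib_left power2_eq_square mult_ac)
  finally show "expectation (\<lambda>\<omega>. (\<Sum>i\<in>J. c i * A i \<omega> * \<xi> i \<omega>)^2) = s * (\<Sum>i\<in>J. (c i)^2 * expectation (\<lambda>\<omega>. (A i \<omega>)^2))" .
qed

end

section \<open>Stochastic boundedness of ratios\<close>

lemma bigo_prob_mono:
  assumes "prob_space M" "bigo_prob M Z a" "a \<in> O[at_right 0](b)"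
  shows "bigo_prob M Z b"
  unfolding bigo_prob_def
proof (intro conjI allI impI)
  interpret prob_space M by fact
  show meas: "\<forall>\<^sub>F \<epsilon> in at_right 0. Z \<epsilon> \<in> borel_measurable M" using assms(2) by (simp add: bigo_prob_def)
  obtain c where c: "c > 0" "\<forall>\<^sub>F \<epsilon> in at_right 0. norm (a \<epsilon>) \<le> c * norm (b \<epsilon>)"
    using assms(3) by (elim landau_o.bigE)
  fix \<delta> :: real assume "\<delta> > 0"
  then obtain C where C: "C > 0" "\<forall>\<^sub>F \<epsilon> in at_right 0. measure M {\<omega> \<in> space M. C * \<bar>a \<epsilon>\<bar> < \<bar>Z \<epsilon> \<omega>\<bar>} \<le> \<delta>"
    using assms(2) unfolding bigo_prob_def by blast
  have "\<forall>\<^sub>F \<epsilon> in at_right 0. measure M {\<omega> \<in> space M. (C * c) * \<bar>b \<epsilon>\<bar> < \<bar>Z \<epsilon> \<omega>\<bar>} \<le> \<delta>"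
    using c(2) C(2) meas
  proof eventually_elim
    case (elim \<epsilon>)
    note [measurable] = elim(3)
    have "C * \<bar>a \<epsilon>\<bar> \<le> (C * c) * \<bar>b \<epsilon>\<bar>" using elim(1) C(1) by (simp add: mult.assoc)
    hence "measure M {\<omega> \<in> space M. (C * c) * \<bar>b \<epsilon>\<bar> < \<bar>Z \<epsilon> \<omega>\<bar>} \<le> measure M {\<omega> \<in> space M. C * \<bar>a \<epsilon>\<bar> < \<bar>Z \<epsilon> \<omega>\<bar>}"
      by (intro finite_measure_mono) auto
    thus ?case using elim(2) by simp
  qed
  thus "\<exists>C>0. \<forall>\<^sub>F \<epsilon> in at_right 0. measure M {\<omega> \<in> space M. C * \<bar>b \<epsilon>\<bar> < \<bar>Z \<epsilon> \<omega>\<bar>} \<le> \<delta>"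
    using C(1) c(1) by (intro exI[of _ "C * c"]) simp
qed

lemma bigo_prob_add:
  assumes "prob_space M" "bigo_prob M Y a" "bigo_prob M Z b"
  shows "bigo_prob M (\<lambda>\<epsilon> \<omega>. Y \<epsilon> \<omega> + Z \<epsilon> \<omega>) (\<lambda>\<epsilon>. \<bar>a \<epsilon>\<bar> + \<bar>b \<epsilon>\<bar>)"
  unfolding bigo_prob_def
proof (intro conjI allI impI)
  interpret prob_space M by fact
  have meas: "\<forall>\<^sub>F \<epsilon> in at_right 0. Y \<epsilon> \<in> borel_measurable M" "\<forall>\<^sub>F \<epsilon> in at_right 0. Z \<epsilon> \<in> borel_measurable M"
    using assms(2,3) by (simp_all add: bigo_prob_def)
  show "\<forall>\<^sub>F \<epsilon> in at_right 0. (\<lambda>\<omega>. Y \<epsilon> \<omega> + Z \<epsilon> \<omega>) \<in> borel_measurable M"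
    using meas by eventually_elim auto
  fix \<delta> :: real assume "\<delta> > 0"
  hence "\<delta> / 2 > 0" by simp
  then obtain C D where C: "C > 0" "\<forall>\<^sub>F \<epsilon> in at_right 0. measure M {\<omega> \<in> space M. C * \<bar>a \<epsilon>\<bar> < \<bar>Y \<epsilon> \<omega>\<bar>} \<le> \<delta> / 2"
    and D: "D > 0" "\<forall>\<^sub>F \<epsilon> in at_right 0. measure M {\<omega> \<in> space M. D * \<bar>b \<epsilon>\<bar> < \<bar>Z \<epsilon> \<omega>\<bar>} \<le> \<delta> / 2"
    using assms(2,3) unfolding bigo_prob_def by meson
  define E where "E = max C D"
  have "\<forall>\<^sub>F \<epsilon> in at_right 0. measure M {\<omega> \<in> space M. E * \<bar>\<bar>a \<epsilon>\<bar> + \<bar>b \<epsilon>\<bar>\<bar> < \<bar>Y \<epsilon> \<omega> + Z \<epsilon> \<omega>\<bar>} \<le> \<delta>"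
    using C(2) D(2) meas
  proof eventually_elim
    case (elim \<epsilon>)
    note [measurable] = elim(3,4)
    have "C * \<bar>a \<epsilon>\<bar> \<le> E * \<bar>a \<epsilon>\<bar>" "D * \<bar>b \<epsilon>\<bar> \<le> E * \<bar>b \<epsilon>\<bar>" by (auto simp: E_def intro!: mult_right_mono)
    hence "C * \<bar>a \<epsilon>\<bar> < \<bar>Y \<epsilon> \<omega>\<bar> \<or> D * \<bar>b \<epsilon>\<bar> < \<bar>Z \<epsilon> \<omega>\<bar>"
      if "E * (\<bar>a \<epsilon>\<bar> + \<bar>b \<epsilon>\<bar>) < \<bar>Y \<epsilon> \<omega> + Z \<epsilon> \<omega>\<bar>" for \<omega>
      using that abs_triangle_ineq[of "Y \<epsilon> \<omega>" "Z \<epsilon> \<omega>"] by (simp add: distrib_left) linarith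
    hence "measure M {\<omega> \<in> space M. E * \<bar>\<bar>a \<epsilon>\<bar> + \<bar>b \<epsilon>\<bar>\<bar> < \<bar>Y \<epsilon> \<omega> + Z \<epsilon> \<omega>\<bar>}
       \<le> measure M ({\<omega> \<in> space M. C * \<bar>a \<epsilon>\<bar> < \<bar>Y \<epsilon> \<omega>\<bar>} \<union> {\<omega> \<in> space M. D * \<bar>b \<epsilon>\<bar> < \<bar>Z \<epsilon> \<omega>\<bar>})"
      by (intro finite_measure_mono) auto
    also have "\<dots> \<le> measure M {\<omega> \<in> space M. C * \<bar>a \<epsilon>\<bar> < \<bar>Y \<epsilon> \<omega>\<bar>} + measure M {\<omega> \<in> space M. D * \<bar>b \<epsilon>\<bar> < \<bar>Z \<epsilon> \<omega>\<bar>}"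
      by (intro measure_Un_le) auto
    finally show ?case using elim(1,2) by simp
  qed
  thus "\<exists>C>0. \<forall>\<^sub>F \<epsilon> in at_right 0. measure M {\<omega> \<in> space M. C * \<bar>\<bar>a \<epsilon>\<bar> + \<bar>b \<epsilon>\<bar>\<bar> < \<bar>Y \<epsilon> \<omega> + Z \<epsilon> \<omega>\<bar>} \<le> \<delta>"
    using C(1) by (intro exI[of _ E]) (auto simp: E_def)
qed

text \<open>Unless \<open>I\<close> deviates from its mean by at least c n / 2, it satisfies |I|
  \<ge> c n / 2, and then a large \<open>Z\<close> forces a large \<open>P\<close>. Chebyshev
  controls the deviation and Markov controls P^2. The identity Z I = P is asked for almost surely
  and only where I is nonzero, because the equation behind it holds almost surely and the estimator
  contains \<open>inverse (I \<epsilon> \<omega>)\<close>.\<close>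

lemma bigo_prob_ratio:
  assumes "prob_space M"
    and Z: "\<forall>\<^sub>F \<epsilon> in at_right 0. Z \<epsilon> \<in> borel_measurable M"
    and I: "\<forall>\<^sub>F \<epsilon> in at_right 0. I \<epsilon> \<in> borel_measurable M \<and> integrable M (\<lambda>\<omega>. (I \<epsilon> \<omega>)^2)"
    and P: "\<forall>\<^sub>F \<epsilon> in at_right 0. P \<epsilon> \<in> borel_measurable M \<and> integrable M (\<lambda>\<omega>. (P \<epsilon> \<omega>)^2)"
    and eq: "\<forall>\<^sub>F \<epsilon> in at_right 0. AE \<omega> in M. I \<epsilon> \<omega> \<noteq> 0 \<longrightarrow> Z \<epsilon> \<omega> * I \<epsilon> \<omega> = P \<epsilon> \<omega>"
    and a: "\<forall>\<^sub>F \<epsilon> in at_right 0. a \<epsilon> > 0" and n: "\<forall>\<^sub>F \<epsilon> in at_right 0. n \<epsilon> > 0"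
    and EI: "(\<lambda>\<epsilon>. \<integral>\<omega>. I \<epsilon> \<omega> \<partial>M) \<in> \<Omega>[at_right 0](n)"
    and VI: "(\<lambda>\<epsilon>. prob_space.variance M (I \<epsilon>)) \<in> o[at_right 0](\<lambda>\<epsilon>. (n \<epsilon>)\<^sup>2)"
    and EP: "(\<lambda>\<epsilon>. \<integral>\<omega>. (P \<epsilon> \<omega>)\<^sup>2 \<partial>M) \<in> O[at_right 0](\<lambda>\<epsilon>. (a \<epsilon> * n \<epsilon>)\<^sup>2)"
  shows "bigo_prob M Z a"
  unfolding bigo_prob_def
proof (intro conjI allI impI)
  interpret prob_space M by fact
  show "\<forall>\<^sub>F \<epsilon> in at_right 0. Z \<epsilon> \<in> borel_measurable M" by fact
  fix \<delta> :: real assume \<delta>: "\<delta> > 0"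
  obtain c where c: "c > 0" "\<forall>\<^sub>F \<epsilon> in at_right 0. norm (expectation (I \<epsilon>)) \<ge> c * norm (n \<epsilon>)"
    using EI by (elim landau_omega.bigE)
  obtain K where K: "K > 0" "\<forall>\<^sub>F \<epsilon> in at_right 0. norm (expectation (\<lambda>\<omega>. (P \<epsilon> \<omega>)\<^sup>2)) \<le> K * norm ((a \<epsilon> * n \<epsilon>)\<^sup>2)"
    using EP by (elim landau_o.bigE)
  \<comment> \<open>The factor \<delta> c^2 / 8 makes the Chebyshev bound at distance c n / 2 equal
    to \<delta> / 2.\<close>
  have V: "\<forall>\<^sub>F \<epsilon> in at_right 0. norm (variance (I \<epsilon>)) \<le> (\<delta> * c^2 / 8) * norm ((n \<epsilon>)\<^sup>2)"
    using VI by (rule landau_o.smallD) (use \<delta> c in auto)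
  \<comment> \<open>Solves 4 K / (C^2 c^2) = \<delta> / 2, the Markov bound for the second
    event.\<close>
  define C where "C = sqrt (8 * K / (\<delta> * c^2))"
  have C: "C > 0" using \<delta> c K by (simp add: C_def)
  have C2: "C^2 = 8 * K / (\<delta> * c^2)" using \<delta> c K by (simp add: C_def)
  have "\<forall>\<^sub>F \<epsilon> in at_right 0. measure M {\<omega> \<in> space M. C * \<bar>a \<epsilon>\<bar> < \<bar>Z \<epsilon> \<omega>\<bar>} \<le> \<delta>"
    using c(2) K(2) V Z I P eq a n
  proof eventually_elim
    case (elim \<epsilon>)
    have [measurable]: "Z \<epsilon> \<in> borel_measurable M" "I \<epsilon> \<in> borel_measurable M" "P \<epsilon> \<in> borel_measurable M"
      using elim by auto
    have n: "n \<epsilon> > 0" and a: "a \<epsilon> > 0" using elim by auto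
    let ?A = "{\<omega> \<in> space M. \<bar>I \<epsilon> \<omega> - expectation (I \<epsilon>)\<bar> \<ge> c * n \<epsilon> / 2}"
    let ?B = "{\<omega> \<in> space M. (P \<epsilon> \<omega>)^2 \<ge> (C * a \<epsilon> * (c * n \<epsilon> / 2))^2}"
    have "AE \<omega> in M. \<omega> \<in> {\<omega> \<in> space M. C * \<bar>a \<epsilon>\<bar> < \<bar>Z \<epsilon> \<omega>\<bar>} \<longrightarrow> \<omega> \<in> ?A \<union> ?B"
      using elim(7) AE_space
    proof eventually_elim
      case w: (elim \<omega>)
      show ?case
      proof (intro impI)
        assume "\<omega> \<in> {\<omega> \<in> space M. C * \<bar>a \<epsilon>\<bar> < \<bar>Z \<epsilon> \<omega>\<bar>}"
        hence h: "\<omega> \<in> space M" "C * a \<epsilon> < \<bar>Z \<epsilon> \<omega>\<bar>" using a by auto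
        show "\<omega> \<in> ?A \<union> ?B"
        proof (cases "\<bar>I \<epsilon> \<omega> - expectation (I \<epsilon>)\<bar> \<ge> c * n \<epsilon> / 2")
          case False
          hence I: "\<bar>I \<epsilon> \<omega>\<bar> \<ge> c * n \<epsilon> / 2" using elim(1) n by (simp add: abs_if split: if_splits)
          hence "I \<epsilon> \<omega> \<noteq> 0" using c(1) n by (metis abs_zero half_gt_zero less_le_not_le mult_pos_pos)
          hence "P \<epsilon> \<omega> = Z \<epsilon> \<omega> * I \<epsilon> \<omega>" using w(1) by simp
          moreover have "C * a \<epsilon> * (c * n \<epsilon> / 2) \<le> \<bar>Z \<epsilon> \<omega>\<bar> * \<bar>I \<epsilon> \<omega>\<bar>"
            by (intro mult_mono) (use h I c n in auto)
          ultimately have "C * a \<epsilon> * (c * n \<epsilon> / 2) \<le> \<bar>P \<epsilon> \<omega>\<bar>" by (simp add: abs_mult)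
          hence "(C * a \<epsilon> * (c * n \<epsilon> / 2))^2 \<le> \<bar>P \<epsilon> \<omega>\<bar>^2"
            by (rule power_mono) (use C a c n in auto)
          thus ?thesis using h by simp
        qed (use h in simp)
      qed
    qed
    hence "measure M {\<omega> \<in> space M. C * \<bar>a \<epsilon>\<bar> < \<bar>Z \<epsilon> \<omega>\<bar>} \<le> measure M (?A \<union> ?B)"
      by (intro finite_measure_mono_AE) auto
    also have "\<dots> \<le> measure M ?A + measure M ?B" by (intro measure_Un_le) auto
    also have "measure M ?A \<le> variance (I \<epsilon>) / (c * n \<epsilon> / 2)^2"
      using elim(5) c n by (intro Chebyshev_inequality) auto
    also have "variance (I \<epsilon>) / (c * n \<epsilon> / 2)^2 \<le> \<delta> / 2"
      using elim(3) c n by (simp add: field_simps power2_eq_square)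
    also have "measure M ?B \<le> expectation (\<lambda>\<omega>. (P \<epsilon> \<omega>)\<^sup>2) / (C * a \<epsilon> * (c * n \<epsilon> / 2))^2"
      using elim(6) C a c n by (intro integral_Markov_inequality_measure[where A="{}"]) auto
    also have "\<dots> \<le> (K * (a \<epsilon> * n \<epsilon>)^2) / (C * a \<epsilon> * (c * n \<epsilon> / 2))^2"
      using elim(2) by (intro divide_right_mono) auto
    also have "\<dots> = 4 * K / (C^2 * c^2)"
      using C a c n by (simp add: power_mult_distrib power_divide field_simps)
    also have "\<dots> = \<delta> / 2"
      unfolding C2 using \<delta> c K by (simp add: field_simps)
    finally show ?case by simp
  qed
  thus "\<exists>C>0. \<forall>\<^sub>F \<epsilon> in at_right 0. measure M {\<omega> \<in> space M. C * \<bar>a \<epsilon>\<bar> < \<bar>Z \<epsilon> \<omega>\<bar>} \<le> \<delta>"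
    using C by blast
qed

section \<open>The Hilbert space \<open>L\<^sup>2\<close>\<close>

lemma L2_measurable: "f \<in> L2 A \<Longrightarrow> f \<in> borel_measurable (lebesgue_on A)"
  and L2_integrable_square: "f \<in> L2 A \<Longrightarrow> integrable (lebesgue_on A) (\<lambda>x. (f x)\<^sup>2)"
  by (auto simp: L2_def)

lemma L2_integrable_mult:
  assumes "f \<in> L2 A" "g \<in> L2 A"
  shows "integrable (lebesgue_on A) (\<lambda>x. f x * g x)"
proof (rule Bochner_Integration.integrable_bound)
  show "integrable (lebesgue_on A) (\<lambda>x. (f x)\<^sup>2 + (g x)\<^sup>2)"
    using assms by (intro Bochner_Integration.integrable_add L2_integrable_square)
  show "(\<lambda>x. f x * g x) \<in> borel_measurable (lebesgue_on A)"
    using assms[THEN L2_measurable] by measurable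
  have "\<bar>a * b\<bar> \<le> a ^ 2 + b ^ 2" for a b :: real
    using sum_squares_bound[of "\<bar>a\<bar>" "\<bar>b\<bar>"] mult_nonneg_nonneg[of "\<bar>a\<bar>" "\<bar>b\<bar>"]
    by (simp add: abs_mult mult.assoc del: mult_nonneg_nonneg)
  thus "AE x in lebesgue_on A. norm (f x * g x) \<le> norm ((f x)\<^sup>2 + (g x)\<^sup>2)"
    by (auto intro!: AE_I2 order_trans[OF _ abs_ge_self])
qed

lemma L2_lincomb:
  assumes "f \<in> L2 A" "g \<in> L2 A"
  shows "(\<lambda>x. a * f x + b * g x) \<in> L2 A"
proof -
  have "(\<lambda>x. a * f x + b * g x) \<in> borel_measurable (lebesgue_on A)"
    using assms[THEN L2_measurable] by measurable
  moreover have "integrable (lebesgue_on A) (\<lambda>x. a^2 * (f x)\<^sup>2 + (2*a*b) * (f x * g x) + b^2 * (g x)^2)"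
    using assms by (intro Bochner_Integration.integrable_add integrable_mult_right L2_integrable_square L2_integrable_mult)
  moreover have "(\<lambda>x. a^2 * (f x)\<^sup>2 + (2*a*b) * (f x * g x) + b^2 * (g x)^2) = (\<lambda>x. (a * f x + b * g x)^2)"
    by (auto simp: power2_eq_square algebra_simps)
  ultimately show ?thesis by (simp add: L2_def)
qed

lemma L2_zero [simp]: "(\<lambda>x. 0) \<in> L2 A"
  by (simp add: L2_def)

lemma L2_add: "f \<in> L2 A \<Longrightarrow> g \<in> L2 A \<Longrightarrow> (\<lambda>x. f x + g x) \<in> L2 A"
  using L2_lincomb[of f A g 1 1] by simp

lemma L2_diff: "f \<in> L2 A \<Longrightarrow> g \<in> L2 A \<Longrightarrow> (\<lambda>x. f x - g x) \<in> L2 A"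
  using L2_lincomb[of f A g 1 "-1"] by simp

lemma L2_mult: "f \<in> L2 A \<Longrightarrow> (\<lambda>x. a * f x) \<in> L2 A"
  using L2_lincomb[of f A f a 0] by simp

lemma L2_sum: "(\<And>i. i \<in> F \<Longrightarrow> f i \<in> L2 A) \<Longrightarrow> (\<lambda>x. \<Sum>i\<in>F. c i * f i x) \<in> L2 A"
proof (induction F rule: infinite_finite_induct)
  case (insert i F)
  thus ?case using L2_add[OF L2_mult[of "f i" A "c i"]] by simp
qed auto

lemma ip_commute: "ip A f g = ip A g f"
  by (simp add: ip_def mult.commute)

lemma ip_lincomb:
  assumes "f \<in> L2 A" "g \<in> L2 A" "h \<in> L2 A"
  shows "ip A (\<lambda>x. a * f x + b * g x) h = a * ip A f h + b * ip A g h"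
    and "ip A h (\<lambda>x. a * f x + b * g x) = a * ip A h f + b * ip A h g"
proof -
  have "ip A (\<lambda>x. a * f x + b * g x) h = (\<integral>x. a * (f x * h x) + b * (g x * h x) \<partial>lebesgue_on A)"
    by (simp add: ip_def algebra_simps)
  also have "\<dots> = a * ip A f h + b * ip A g h"
    using assms by (simp add: ip_def L2_integrable_mult)
  finally show 1: "ip A (\<lambda>x. a * f x + b * g x) h = a * ip A f h + b * ip A g h" .
  show "ip A h (\<lambda>x. a * f x + b * g x) = a * ip A h f + b * ip A h g"
    using 1 by (simp add: ip_commute[of A h])
qed

lemma ip_cong_AE:
  assumes "f \<in> L2 A" "g \<in> L2 A" "f' \<in> L2 A" "g' \<in> L2 A"
    and "AE x in lebesgue_on A. f x = f' x" "AE x in lebesgue_on A. g x = g' x"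
  shows "ip A f g = ip A f' g'"
  unfolding ip_def
proof (rule integral_cong_AE)
  show "AE x in lebesgue_on A. f x * g x = f' x * g' x"
    using assms(5,6) by eventually_elim simp
qed (use assms(1-4)[THEN L2_measurable] in measurable)

lemma nrm_cong_AE:
  assumes "f \<in> L2 A" "g \<in> L2 A" "AE x in lebesgue_on A. f x = g x"
  shows "nrm A f = nrm A g"
  using ip_cong_AE[of f A f g g] assms by (simp add: nrm_def)

lemma ip_nonneg: "ip A f f \<ge> 0"
  by (simp add: ip_def)

lemma nrm_nonneg [simp]: "nrm A f \<ge> 0"
  by (simp add: nrm_def ip_nonneg)

lemma nrm_square: "(nrm A f)\<^sup>2 = ip A f f"
  by (simp add: nrm_def ip_nonneg)

lemma nrm_zero [simp]: "nrm A (\<lambda>x. 0) = 0"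
  by (simp add: nrm_def ip_def)

lemma nrm_mult: "nrm A (\<lambda>x. a * f x) = \<bar>a\<bar> * nrm A f"
proof -
  have "ip A (\<lambda>x. a * f x) (\<lambda>x. a * f x) = a^2 * ip A f f"
    unfolding ip_def by (subst integral_mult_right_zero[symmetric]) (simp add: power2_eq_square mult_ac)
  thus ?thesis by (simp add: nrm_def real_sqrt_mult)
qed

lemma nrm_minus_commute: "nrm A (\<lambda>x. f x - g x) = nrm A (\<lambda>x. g x - f x)"
  using nrm_mult[of A "-1" "\<lambda>x. f x - g x"] by simp

lemma ip_Cauchy_Schwarz:
  assumes f: "f \<in> L2 A" and g: "g \<in> L2 A"
  shows "\<bar>ip A f g\<bar> \<le> nrm A f * nrm A g"
proof -
  have q: "0 \<le> ip A f f + 2 * t * ip A f g + t^2 * ip A g g" for t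
  proof -
    let ?h = "\<lambda>x. 1 * f x + t * g x"
    have "ip A ?h ?h = ip A f ?h + t * ip A g ?h"
      using ip_lincomb(1)[OF f g L2_lincomb[OF f g], of 1 t 1 t] by simp
    also have "\<dots> = ip A f f + t * ip A f g + t * (ip A g f + t * ip A g g)"
      using ip_lincomb(2)[OF f g f, of 1 t] ip_lincomb(2)[OF f g g, of 1 t] by simp
    finally show ?thesis using ip_nonneg[of A ?h] by (simp add: ip_commute[of A g f] power2_eq_square algebra_simps)
  qed
  have "(ip A f g)^2 \<le> ip A f f * ip A g g"
  proof (cases "ip A g g = 0")
    case True
    have "ip A f g = 0"
    proof (rule ccontr)
      assume "ip A f g \<noteq> 0"
      thus False using q[of "- (ip A f f + 1) / (2 * ip A f g)"] True by (simp add: field_simps)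
    qed
    thus ?thesis using True by simp
  next
    case False
    hence p: "ip A g g > 0" using ip_nonneg[of A g] by simp
    have "0 \<le> ip A f f - (ip A f g)^2 / ip A g g"
      using q[of "- ip A f g / ip A g g"] p by (simp add: field_simps power2_eq_square)
    thus ?thesis using p by (simp add: field_simps)
  qed
  hence "(ip A f g)^2 \<le> (nrm A f * nrm A g)^2"
    by (simp add: power_mult_distrib nrm_square)
  thus ?thesis by (metis abs_le_square_iff abs_of_nonneg mult_nonneg_nonneg nrm_nonneg)
qed

lemma nrm_triangle:
  assumes f: "f \<in> L2 A" and g: "g \<in> L2 A"
  shows "nrm A (\<lambda>x. f x + g x) \<le> nrm A f + nrm A g"
proof (rule power2_le_imp_le)
  let ?h = "\<lambda>x. 1 * f x + 1 * g x"
  have "ip A ?h ?h = ip A f ?h + ip A g ?h"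
    using ip_lincomb(1)[OF f g L2_lincomb[OF f g], of 1 1 1 1] by simp
  also have "\<dots> = ip A f f + ip A f g + (ip A g f + ip A g g)"
    using ip_lincomb(2)[OF f g f, of 1 1] ip_lincomb(2)[OF f g g, of 1 1] by simp
  finally show "(nrm A (\<lambda>x. f x + g x))\<^sup>2 \<le> (nrm A f + nrm A g)\<^sup>2"
    using ip_Cauchy_Schwarz[OF f g] by (simp add: nrm_square power2_sum ip_commute[of A g f])
qed simp

lemma nrm_triangle_diff:
  assumes "f \<in> L2 A" "g \<in> L2 A" "h \<in> L2 A"
  shows "nrm A (\<lambda>x. f x - h x) \<le> nrm A (\<lambda>x. f x - g x) + nrm A (\<lambda>x. g x - h x)"
  using nrm_triangle[of "\<lambda>x. f x - g x" A "\<lambda>x. g x - h x"] assms L2_diff by (simp add: L2_diff)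

lemma nrm_reverse_triangle:
  assumes f: "f \<in> L2 A" and g: "g \<in> L2 A"
  shows "nrm A f - nrm A g \<le> nrm A (\<lambda>x. f x - g x)"
  using nrm_triangle[of "\<lambda>x. f x - g x" A g] assms L2_diff[OF f g] by simp

lemma nrm_le_of_nn_integral:
  assumes "f \<in> borel_measurable (lebesgue_on A)" "b \<ge> 0"
    and "(\<integral>\<^sup>+x. ennreal ((f x)\<^sup>2) \<partial>lebesgue_on A) \<le> ennreal (b^2)"
  shows "f \<in> L2 A" "nrm A f \<le> b"
proof -
  have [measurable]: "f \<in> borel_measurable (lebesgue_on A)" by fact
  have i: "integrable (lebesgue_on A) (\<lambda>x. (f x)\<^sup>2)"
    using le_less_trans[OF assms(3)] by (intro integrableI_nonneg) auto
  thus "f \<in> L2 A" by (simp add: L2_def)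
  have "ennreal (\<integral>x. (f x)\<^sup>2 \<partial>lebesgue_on A) \<le> ennreal (b^2)"
    using assms(3) nn_integral_eq_integral[OF i] by simp
  hence "(nrm A f)^2 \<le> b^2"
    unfolding nrm_square by (simp add: ip_def power2_eq_square ennreal_le_iff)
  thus "nrm A f \<le> b" using assms(2) by (rule power2_le_imp_le)
qed

lemma nn_integral_nrm:
  assumes "f \<in> L2 A"
  shows "(\<integral>\<^sup>+x. ennreal ((f x)\<^sup>2) \<partial>lebesgue_on A) = ennreal ((nrm A f)\<^sup>2)"
  using nn_integral_eq_integral[OF L2_integrable_square[OF assms]]
  unfolding nrm_square by (simp add: ip_def power2_eq_square)

lemma nrm_sum_le:
  assumes "\<And>i. i \<in> F \<Longrightarrow> f i \<in> L2 A" "\<And>i. i \<in> F \<Longrightarrow> nrm A (f i) \<le> 1"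
  shows "nrm A (\<lambda>x. \<Sum>i\<in>F. c i * f i x) \<le> (\<Sum>i\<in>F. \<bar>c i\<bar>)"
  using assms
proof (induction F rule: infinite_finite_induct)
  case (insert i F)
  have "nrm A (\<lambda>x. c i * f i x + (\<Sum>i\<in>F. c i * f i x)) \<le> nrm A (\<lambda>x. c i * f i x) + nrm A (\<lambda>x. \<Sum>i\<in>F. c i * f i x)"
    using insert by (intro nrm_triangle L2_mult L2_sum) auto
  also have "\<dots> \<le> \<bar>c i\<bar> + (\<Sum>i\<in>F. \<bar>c i\<bar>)"
    using insert by (intro add_mono) (auto simp: nrm_mult mult_left_le)
  finally show ?case using insert by simp
qed auto

text \<open>The instance of completeness needed for the gliding hump, with an explicit rate. Since
  the sum of 3^(-k) f_k^2 has finite integral and |f_k| \<le> 1 + f_k^2, the series converges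
  absolutely almost everywhere; Fatou's lemma then bounds its tail by the geometric tail 3/2 *
  3^(-n).\<close>

lemma L2_series:
  assumes f: "\<And>k. f k \<in> L2 A" and f1: "\<And>k. nrm A (f k) \<le> 1" and c: "\<And>k. \<bar>c k\<bar> \<le> (1/3)^k"
  obtains y where "y \<in> L2 A" "\<And>n. nrm A (\<lambda>x. y x - (\<Sum>k<n. c k * f k x)) \<le> 3/2 * (1/3)^n"
proof -
  let ?\<mu> = "lebesgue_on A"
  have [measurable]: "f k \<in> borel_measurable ?\<mu>" for k using f by (rule L2_measurable)
  define y where "y = (\<lambda>x. \<Sum>k. c k * f k x)"
  have [measurable]: "y \<in> borel_measurable ?\<mu>" unfolding y_def by measurable
  have ae: "AE x in ?\<mu>. summable (\<lambda>k. c k * f k x)"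
  proof -
    have "(\<integral>\<^sup>+x. (\<Sum>k. ennreal ((1/3)^k * (f k x)^2)) \<partial>?\<mu>) = (\<Sum>k. \<integral>\<^sup>+x. ennreal ((1/3)^k * (f k x)^2) \<partial>?\<mu>)"
      by (intro nn_integral_suminf) measurable
    also have "\<dots> \<le> (\<Sum>k. ennreal ((1/3)^k))"
    proof (intro suminf_le)
      fix k
      have "(\<integral>\<^sup>+x. ennreal ((1/3)^k * (f k x)^2) \<partial>?\<mu>) = ennreal ((1/3)^k) * ennreal ((nrm A (f k))^2)"
        by (subst nn_integral_nrm[OF f, symmetric]) (simp add: ennreal_mult nn_integral_cmult)
      also have "\<dots> \<le> ennreal ((1/3)^k) * 1"
        using f1[of k] by (intro mult_left_mono) (auto simp: power_le_one)
      finally show "(\<integral>\<^sup>+x. ennreal ((1/3)^k * (f k x)^2) \<partial>?\<mu>) \<le> ennreal ((1/3)^k)" by simp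
    qed auto
    also have "\<dots> = ennreal (\<Sum>k. (1/3)^k)"
      by (intro suminf_ennreal2 summable_geometric) auto
    finally have "(\<integral>\<^sup>+x. (\<Sum>k. ennreal ((1/3)^k * (f k x)^2)) \<partial>?\<mu>) \<noteq> \<infinity>"
      by (auto simp: top_unique)
    hence "AE x in ?\<mu>. (\<Sum>k. ennreal ((1/3)^k * (f k x)^2)) \<noteq> \<infinity>"
      by (intro nn_integral_noteq_infinite) measurable
    thus ?thesis
    proof eventually_elim
      case (elim x)
      hence s: "summable (\<lambda>k. (1/3)^k * (f k x)^2)" by (intro summable_suminf_not_top) auto
      have "summable (\<lambda>k. (1/3)^k + (1/3)^k * (f k x)^2)"
        by (intro summable_add s summable_geometric) auto
      moreover have "norm (c k * f k x) \<le> (1/3)^k + (1/3)^k * (f k x)^2" for k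
      proof -
        have "\<bar>f k x\<bar> \<le> 1 + (f k x)^2"
          using sum_squares_bound[of "\<bar>f k x\<bar>" 1] by simp
        hence "\<bar>c k\<bar> * \<bar>f k x\<bar> \<le> (1/3)^k * (1 + (f k x)^2)" using c[of k] by (intro mult_mono) auto
        thus ?thesis by (simp add: abs_mult algebra_simps)
      qed
      ultimately show ?case by (rule summable_comparison_test')
    qed
  qed
  have key: "(\<lambda>x. y x - (\<Sum>k<n. c k * f k x)) \<in> L2 A \<and> nrm A (\<lambda>x. y x - (\<Sum>k<n. c k * f k x)) \<le> 3/2 * (1/3)^n" for n
  proof -
    let ?d = "\<lambda>m x. \<Sum>k=n..<m. c k * f k x"
    have geo: "(\<Sum>k=n..<m. \<bar>c k\<bar>) \<le> 3/2 * (1/3)^n" for m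
    proof (cases "n \<le> m")
      case True
      have "(\<Sum>k=n..<m. \<bar>c k\<bar>) \<le> (\<Sum>k=n..<m. (1/3)^k)" by (intro sum_mono c)
      also have "\<dots> = ((1/3)^n - (1/3)^m) * (3/2)"
        using True by (induction m rule: dec_induct) auto
      also have "\<dots> \<le> 3/2 * (1/3)^n" by simp
      finally show ?thesis .
    qed simp
    have "(\<integral>\<^sup>+x. ennreal ((y x - (\<Sum>k<n. c k * f k x))^2) \<partial>?\<mu>) = (\<integral>\<^sup>+x. liminf (\<lambda>m. ennreal ((?d m x)^2)) \<partial>?\<mu>)"
    proof (rule nn_integral_cong_AE)
      show "AE x in ?\<mu>. ennreal ((y x - (\<Sum>k<n. c k * f k x))^2) = liminf (\<lambda>m. ennreal ((?d m x)^2))"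
        using ae
      proof eventually_elim
        case (elim x)
        hence "(\<lambda>m. \<Sum>k<m. c k * f k x) \<longlonglongrightarrow> y x" unfolding y_def by (rule summable_LIMSEQ)
        hence "(\<lambda>m. (\<Sum>k<m. c k * f k x) - (\<Sum>k<n. c k * f k x)) \<longlonglongrightarrow> y x - (\<Sum>k<n. c k * f k x)"
          by (intro tendsto_intros)
        moreover have "\<forall>\<^sub>F m in sequentially. (\<Sum>k<m. c k * f k x) - (\<Sum>k<n. c k * f k x) = ?d m x"
          using eventually_ge_at_top[of n]
          by eventually_elim (simp add: lessThan_atLeast0 sum_diff_nat_ivl)
        ultimately have "(\<lambda>m. ?d m x) \<longlonglongrightarrow> y x - (\<Sum>k<n. c k * f k x)"
          by (rule Lim_transform_eventually)
        hence "(\<lambda>m. ennreal ((?d m x)^2)) \<longlonglongrightarrow> ennreal ((y x - (\<Sum>k<n. c k * f k x))^2)"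
          by (intro tendsto_intros tendsto_ennrealI)
        thus ?case by (intro lim_imp_Liminf[symmetric]) auto
      qed
    qed
    also have "\<dots> \<le> liminf (\<lambda>m. \<integral>\<^sup>+x. ennreal ((?d m x)^2) \<partial>?\<mu>)"
      by (intro nn_integral_liminf) measurable
    also have "\<dots> \<le> limsup (\<lambda>m. \<integral>\<^sup>+x. ennreal ((?d m x)^2) \<partial>?\<mu>)"
      by (intro Liminf_le_Limsup) simp
    also have "\<dots> \<le> ennreal ((3/2 * (1/3)^n)^2)"
    proof (intro Limsup_bounded always_eventually allI)
      fix m
      have "nrm A (?d m) \<le> 3/2 * (1/3)^n"
        using nrm_sum_le[of "{n..<m}" f A c] f f1 geo[of m] by simp
      hence "(nrm A (?d m))^2 \<le> (3/2 * (1/3)^n)^2" by (intro power_mono) auto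
      moreover have "?d m \<in> L2 A" by (intro L2_sum f)
      ultimately show "(\<integral>\<^sup>+x. ennreal ((?d m x)^2) \<partial>?\<mu>) \<le> ennreal ((3/2 * (1/3)^n)^2)"
        by (simp add: nn_integral_nrm ennreal_leI)
    qed
    finally show ?thesis
      using nrm_le_of_nn_integral[of "\<lambda>x. y x - (\<Sum>k<n. c k * f k x)" A "3/2 * (1/3)^n"] by simp
  qed
  from key[of 0] have "y \<in> L2 A" by simp
  thus thesis using that key by blast
qed

section \<open>Strongly continuous semigroups\<close>

locale l2_semigroup =
  fixes D :: "'a::euclidean_space set" and S :: "real \<Rightarrow> ('a \<Rightarrow> real) \<Rightarrow> 'a \<Rightarrow> real"
  assumes semigroup: "C0_semigroup D S"
begin

lemma S_L2: "t \<ge> 0 \<Longrightarrow> f \<in> L2 D \<Longrightarrow> S t f \<in> L2 D"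
  using semigroup by (simp add: C0_semigroup_def)

lemma S_lincomb: "t \<ge> 0 \<Longrightarrow> f \<in> L2 D \<Longrightarrow> g \<in> L2 D \<Longrightarrow>
    AE x in lebesgue_on D. S t (\<lambda>y. a * f y + b * g y) x = a * S t f x + b * S t g x"
  using semigroup by (simp add: C0_semigroup_def)

lemma S_0: "f \<in> L2 D \<Longrightarrow> AE x in lebesgue_on D. S 0 f x = f x"
  using semigroup by (simp add: C0_semigroup_def)

lemma S_add: "s \<ge> 0 \<Longrightarrow> t \<ge> 0 \<Longrightarrow> f \<in> L2 D \<Longrightarrow> AE x in lebesgue_on D. S (s + t) f x = S s (S t f) x"
  using semigroup by (simp add: C0_semigroup_def)

lemma S_tendsto_0: "f \<in> L2 D \<Longrightarrow> ((\<lambda>t. nrm D (\<lambda>x. S t f x - f x)) \<longlongrightarrow> 0) (at_right 0)"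
  using semigroup by (simp add: C0_semigroup_def)

lemma S_bounded: "t \<ge> 0 \<Longrightarrow> \<exists>C. \<forall>f\<in>L2 D. nrm D (S t f) \<le> C * nrm D f"
  using semigroup by (simp add: C0_semigroup_def)

lemma nrm_S_lincomb:
  assumes "t \<ge> 0" "f \<in> L2 D" "g \<in> L2 D"
  shows "nrm D (S t (\<lambda>y. a * f y + b * g y)) = nrm D (\<lambda>x. a * S t f x + b * S t g x)"
  using assms by (intro nrm_cong_AE S_lincomb S_L2 L2_lincomb) auto

lemma nrm_S_diff:
  assumes "t \<ge> 0" "f \<in> L2 D" "g \<in> L2 D"
  shows "nrm D (\<lambda>x. S t f x - S t g x) = nrm D (S t (\<lambda>y. f y - g y))"
  using nrm_S_lincomb[OF assms, of 1 "-1"] by simp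

lemma nrm_S_mult:
  assumes "t \<ge> 0" "f \<in> L2 D"
  shows "nrm D (S t (\<lambda>y. a * f y)) = \<bar>a\<bar> * nrm D (S t f)"
  using nrm_S_lincomb[OF assms(1,2,2), of a 0] by (simp add: nrm_mult)

text \<open>\<open>N\<close> is the operator norm of \<open>S t\<close>, written as a supremum over
  the unit ball. The supremum need not be attained, so only two thirds of it is claimed; C < N makes
  \<open>N\<close> positive and hence 2/3 N strictly smaller than the supremum.\<close>

lemma near_norming_element:
  assumes t: "t \<ge> 0" and C: "\<exists>f\<in>L2 D. nrm D (S t f) > C * nrm D f" "C > 0"
  obtains f N where "f \<in> L2 D" "nrm D f \<le> 1" "N > C" "nrm D (S t f) \<ge> 2/3 * N"
    "\<And>g. g \<in> L2 D \<Longrightarrow> nrm D (S t g) \<le> N * nrm D g"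
proof -
  obtain C' where C': "\<forall>f\<in>L2 D. nrm D (S t f) \<le> C' * nrm D f" using S_bounded[OF t] by blast
  have z: "nrm D (S t f) = 0" if "f \<in> L2 D" "nrm D f = 0" for f
    using bspec[OF C' that(1)] that(2) nrm_nonneg[of D "S t f"] by simp
  define A where "A = {nrm D (S t f) | f. f \<in> L2 D \<and> nrm D f \<le> 1}"
  define N where "N = Sup A"
  have "\<bar>C'\<bar> \<ge> a" if aA: "a \<in> A" for a
  proof -
    obtain f where f: "f \<in> L2 D" "nrm D f \<le> 1" "a = nrm D (S t f)" using aA unfolding A_def by blast
    have "a \<le> C' * nrm D f" using C' f by auto
    also have "\<dots> \<le> \<bar>C'\<bar> * 1" using f by (intro mult_mono) auto
    finally show ?thesis by simp
  qed
  hence bdd: "bdd_above A" by (auto simp: bdd_above_def)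
  have "nrm D (S t (\<lambda>x. 0)) \<in> A" unfolding A_def using L2_zero[of D] nrm_zero[of D] by fastforce
  hence A0: "A \<noteq> {}" by blast
  have normalize: "nrm D g > 0 \<Longrightarrow> g \<in> L2 D \<Longrightarrow> nrm D (S t g) / nrm D g \<in> A" for g
    using nrm_S_mult[OF t, of g "1 / nrm D g"] L2_mult[of g D "1 / nrm D g"] nrm_mult[of D "1 / nrm D g" g]
    unfolding A_def by (intro CollectI exI[of _ "\<lambda>x. 1 / nrm D g * g x"]) auto
  have le: "nrm D (S t g) \<le> N * nrm D g" if g: "g \<in> L2 D" for g
  proof (cases "nrm D g = 0")
    case False
    hence p: "nrm D g > 0" by (simp add: less_le)
    have "nrm D (S t g) / nrm D g \<le> N" unfolding N_def by (rule cSup_upper[OF normalize[OF p g] bdd])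
    thus ?thesis using p by (simp add: field_simps)
  qed (use z g in simp)
  obtain f0 where f0: "f0 \<in> L2 D" "nrm D (S t f0) > C * nrm D f0" using C by blast
  have "nrm D f0 \<noteq> 0" using z f0 by force
  hence p: "nrm D f0 > 0" by (simp add: less_le)
  have "C < N" using le[OF f0(1)] f0(2) p by (meson less_le_trans mult_less_cancel_right_pos)
  hence "2/3 * N < Sup A" using C by (simp add: N_def)
  then obtain a where "a \<in> A" "2/3 * N < a" using less_cSup_iff[OF A0 bdd] by blast
  then obtain f where "f \<in> L2 D" "nrm D f \<le> 1" "2/3 * N < nrm D (S t f)" by (auto simp: A_def)
  thus thesis using that[of f N] \<open>C < N\<close> le by auto
qed

text \<open>Uniform boundedness near time 0, by a gliding hump in place of Baire's theorem: the signs in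
  the series \<open>\<Sum>n. \<plusminus> 3\<^sup>-\<^sup>n f\<^sub>n\<close> of near-norming elements are chosen so that no term is cancelled
  by the preceding ones.\<close>

lemma S_locally_bounded_0:
  "\<exists>\<delta>>0. \<exists>C>0. \<forall>t\<in>{0..\<delta>}. \<forall>f\<in>L2 D. nrm D (S t f) \<le> C * nrm D f"
proof (rule ccontr)
  assume neg: "\<not> ?thesis"
  \<comment> \<open>The threshold 6 * 3^n * (n + 1) is chosen for the final estimate: the signal
    exceeds the tail of the series by N 3^(-n) / 6, which is then at least n + 1.\<close>
  have "\<exists>t f N. 0 \<le> t \<and> t \<le> 1 / Suc n \<and> f \<in> L2 D \<and> nrm D f \<le> 1 \<and> N > 6 * 3^n * real (Suc n) \<and>
      nrm D (S t f) \<ge> 2/3 * N \<and> (\<forall>g\<in>L2 D. nrm D (S t g) \<le> N * nrm D g)" for n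
  proof -
    have "\<exists>t\<in>{0..1 / Suc n}. \<exists>f\<in>L2 D. nrm D (S t f) > (6 * 3^n * real (Suc n)) * nrm D f"
    proof (rule ccontr)
      assume "\<not> ?thesis"
      hence "\<forall>t\<in>{0..1 / Suc n}. \<forall>f\<in>L2 D. nrm D (S t f) \<le> (6 * 3^n * real (Suc n)) * nrm D f"
        by (auto simp: not_less algebra_simps)
      moreover have "1 / real (Suc n) > 0" "6 * 3^n * real (Suc n) > 0" by simp_all
      ultimately have "\<exists>\<delta>>0. \<exists>C>0. \<forall>t\<in>{0..\<delta>}. \<forall>f\<in>L2 D. nrm D (S t f) \<le> C * nrm D f"
        by - (rule exI[of _ "1 / real (Suc n)"], rule conjI, assumption, rule exI[of _ "6 * 3^n * real (Suc n)"], rule conjI)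
      with neg show False by (rule notE)
    qed
    then obtain t where t: "t \<in> {0..1 / Suc n}" "\<exists>f\<in>L2 D. nrm D (S t f) > (6 * 3^n * real (Suc n)) * nrm D f"
      by blast
    have "t \<ge> 0" using t by simp
    have pos: "6 * 3^n * real (Suc n) > 0" by simp
    then obtain f and N :: real where "f \<in> L2 D" "nrm D f \<le> 1" "N > 6 * 3^n * real (Suc n)" "nrm D (S t f) \<ge> 2/3 * N"
      "\<And>g. g \<in> L2 D \<Longrightarrow> nrm D (S t g) \<le> N * nrm D g"
      using near_norming_element[OF \<open>t \<ge> 0\<close> t(2)] pos by blast
    thus ?thesis using t by (intro exI[of _ t] exI[of _ f] exI[of _ N]) auto
  qed
  then obtain t f N where t: "\<And>n. 0 \<le> t n" "\<And>n. t n \<le> 1 / Suc n"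
    and f: "\<And>n. f n \<in> L2 D" "\<And>n. nrm D (f n) \<le> 1"
    and N: "\<And>n. N n > 6 * 3^n * real (Suc n)" "\<And>n. nrm D (S (t n) (f n)) \<ge> 2/3 * N n"
      "\<And>n g. g \<in> L2 D \<Longrightarrow> nrm D (S (t n) g) \<le> N n * nrm D g"
    by metis
  define step where "step = (\<lambda>n (x :: 'a \<Rightarrow> real).
    if nrm D (S (t n) (\<lambda>y. x y + (1/3)^n * f n y)) \<ge> (1/3)^n * nrm D (S (t n) (f n)) then 1 else -1 :: real)"
  define x where "x = rec_nat (\<lambda>_. 0 :: real) (\<lambda>n x y. x y + step n x * (1/3)^n * f n y)"
  define c where "c = (\<lambda>n. step n (x n) * (1/3)^n)"
  have x_Suc: "x (Suc n) = (\<lambda>y. x n y + c n * f n y)" for n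
    by (simp add: x_def c_def)
  have x_sum: "x n = (\<lambda>y. \<Sum>k<n. c k * f k y)" for n
    by (induction n) (simp_all add: x_Suc, simp add: x_def)
  have c_le: "\<bar>c n\<bar> \<le> (1/3)^n" for n by (simp add: c_def step_def abs_mult)
  have xL2: "x n \<in> L2 D" for n unfolding x_sum by (intro L2_sum f)
  \<comment> \<open>Twice 3^(-n) S f_n is the difference of the images of x_n + 3^(-n) f_n and x_n -
    3^(-n) f_n. By the triangle inequality at least one of the two images has norm at least 3^(-n)
    times that of S f_n, and \<open>step\<close> picks that sign.\<close>
  have hump: "nrm D (S (t n) (x (Suc n))) \<ge> (1/3)^n * nrm D (S (t n) (f n))" for n
  proof (rule ccontr)
    assume small: "\<not> ?thesis"
    let ?p = "\<lambda>y. x n y + (1/3)^n * f n y" and ?m = "\<lambda>y. x n y - (1/3)^n * f n y"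
    have p: "?p \<in> L2 D" "?m \<in> L2 D" using xL2 f by (auto intro!: L2_add L2_diff L2_mult)
    have "nrm D (S (t n) ?p) < (1/3)^n * nrm D (S (t n) (f n)) \<and> nrm D (S (t n) ?m) < (1/3)^n * nrm D (S (t n) (f n))"
      using small by (auto simp: x_Suc c_def step_def not_le split: if_splits)
    moreover have "2 * ((1/3)^n * nrm D (S (t n) (f n))) = nrm D (S (t n) (\<lambda>y. ?p y - ?m y))"
      using nrm_S_mult[of "t n" "f n" "2 * (1/3)^n", OF t(1) f(1)] by (simp add: abs_mult mult_ac)
    moreover have "\<dots> = nrm D (\<lambda>y. S (t n) ?p y - S (t n) ?m y)" using t p by (intro nrm_S_diff[symmetric]) auto
    moreover have "\<dots> \<le> nrm D (S (t n) ?p) + nrm D (S (t n) ?m)"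
      using nrm_triangle[OF S_L2[OF t(1)[of n] p(1)] L2_mult[where a="-1", OF S_L2[OF t(1)[of n] p(2)]]]
        nrm_mult[of D "-1" "S (t n) ?m"] by simp
    ultimately show False by linarith
  qed
  obtain y where y: "y \<in> L2 D" "\<And>n. nrm D (\<lambda>z. y z - x n z) \<le> 3/2 * (1/3)^n"
    using L2_series[of f D c] f c_le unfolding x_sum by blast
  \<comment> \<open>The hump contributes at least 2/3 N 3^(-n), while everything after step n is
    damped to at most N * 3/2 * 3^(-n-1) = 1/2 N 3^(-n).\<close>
  have big: "nrm D (S (t n) y) \<ge> Suc n" for n
  proof -
    have "nrm D (S (t n) (x (Suc n))) - nrm D (S (t n) y) \<le> nrm D (\<lambda>z. S (t n) (x (Suc n)) z - S (t n) y z)"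
      by (intro nrm_reverse_triangle S_L2 t xL2 y)
    also have "\<dots> = nrm D (S (t n) (\<lambda>z. x (Suc n) z - y z))" by (intro nrm_S_diff t xL2 y)
    also have "\<dots> \<le> N n * nrm D (\<lambda>z. x (Suc n) z - y z)" by (intro N L2_diff xL2 y)
    also have "\<dots> \<le> N n * (3/2 * (1/3)^Suc n)"
      using y(2)[of "Suc n"] N(1)[of n] nrm_minus_commute[of D y "x (Suc n)"]
      by (intro mult_left_mono) (auto intro!: less_imp_le[OF le_less_trans[OF _ N(1)[of n]]])
    finally have 1: "nrm D (S (t n) y) \<ge> nrm D (S (t n) (x (Suc n))) - N n * (1/2 * (1/3)^n)" by simp
    have "(1/3)^n * (2/3 * N n) \<le> (1/3)^n * nrm D (S (t n) (f n))" by (intro mult_left_mono N) auto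
    hence 2: "nrm D (S (t n) (x (Suc n))) \<ge> (1/3)^n * (2/3 * N n)" using hump[of n] by linarith
    have "(1/3)^n * (2/3 * N n) - N n * (1/2 * (1/3)^n) = N n * ((1/3)^n / 6)" by (simp add: field_simps)
    also have "\<dots> \<ge> (6 * 3^n * real (Suc n)) * ((1/3)^n / 6)" using N(1)[of n] by (intro mult_right_mono) auto
    also have "(6 * 3^n * real (Suc n)) * ((1/3)^n / 6) = Suc n"  by (simp add: power_one_over)
    finally show ?thesis using 1 2 by linarith
  qed
  \<comment> \<open>Strong continuity at 0 keeps the norms of \<open>S t y\<close> bounded for small
    t, whereas t n tends to 0 and the norms at t n exceed every bound.\<close>
  obtain \<delta> where \<delta>: "\<delta> > 0" "\<And>s. 0 < s \<Longrightarrow> s < \<delta> \<Longrightarrow> nrm D (\<lambda>z. S s y z - y z) < 1"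
    using order_tendstoD(2)[OF S_tendsto_0[OF y(1)], of 1] by (auto simp: eventually_at_right_field)
  obtain m where m: "1 / Suc m < \<delta>" using \<delta>(1) nat_approx_posE by blast
  obtain k where k: "real k > nrm D y + 1" using reals_Archimedean2 by blast
  define n where "n = max m k"
  have tn: "t n < \<delta>"
  proof -
    have "t n \<le> 1 / Suc n" by (rule t)
    also have "\<dots> \<le> 1 / Suc m" by (simp add: n_def frac_le)
    finally show ?thesis using m by simp
  qed
  have "nrm D (S (t n) y) \<le> nrm D y + 1"
  proof (cases "t n = 0")
    case True
    have "nrm D (S 0 y) = nrm D y" by (intro nrm_cong_AE S_L2 S_0 y) auto
    thus ?thesis using True by simp
  next
    case False
    hence "nrm D (\<lambda>z. S (t n) y z - y z) < 1" using t(1)[of n] tn by (intro \<delta>) auto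
    thus ?thesis using nrm_reverse_triangle[OF S_L2[OF t(1) y(1)] y(1), of n] by linarith
  qed
  moreover have "real (Suc n) \<ge> real k" by (simp add: n_def)
  ultimately show False using big[of n] k by linarith
qed

text \<open>The semigroup law carries the bound near 0 forward in steps of length \<delta>, at the
  price of one factor \<open>E\<close> per step. Taking E \<ge> 1 lets one power serve all smaller
  times.\<close>

lemma S_locally_bounded:
  "\<exists>C>0. \<forall>t\<in>{0..R}. \<forall>f\<in>L2 D. nrm D (S t f) \<le> C * nrm D f"
proof -
  obtain \<delta> C where d: "\<delta> > 0" "C > 0" and C: "\<And>t f. 0 \<le> t \<Longrightarrow> t \<le> \<delta> \<Longrightarrow> f \<in> L2 D \<Longrightarrow> nrm D (S t f) \<le> C * nrm D f"
    using S_locally_bounded_0 by auto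
  define E where "E = max 1 C"
  have E: "\<And>t f. 0 \<le> t \<Longrightarrow> t \<le> \<delta> \<Longrightarrow> f \<in> L2 D \<Longrightarrow> nrm D (S t f) \<le> E * nrm D f"
    by (rule order_trans[OF C]) (auto simp: E_def intro!: mult_right_mono)
  have E1: "E \<ge> 1" by (simp add: E_def)
  have *: "\<forall>t f. 0 \<le> t \<longrightarrow> t \<le> n * \<delta> \<longrightarrow> f \<in> L2 D \<longrightarrow> nrm D (S t f) \<le> E ^ Suc n * nrm D f" for n :: nat
  proof (induction n)
    case 0
    thus ?case using E d by auto
  next
    case (Suc n)
    show ?case
    proof (intro allI impI)
      fix t f assume t: "0 \<le> t" "t \<le> Suc n * \<delta>" and f: "f \<in> L2 D"
      show "nrm D (S t f) \<le> E ^ Suc (Suc n) * nrm D f"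
      proof (cases "t \<le> \<delta>")
        case True
        have "E * nrm D f \<le> E ^ Suc (Suc n) * nrm D f"
          using E1 by (intro mult_right_mono self_le_power) auto
        thus ?thesis using E[OF t(1) True f] by linarith
      next
        case False
        have "nrm D (S (\<delta> + (t - \<delta>)) f) = nrm D (S \<delta> (S (t - \<delta>) f))"
          using False d f by (intro nrm_cong_AE S_add S_L2) auto
        also have "\<dots> \<le> E * nrm D (S (t - \<delta>) f)" using False d f by (intro E S_L2) auto
        also have "\<dots> \<le> E * (E ^ Suc n * nrm D f)"
          using E1 False d f t Suc by (intro mult_left_mono) (auto simp: algebra_simps)
        finally show ?thesis by simp
      qed
    qed
  qed
  obtain n :: nat where "R / \<delta> < n" using reals_Archimedean2 by blast
  hence "R \<le> n * \<delta>" using d by (simp add: field_simps)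
  thus ?thesis using *[of n] E1 by (intro exI[of _ "E ^ Suc n"]) auto
qed

text \<open>Continuity of an L2-valued map. Elements are represented by functions and
  \<open>nrm\<close> is not the metric of a type, so continuity is expressed through the real
  function that measures the distance to the value at \<open>p\<close>.\<close>

definition L2cont :: "'p::metric_space set \<Rightarrow> ('p \<Rightarrow> 'a \<Rightarrow> real) \<Rightarrow> bool" where
  "L2cont U \<phi> \<longleftrightarrow> (\<forall>p\<in>U. \<phi> p \<in> L2 D \<and> continuous (at p within U) (\<lambda>q. nrm D (\<lambda>x. \<phi> q x - \<phi> p x)))"

lemma L2cont_iff:
  "L2cont U \<phi> \<longleftrightarrow> (\<forall>p\<in>U. \<phi> p \<in> L2 D \<and> ((\<lambda>q. nrm D (\<lambda>x. \<phi> q x - \<phi> p x)) \<longlongrightarrow> 0) (at p within U))"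
  by (simp add: L2cont_def continuous_within)

lemma L2cont_compose:
  assumes "L2cont V \<phi>" "continuous_on U g" "g ` U \<subseteq> V"
  shows "L2cont U (\<lambda>p. \<phi> (g p))"
  unfolding L2cont_def
proof (intro ballI conjI)
  fix p assume p: "p \<in> U"
  show "\<phi> (g p) \<in> L2 D" using assms p by (auto simp: L2cont_def)
  have "continuous (at (g p) within g ` U) (\<lambda>q. nrm D (\<lambda>x. \<phi> q x - \<phi> (g p) x))"
    by (rule continuous_within_subset[of _ V]) (use assms p in \<open>auto simp: L2cont_def\<close>)
  moreover have "continuous (at p within U) g" using assms(2) p by (simp add: continuous_on_eq_continuous_within)
  ultimately have "continuous (at p within U) ((\<lambda>q. nrm D (\<lambda>x. \<phi> q x - \<phi> (g p) x)) \<circ> g)"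
    by (intro continuous_within_compose)
  thus "continuous (at p within U) (\<lambda>q. nrm D (\<lambda>x. \<phi> (g q) x - \<phi> (g p) x))" by (simp add: o_def)
qed

lemma L2cont_lincomb:
  assumes "L2cont U \<phi>" "L2cont U \<psi>"
  shows "L2cont U (\<lambda>p x. a * \<phi> p x + b * \<psi> p x)"
  unfolding L2cont_iff
proof (intro ballI conjI)
  fix p assume p: "p \<in> U"
  have L: "\<phi> q \<in> L2 D" "\<psi> q \<in> L2 D" if "q \<in> U" for q using assms that by (auto simp: L2cont_iff)
  show "(\<lambda>x. a * \<phi> p x + b * \<psi> p x) \<in> L2 D" using L p by (intro L2_lincomb)
  have lim: "((\<lambda>q. \<bar>a\<bar> * nrm D (\<lambda>x. \<phi> q x - \<phi> p x) + \<bar>b\<bar> * nrm D (\<lambda>x. \<psi> q x - \<psi> p x)) \<longlongrightarrow> \<bar>a\<bar> * 0 + \<bar>b\<bar> * 0) (at p within U)"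
    using assms p by (intro tendsto_intros) (auto simp: L2cont_iff)
  have bd: "nrm D (\<lambda>x. (a * \<phi> q x + b * \<psi> q x) - (a * \<phi> p x + b * \<psi> p x))
      \<le> \<bar>a\<bar> * nrm D (\<lambda>x. \<phi> q x - \<phi> p x) + \<bar>b\<bar> * nrm D (\<lambda>x. \<psi> q x - \<psi> p x)" if "q \<in> U" for q
  proof -
    have "(\<lambda>x. (a * \<phi> q x + b * \<psi> q x) - (a * \<phi> p x + b * \<psi> p x)) = (\<lambda>x. a * (\<phi> q x - \<phi> p x) + b * (\<psi> q x - \<psi> p x))"
      by (auto simp: algebra_simps)
    thus ?thesis
      using nrm_triangle[of "\<lambda>x. a * (\<phi> q x - \<phi> p x)" D "\<lambda>x. b * (\<psi> q x - \<psi> p x)"] L[OF that] L[OF p]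
      by (simp only: nrm_mult L2_mult L2_diff)
  qed
  show "((\<lambda>q. nrm D (\<lambda>x. (a * \<phi> q x + b * \<psi> q x) - (a * \<phi> p x + b * \<psi> p x))) \<longlongrightarrow> 0) (at p within U)"
    by (rule Lim_null_comparison[OF _ lim[simplified]]) (auto simp: eventually_at_filter bd)
qed

lemma L2cont_ip:
  assumes "L2cont U \<phi>" "L2cont U \<psi>"
  shows "continuous_on U (\<lambda>p. ip D (\<phi> p) (\<psi> p))"
  unfolding continuous_on_def
proof (intro ballI)
  fix p assume p: "p \<in> U"
  have L: "\<phi> q \<in> L2 D" "\<psi> q \<in> L2 D" if "q \<in> U" for q using assms that by (auto simp: L2cont_iff)
  let ?f = "\<lambda>q. nrm D (\<lambda>x. \<phi> q x - \<phi> p x)" and ?g = "\<lambda>q. nrm D (\<lambda>x. \<psi> q x - \<psi> p x)"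
  have lim: "((\<lambda>q. ?f q * (?g q + nrm D (\<psi> p)) + nrm D (\<phi> p) * ?g q) \<longlongrightarrow> 0 * (0 + nrm D (\<psi> p)) + nrm D (\<phi> p) * 0) (at p within U)"
    using assms p by (intro tendsto_intros) (auto simp: L2cont_iff)
  have bd: "\<bar>ip D (\<phi> q) (\<psi> q) - ip D (\<phi> p) (\<psi> p)\<bar> \<le> ?f q * (?g q + nrm D (\<psi> p)) + nrm D (\<phi> p) * ?g q"
    if q: "q \<in> U" for q
  proof -
    have "ip D (\<phi> q) (\<psi> q) - ip D (\<phi> p) (\<psi> p) = ip D (\<lambda>x. \<phi> q x - \<phi> p x) (\<psi> q) + ip D (\<phi> p) (\<lambda>x. \<psi> q x - \<psi> p x)"
      using ip_lincomb(1)[of "\<phi> q" D "\<phi> p" "\<psi> q" 1 "-1"] ip_lincomb(2)[of "\<psi> q" D "\<psi> p" "\<phi> p" 1 "-1"] L[OF q] L[OF p] by simp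
    moreover have "\<bar>ip D (\<lambda>x. \<phi> q x - \<phi> p x) (\<psi> q)\<bar> \<le> ?f q * nrm D (\<psi> q)"
      using L q p by (intro ip_Cauchy_Schwarz L2_diff) auto
    moreover have "\<bar>ip D (\<phi> p) (\<lambda>x. \<psi> q x - \<psi> p x)\<bar> \<le> nrm D (\<phi> p) * ?g q"
      using L q p by (intro ip_Cauchy_Schwarz L2_diff) auto
    moreover have "?f q * nrm D (\<psi> q) \<le> ?f q * (?g q + nrm D (\<psi> p))"
      using nrm_reverse_triangle[of "\<psi> q" D "\<psi> p"] L q p by (intro mult_left_mono) auto
    ultimately show ?thesis by linarith
  qed
  have "((\<lambda>q. ip D (\<phi> q) (\<psi> q) - ip D (\<phi> p) (\<psi> p)) \<longlongrightarrow> 0) (at p within U)"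
    by (rule Lim_null_comparison[OF _ lim[simplified]]) (auto simp: eventually_at_filter bd)
  thus "((\<lambda>q. ip D (\<phi> q) (\<psi> q)) \<longlongrightarrow> ip D (\<phi> p) (\<psi> p)) (at p within U)" by (rule LIM_zero_cancel)
qed

text \<open>By the semigroup law the increment between two times is \<open>S\<close> at the smaller
  time applied to S u f - f, with u the distance of the times. The local bound reduces both
  one-sided limits to strong continuity at 0.\<close>

lemma L2cont_S_const:
  assumes f: "f \<in> L2 D"
  shows "L2cont {0..} (\<lambda>r. S r f)"
  unfolding L2cont_iff
proof (intro ballI conjI)
  fix r assume "r \<in> {0::real..}"
  hence r: "r \<ge> 0" by simp
  show "S r f \<in> L2 D" by (intro S_L2 r f)
  obtain C where C: "C > 0" "\<And>t g. t \<in> {0..r+1} \<Longrightarrow> g \<in> L2 D \<Longrightarrow> nrm D (S t g) \<le> C * nrm D g"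
    using S_locally_bounded[of "r + 1"] by blast
  \<comment> \<open>The value at 0 is prescribed so that the right-hand limit becomes continuity at
    0 and can be composed with \<bar>q - r\<bar>.\<close>
  define \<omega> where "\<omega> = (\<lambda>u. if u = 0 then 0 else nrm D (\<lambda>x. S u f x - f x))"
  have bd: "nrm D (\<lambda>x. S (a + u) f x - S a f x) \<le> C * \<omega> u" if a: "0 \<le> a" "a \<le> r + 1" "u \<ge> 0" for a u
  proof (cases "u = 0")
    case False
    have "nrm D (\<lambda>x. S (a + u) f x - S a f x) = nrm D (\<lambda>x. S a (S u f) x - S a f x)"
    proof (intro nrm_cong_AE L2_diff S_L2 f)
      show "AE x in lebesgue_on D. S (a + u) f x - S a f x = S a (S u f) x - S a f x"
        using S_add[OF a(1,3) f] by eventually_elim simp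
    qed (use a in auto)
    also have "\<dots> = nrm D (S a (\<lambda>x. S u f x - f x))" using a f by (intro nrm_S_diff S_L2) auto
    also have "\<dots> \<le> C * nrm D (\<lambda>x. S u f x - f x)" using a f by (intro C L2_diff S_L2) auto
    finally show ?thesis using False by (simp add: \<omega>_def)
  qed (simp add: \<omega>_def)
  have "((\<lambda>u. \<omega> u) \<longlongrightarrow> 0) (at_right 0)"
    by (rule Lim_transform_eventually[OF S_tendsto_0[OF f]]) (auto simp: \<omega>_def eventually_at_filter)
  hence "continuous (at 0 within {0..}) \<omega>"
    by (simp add: continuous_within \<omega>_def at_within_Ici_at_right)
  moreover have "continuous (at r within {0..}) (\<lambda>q. \<bar>q - r\<bar>)" by (intro continuous_intros)
  ultimately have "continuous (at r within {0..}) (\<omega> \<circ> (\<lambda>q. \<bar>q - r\<bar>))"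
    by (intro continuous_within_compose) (auto intro: continuous_within_subset[of _ "{0..}"])
  hence "((\<lambda>q. \<omega> \<bar>q - r\<bar>) \<longlongrightarrow> 0) (at r within {0..})"
    by (simp add: continuous_within o_def) (simp add: \<omega>_def)
  hence "((\<lambda>q. C * \<omega> \<bar>q - r\<bar>) \<longlongrightarrow> C * 0) (at r within {0..})"
    by (intro tendsto_intros)
  moreover have "\<forall>\<^sub>F q in at r within {0..}. norm (nrm D (\<lambda>x. S q f x - S r f x)) \<le> C * \<omega> \<bar>q - r\<bar>"
  proof -
    have "nrm D (\<lambda>x. S q f x - S r f x) \<le> C * \<omega> \<bar>q - r\<bar>" if "q \<ge> 0" for q
    proof (cases "q \<ge> r")
      case True thus ?thesis using bd[of r "q - r"] r by simp
    next
      case False thus ?thesis using bd[of q "r - q"] r that by (simp add: nrm_minus_commute[of D "S q f"])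
    qed
    thus ?thesis by (auto simp: eventually_at_filter)
  qed
  ultimately show "((\<lambda>q. nrm D (\<lambda>x. S q f x - S r f x)) \<longlongrightarrow> 0) (at r within {0..})"
    by (simp add: Lim_null_comparison)
qed

text \<open>Joint continuity in time and argument: the locally uniform operator bound absorbs the
  change of argument, strong continuity the change of time.\<close>

lemma S_tendsto:
  assumes \<phi>: "\<forall>\<^sub>F q in F. \<phi> q \<in> L2 D" "l \<in> L2 D" "((\<lambda>q. nrm D (\<lambda>x. \<phi> q x - l x)) \<longlongrightarrow> 0) F"
    and \<rho>: "(\<rho> \<longlongrightarrow> r) F" "\<forall>\<^sub>F q in F. \<rho> q \<ge> 0" "r \<ge> 0"
  shows "((\<lambda>q. nrm D (\<lambda>x. S (\<rho> q) (\<phi> q) x - S r l x)) \<longlongrightarrow> 0) F"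
proof -
  obtain C where C: "C > 0" "\<And>t g. t \<in> {0..r+1} \<Longrightarrow> g \<in> L2 D \<Longrightarrow> nrm D (S t g) \<le> C * nrm D g"
    using S_locally_bounded[of "r + 1"] by blast
  \<comment> \<open>Truncating the time at 0 gives a function continuous on the whole line, so that
    the limit along an arbitrary filter is a composition.\<close>
  have "isCont (\<lambda>t. nrm D (\<lambda>x. S (max 0 t) l x - S r l x)) r"
  proof -
    have "L2cont UNIV (\<lambda>t. S (max 0 t) l)"
      by (rule L2cont_compose[OF L2cont_S_const[OF \<phi>(2)]]) (auto intro!: continuous_intros)
    moreover have "max 0 r = r" using \<rho>(3) by simp
    ultimately show ?thesis unfolding L2cont_def by (metis UNIV_I)
  qed
  from isCont_tendsto_compose[OF this \<rho>(1)]
  have "((\<lambda>q. nrm D (\<lambda>x. S (max 0 (\<rho> q)) l x - S r l x)) \<longlongrightarrow> 0) F"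
    using \<rho>(3) by (simp add: max_def)
  with \<phi>(3) have "((\<lambda>q. C * nrm D (\<lambda>x. \<phi> q x - l x) + nrm D (\<lambda>x. S (max 0 (\<rho> q)) l x - S r l x)) \<longlongrightarrow> C * 0 + 0) F"
    by (intro tendsto_intros)
  moreover have "\<forall>\<^sub>F q in F. norm (nrm D (\<lambda>x. S (\<rho> q) (\<phi> q) x - S r l x)) \<le>
      C * nrm D (\<lambda>x. \<phi> q x - l x) + nrm D (\<lambda>x. S (max 0 (\<rho> q)) l x - S r l x)"
  proof -
    have "\<forall>\<^sub>F q in F. \<rho> q < r + 1" using \<rho>(1) by (rule order_tendstoD(2)) simp
    with \<phi>(1) \<rho>(2) show ?thesis
    proof eventually_elim
      case (elim q)
      have q: "\<rho> q \<in> {0..r + 1}" using elim by auto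
      have "nrm D (\<lambda>x. S (\<rho> q) (\<phi> q) x - S (\<rho> q) l x) = nrm D (S (\<rho> q) (\<lambda>x. \<phi> q x - l x))"
        using q elim \<phi> by (intro nrm_S_diff) auto
      also have "\<dots> \<le> C * nrm D (\<lambda>x. \<phi> q x - l x)" by (intro C q L2_diff elim \<phi>)
      finally show ?case
        using nrm_triangle_diff[OF S_L2[OF elim(2,1)] S_L2[OF elim(2) \<phi>(2)] S_L2[OF \<rho>(3) \<phi>(2)]] elim(2)
        by (simp add: max_def)
    qed
  qed
  ultimately show ?thesis by (simp add: Lim_null_comparison)
qed

lemma ip_tendsto:
  assumes "\<forall>\<^sub>F q in F. \<phi> q \<in> L2 D" "l \<in> L2 D" "((\<lambda>q. nrm D (\<lambda>x. \<phi> q x - l x)) \<longlongrightarrow> 0) F" "g \<in> L2 D"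
  shows "((\<lambda>q. ip D g (\<phi> q)) \<longlongrightarrow> ip D g l) F"
proof -
  have "((\<lambda>q. nrm D g * nrm D (\<lambda>x. \<phi> q x - l x)) \<longlongrightarrow> nrm D g * 0) F" using assms by (intro tendsto_intros)
  moreover have "\<forall>\<^sub>F q in F. norm (ip D g (\<phi> q) - ip D g l) \<le> nrm D g * nrm D (\<lambda>x. \<phi> q x - l x)"
    using assms(1)
  proof eventually_elim
    case (elim q)
    have "ip D g (\<phi> q) - ip D g l = ip D g (\<lambda>x. \<phi> q x - l x)"
      using ip_lincomb(2)[OF elim assms(2,4), of 1 "-1"] by simp
    thus ?case using ip_Cauchy_Schwarz[OF assms(4) L2_diff[OF elim assms(2)]] by simp
  qed
  ultimately have "((\<lambda>q. ip D g (\<phi> q) - ip D g l) \<longlongrightarrow> 0) F" by (simp add: Lim_null_comparison)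
  thus ?thesis by (rule LIM_zero_cancel)
qed

lemma L2cont_S:
  assumes \<phi>: "L2cont U \<phi>" and \<rho>: "continuous_on U \<rho>" "\<And>p. p \<in> U \<Longrightarrow> \<rho> p \<ge> 0"
  shows "L2cont U (\<lambda>p. S (\<rho> p) (\<phi> p))"
  unfolding L2cont_iff
proof (intro ballI conjI)
  fix p assume p: "p \<in> U"
  have L: "\<phi> q \<in> L2 D" if "q \<in> U" for q using \<phi> that by (auto simp: L2cont_iff)
  show "S (\<rho> p) (\<phi> p) \<in> L2 D" by (intro S_L2 L \<rho> p)
  show "((\<lambda>q. nrm D (\<lambda>x. S (\<rho> q) (\<phi> q) x - S (\<rho> p) (\<phi> p) x)) \<longlongrightarrow> 0) (at p within U)"
    using \<phi> \<rho> p L by (intro S_tendsto) (auto simp: L2cont_iff continuous_on_def eventually_at_filter)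
qed

text \<open>Both one-sided difference quotients at \<open>r\<close> are \<open>S\<close> at the smaller of the two times applied to a
  difference quotient at time 0.\<close>

lemma S_deriv:
  assumes f: "f \<in> L2 D" and u: "u \<in> L2 D" and r: "r \<ge> 0"
    and gen: "((\<lambda>h. nrm D (\<lambda>x. (S h f x - f x) / h - u x)) \<longlongrightarrow> 0) (at_right 0)"
  shows "((\<lambda>q. nrm D (\<lambda>x. (S q f x - S r f x) / (q - r) - S r u x)) \<longlongrightarrow> 0) (at r within {0..})"
proof -
  define d where "d = (\<lambda>h x. (S h f x - f x) / h)"
  have dL2: "d h \<in> L2 D" if "h > 0" for h
    using L2_lincomb[OF S_L2[of h f] f, of "1/h" "-1/h"] that f by (simp add: d_def diff_divide_distrib)
  have eq: "nrm D (\<lambda>x. (S q f x - S r f x) / (q - r) - S r u x) = nrm D (\<lambda>x. S (min q r) (d \<bar>q - r\<bar>) x - S r u x)"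
    if q: "q \<ge> 0" "q \<noteq> r" for q
  proof (intro nrm_cong_AE L2_diff S_L2 dL2 u r)
    define m h where "m = min q r" and "h = \<bar>q - r\<bar>"
    have mh: "m \<ge> 0" "h > 0" using q r by (auto simp: m_def h_def)
    have Sh: "S h f \<in> L2 D" using mh f by (intro S_L2) auto
    show "(\<lambda>x. (S q f x - S r f x) / (q - r)) \<in> L2 D"
      using L2_lincomb[OF S_L2[OF q(1) f] S_L2[OF r f], of "1/(q-r)" "-1/(q-r)"] by (simp add: diff_divide_distrib)
    have "AE x in lebesgue_on D. S m (d h) x = (1/h) * S m (S h f) x + (-1/h) * S m f x"
      using S_lincomb[OF mh(1) Sh f, of "1/h" "-1/h"] by (simp add: d_def diff_divide_distrib)
    moreover have "AE x in lebesgue_on D. S (m + h) f x = S m (S h f) x"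
      using mh f by (intro S_add) auto
    ultimately have "AE x in lebesgue_on D. (S (m + h) f x - S m f x) / h = S m (d h) x"
      by eventually_elim (simp add: diff_divide_distrib)
    moreover have "(S (m + h) f x - S m f x) / h = (S q f x - S r f x) / (q - r)" for x
      using q(2) by (cases "q > r") (auto simp: m_def h_def min_def field_simps abs_if)
    ultimately show "AE x in lebesgue_on D. (S q f x - S r f x) / (q - r) - S r u x = S (min q r) (d \<bar>q - r\<bar>) x - S r u x"
      by (auto simp: m_def h_def)
  qed (use q r in auto)
  have ev: "\<forall>\<^sub>F q in at r within {0..}. q \<ge> 0 \<and> q \<noteq> r" by (auto simp: eventually_at_filter)
  have "((\<lambda>q. nrm D (\<lambda>x. S (min q r) (d \<bar>q - r\<bar>) x - S r u x)) \<longlongrightarrow> 0) (at r within {0..})"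
  proof (rule S_tendsto)
    show "\<forall>\<^sub>F q in at r within {0..}. d \<bar>q - r\<bar> \<in> L2 D" using ev by eventually_elim (auto intro: dL2)
    have "((\<lambda>q. \<bar>q - r\<bar>) \<longlongrightarrow> \<bar>r - r\<bar>) (at r within {0..})" by (intro tendsto_intros)
    hence "filterlim (\<lambda>q. \<bar>q - r\<bar>) (at_right 0) (at r within {0..})"
      using ev by (simp add: filterlim_at) (elim eventually_mono, auto)
    from filterlim_compose[OF gen this]
    show "((\<lambda>q. nrm D (\<lambda>x. d \<bar>q - r\<bar> x - u x)) \<longlongrightarrow> 0) (at r within {0..})" by (simp add: d_def)
    have "((\<lambda>q. min q r) \<longlongrightarrow> min r r) (at r within {0..})" by (intro tendsto_intros)
    thus "((\<lambda>q. min q r) \<longlongrightarrow> r) (at r within {0..})" by simp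
    show "\<forall>\<^sub>F q in at r within {0..}. 0 \<le> min q r" using ev by eventually_elim (use r in auto)
  qed (use u r in auto)
  thus ?thesis
    by (rule Lim_transform_eventually) (use ev in eventually_elim, auto simp: eq)
qed

end

section \<open>The covariance of the stochastic heat equation\<close>

text \<open>The covariance is stated with Lebesgue integrals over sets; this and the next lemma pass
  to gauge integrals over compact intervals, for which substitution, exchange of integrals and the
  fundamental theorem are used later.\<close>

lemma set_lebesgue_integral_interval:
  fixes f :: "real \<Rightarrow> real"
  assumes "continuous_on {a..b} f"
  shows "set_integrable lebesgue {a..b} f" "(LINT x:{a..b}|lebesgue. f x) = integral {a..b} f"
  using absolutely_integrable_continuous_real[OF assms] set_lebesgue_integral_eq_integral(2) by blast+

lemma set_lebesgue_integral_half_line: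
  fixes f :: "real \<Rightarrow> real"
  assumes c: "continuous_on {0..} f" and z: "\<And>t. t \<ge> T \<Longrightarrow> f t = 0"
  shows "set_integrable lebesgue {0..} f" "(LINT x:{0..}|lebesgue. f x) = integral {0..T} f"
proof -
  have c': "continuous_on {0..T} f" by (rule continuous_on_subset[OF c]) auto
  have "(\<lambda>x. indicator {0..} x *\<^sub>R f x) = (\<lambda>x. indicator {0..T} x *\<^sub>R f x)"
    using z by (auto simp: indicator_def fun_eq_iff)
  thus "set_integrable lebesgue {0..} f" "(LINT x:{0..}|lebesgue. f x) = integral {0..T} f"
    using set_lebesgue_integral_interval[OF c'] by (simp_all add: set_integrable_def set_lebesgue_integral_def)
qed

context l2_semigroup
begin

definition supported_family :: "real \<Rightarrow> (real \<Rightarrow> 'a \<Rightarrow> real) \<Rightarrow> bool" where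
  "supported_family T F \<longleftrightarrow> L2cont {0..} F \<and> (\<forall>t\<ge>T. F t = (\<lambda>x. 0))"

definition inner_cov :: "(real \<Rightarrow> 'a \<Rightarrow> real) \<Rightarrow> (real \<Rightarrow> 'a \<Rightarrow> real) \<Rightarrow> real \<Rightarrow> real \<Rightarrow> real" where
  "inner_cov F G t s = (LINT r:{\<bar>t - s\<bar>..t + s}|lebesgue. ip D (F t) (S r (G s)))"

definition heat_cov :: "(real \<Rightarrow> 'a \<Rightarrow> real) \<Rightarrow> (real \<Rightarrow> 'a \<Rightarrow> real) \<Rightarrow> real" where
  "heat_cov F G = (LINT t:{0..}|lebesgue. LINT s:{0..}|lebesgue. inner_cov F G t s)"

lemma ip_zero [simp]: "ip A (\<lambda>x. 0) f = 0" "ip A f (\<lambda>x. 0) = 0"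
  by (simp_all add: ip_def)

lemma ip_S_lincomb:
  assumes "f \<in> L2 D" "g \<in> L2 D" "h \<in> L2 D" "r \<ge> 0"
  shows "ip D h (S r (\<lambda>x. a * f x + b * g x)) = a * ip D h (S r f) + b * ip D h (S r g)"
proof -
  have "ip D h (S r (\<lambda>x. a * f x + b * g x)) = ip D h (\<lambda>x. a * S r f x + b * S r g x)"
    using assms by (intro ip_cong_AE S_lincomb S_L2 L2_lincomb) auto
  thus ?thesis using assms by (simp add: ip_lincomb S_L2)
qed

lemma ip_S_zero: "h \<in> L2 D \<Longrightarrow> r \<ge> 0 \<Longrightarrow> ip D h (S r (\<lambda>x. 0)) = 0"
  using ip_S_lincomb[of "\<lambda>x. 0" "\<lambda>x. 0" h r 0 0] by simp

lemma supported_family_L2: "supported_family T F \<Longrightarrow> t \<ge> 0 \<Longrightarrow> F t \<in> L2 D"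
  by (auto simp: supported_family_def L2cont_def)

lemma supported_family_lincomb:
  assumes "supported_family T F" "supported_family T G"
  shows "supported_family T (\<lambda>t x. a * F t x + b * G t x)"
  using assms by (auto simp: supported_family_def intro: L2cont_lincomb)

lemma kernel_continuous:
  assumes "supported_family T F" "supported_family T G"
  shows "continuous_on ({0..} \<times> {0..} \<times> {0..}) (\<lambda>(t, s, r). ip D (F t) (S r (G s)))"
  unfolding split_beta
proof (rule L2cont_ip)
  show "L2cont ({0..} \<times> {0..} \<times> {0..}) (\<lambda>p. F (fst p))"
    by (rule L2cont_compose[where V="{0..}"]) (use assms in \<open>auto simp: supported_family_def intro!: continuous_intros\<close>)
  have "L2cont ({0..} \<times> {0..} \<times> {0..}) (\<lambda>p. G (fst (snd p)))"
    by (rule L2cont_compose[where V="{0..}"]) (use assms in \<open>auto simp: supported_family_def intro!: continuous_intros\<close>)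
  thus "L2cont ({0..} \<times> {0..} \<times> {0..}) (\<lambda>p. S (snd (snd p)) (G (fst (snd p))))"
    by (rule L2cont_S) (auto intro!: continuous_intros)
qed

lemma kernel_continuous_compose:
  assumes "supported_family T F" "supported_family T G"
    and "continuous_on U f" "continuous_on U g" "continuous_on U h"
    and "\<And>p. p \<in> U \<Longrightarrow> f p \<ge> 0 \<and> g p \<ge> 0 \<and> h p \<ge> 0"
  shows "continuous_on U (\<lambda>p. ip D (F (f p)) (S (h p) (G (g p))))"
proof -
  have "continuous_on U (\<lambda>p. (f p, g p, h p))" using assms by (intro continuous_intros)
  thus ?thesis
    using continuous_on_compose2[OF kernel_continuous[OF assms(1,2)], of U "\<lambda>p. (f p, g p, h p)"] assms(6) by auto
qed

lemma inner_cov_integral: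
  assumes "supported_family T F" "supported_family T G" "t \<ge> 0" "s \<ge> 0"
  shows "set_integrable lebesgue {\<bar>t - s\<bar>..t + s} (\<lambda>r. ip D (F t) (S r (G s)))"
    and "inner_cov F G t s = integral {\<bar>t - s\<bar>..t + s} (\<lambda>r. ip D (F t) (S r (G s)))"
proof -
  have "continuous_on {\<bar>t - s\<bar>..t + s} (\<lambda>r. ip D (F t) (S r (G s)))"
    by (rule kernel_continuous_compose[OF assms(1,2)]) (use assms(3,4) in \<open>auto intro!: continuous_intros\<close>)
  thus "set_integrable lebesgue {\<bar>t - s\<bar>..t + s} (\<lambda>r. ip D (F t) (S r (G s)))"
    "inner_cov F G t s = integral {\<bar>t - s\<bar>..t + s} (\<lambda>r. ip D (F t) (S r (G s)))"
    unfolding inner_cov_def by (rule set_lebesgue_integral_interval)+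
qed

text \<open>The range of r has length (t + s) - |t - s| = 2 min(t, s). Mapping it onto [0, 1] moves
  the parameters into the integrand, so that continuity in (t, s) follows from continuity of
  parameter integrals.\<close>

lemma inner_cov_scaled:
  assumes "supported_family T F" "supported_family T G" "t \<ge> 0" "s \<ge> 0"
  shows "inner_cov F G t s =
    2 * min t s * integral {0..1} (\<lambda>u. ip D (F t) (S (2 * min t s * u + \<bar>t - s\<bar>) (G s)))"
proof (cases "min t s = 0")
  case True
  hence "t + s = \<bar>t - s\<bar>" using assms by (auto simp: min_def split: if_splits)
  thus ?thesis using True by (simp add: inner_cov_integral[OF assms])
next
  case False
  define m where "m = 2 * min t s"
  have m: "m > 0" using False assms by (auto simp: m_def)
  let ?k = "\<lambda>r. ip D (F t) (S r (G s))"
  have e: "t + s = \<bar>t - s\<bar> + m" by (auto simp: m_def min_def)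
  have "?k integrable_on {\<bar>t - s\<bar>..t + s}"
    using inner_cov_integral(1)[OF assms] set_lebesgue_integral_eq_integral(1) by blast
  hence "(?k has_integral inner_cov F G t s) (cbox \<bar>t - s\<bar> (t + s))"
    by (simp add: inner_cov_integral(2)[OF assms] integrable_integral)
  from has_integral_affinity'[OF this m, of "\<bar>t - s\<bar>"]
  have "((\<lambda>u. ?k (m * u + \<bar>t - s\<bar>)) has_integral (inner_cov F G t s / m)) {0..1}"
    using m e by (simp add: divide_inverse mult.commute)
  hence "integral {0..1} (\<lambda>u. ?k (m * u + \<bar>t - s\<bar>)) = inner_cov F G t s / m" by (rule integral_unique)
  thus ?thesis using m by (simp add: m_def[symmetric])
qed

lemma inner_cov_continuous:
  assumes F: "supported_family T F" and G: "supported_family T G"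
  shows "continuous_on ({0..} \<times> {0..}) (\<lambda>(t, s). inner_cov F G t s)"
proof -
  let ?k = "\<lambda>p u. ip D (F (fst p)) (S (2 * min (fst p) (snd p) * u + \<bar>fst p - snd p\<bar>) (G (snd p)))"
  have "continuous_on (({0..} \<times> {0..}) \<times> cbox 0 1) (\<lambda>(p, u). ?k p u)"
    unfolding split_beta by (rule kernel_continuous_compose[OF F G]) (auto intro!: continuous_intros)
  hence "continuous_on ({0..} \<times> {0..}) (\<lambda>p. integral (cbox 0 1) (?k p))"
    by (rule integral_continuous_on_param)
  hence "continuous_on ({0..} \<times> {0..}) (\<lambda>p. 2 * min (fst p) (snd p) * integral {0..1} (?k p))"
    by (auto intro!: continuous_intros)
  moreover have "\<And>p. p \<in> {0..} \<times> {0..} \<Longrightarrow> 2 * min (fst p) (snd p) * integral {0..1} (?k p) = inner_cov F G (fst p) (snd p)"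
    by (auto simp: inner_cov_scaled[OF F G])
  ultimately show ?thesis unfolding split_beta by (simp cong: continuous_on_cong)
qed

lemma inner_cov_vanish:
  assumes "supported_family T F" "supported_family T G" "t \<ge> 0" "s \<ge> 0" "F t = (\<lambda>x. 0) \<or> G s = (\<lambda>x. 0)"
  shows "inner_cov F G t s = 0"
proof -
  have "inner_cov F G t s = (LINT r:{\<bar>t - s\<bar>..t + s}|lebesgue. 0)"
    unfolding inner_cov_def
  proof (rule set_lebesgue_integral_cong)
    show "\<forall>r. r \<in> {\<bar>t - s\<bar>..t + s} \<longrightarrow> ip D (F t) (S r (G s)) = 0"
      using assms supported_family_L2[OF assms(1,3)] by (auto simp: ip_S_zero)
  qed simp
  thus ?thesis by (simp add: set_lebesgue_integral_def)
qed

lemma outer_integral: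
  assumes F: "supported_family T F" and G: "supported_family T G"
  shows "t \<ge> 0 \<Longrightarrow> set_integrable lebesgue {0..} (inner_cov F G t)"
    and "t \<ge> 0 \<Longrightarrow> (LINT s:{0..}|lebesgue. inner_cov F G t s) = integral {0..T} (inner_cov F G t)"
    and "set_integrable lebesgue {0..} (\<lambda>t. LINT s:{0..}|lebesgue. inner_cov F G t s)"
proof -
  have *: "set_integrable lebesgue {0..} (inner_cov F G t) \<and> (LINT s:{0..}|lebesgue. inner_cov F G t s) = integral {0..T} (inner_cov F G t)"
    if t: "t \<ge> 0" for t
  proof -
    have c: "continuous_on {0..} (inner_cov F G t)"
      using continuous_on_compose2[OF inner_cov_continuous[OF F G] continuous_on_Pair[OF continuous_on_const continuous_on_id], of t "{0..}"] t
      by auto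
    \<comment> \<open>\<open>T\<close> may be negative here; replacing it by 0 in that case leaves
      the integral at 0.\<close>
    define T' where "T' = max 0 T"
    have z: "inner_cov F G t s = 0" if "s \<ge> T'" for s
      using that t G by (intro inner_cov_vanish[OF F G]) (auto simp: T'_def supported_family_def)
    have "integral {0..T'} (inner_cov F G t) = integral {0..T} (inner_cov F G t)"
      by (cases "T \<ge> 0") (auto simp: T'_def max_def)
    thus ?thesis using set_lebesgue_integral_half_line[OF c z] by simp
  qed
  thus "t \<ge> 0 \<Longrightarrow> set_integrable lebesgue {0..} (inner_cov F G t)"
    and "t \<ge> 0 \<Longrightarrow> (LINT s:{0..}|lebesgue. inner_cov F G t s) = integral {0..T} (inner_cov F G t)" by auto
  have "continuous_on {0..} (\<lambda>t. integral (cbox 0 T) (inner_cov F G t))"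
    by (rule integral_continuous_on_param)
       (rule continuous_on_subset[OF inner_cov_continuous[OF F G]], auto)
  hence c: "continuous_on {0..} (\<lambda>t. LINT s:{0..}|lebesgue. inner_cov F G t s)"
    using * by (subst continuous_on_cong[OF refl]) auto
  have z: "(LINT s:{0..}|lebesgue. inner_cov F G t s) = 0" if t: "t \<ge> max 0 T" for t
  proof -
    have "(LINT s:{0..}|lebesgue. inner_cov F G t s) = (LINT s:{0::real..}|lebesgue. 0)"
      using t F by (intro set_lebesgue_integral_cong) (auto intro!: inner_cov_vanish[OF F G] simp: supported_family_def)
    thus ?thesis by (simp add: set_lebesgue_integral_def)
  qed
  show "set_integrable lebesgue {0..} (\<lambda>t. LINT s:{0..}|lebesgue. inner_cov F G t s)"
    by (rule set_lebesgue_integral_half_line(1)[OF c z])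
qed

lemma set_integral_lincomb:
  fixes f g :: "real \<Rightarrow> real"
  assumes "set_integrable lebesgue A f" "set_integrable lebesgue A g" "A \<in> sets lebesgue"
    and "\<And>x. x \<in> A \<Longrightarrow> h x = a * f x + b * g x"
  shows "(LINT x:A|lebesgue. h x) = a * (LINT x:A|lebesgue. f x) + b * (LINT x:A|lebesgue. g x)"
proof -
  have "(LINT x:A|lebesgue. h x) = (LINT x:A|lebesgue. a * f x + b * g x)"
    using assms(3,4) by (intro set_lebesgue_integral_cong) auto
  thus ?thesis using assms(1,2) by simp
qed

lemma heat_cov_lincomb:
  assumes F: "supported_family T F" and G: "supported_family T G" and H: "supported_family T H"
  shows "heat_cov (\<lambda>t x. a * F t x + b * G t x) H = a * heat_cov F H + b * heat_cov G H"
    and "heat_cov H (\<lambda>t x. a * F t x + b * G t x) = a * heat_cov H F + b * heat_cov H G"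
proof -
  note L2 = supported_family_L2[OF F] supported_family_L2[OF G] supported_family_L2[OF H]
  have 1: "inner_cov (\<lambda>t x. a * F t x + b * G t x) H t s = a * inner_cov F H t s + b * inner_cov G H t s"
    if "t \<ge> 0" "s \<ge> 0" for t s
    unfolding inner_cov_def using that L2
    by (intro set_integral_lincomb inner_cov_integral(1)[OF F H] inner_cov_integral(1)[OF G H])
       (auto intro!: ip_lincomb S_L2)
  have 2: "inner_cov H (\<lambda>t x. a * F t x + b * G t x) t s = a * inner_cov H F t s + b * inner_cov H G t s"
    if "t \<ge> 0" "s \<ge> 0" for t s
    unfolding inner_cov_def using that L2
    by (intro set_integral_lincomb inner_cov_integral(1)[OF H F] inner_cov_integral(1)[OF H G])
       (auto intro!: ip_S_lincomb)
  show "heat_cov (\<lambda>t x. a * F t x + b * G t x) H = a * heat_cov F H + b * heat_cov G H"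
    unfolding heat_cov_def
    by (intro set_integral_lincomb outer_integral(3)[OF F H] outer_integral(3)[OF G H])
       (auto intro!: set_integral_lincomb outer_integral(1)[OF F H] outer_integral(1)[OF G H] simp: 1)
  show "heat_cov H (\<lambda>t x. a * F t x + b * G t x) = a * heat_cov H F + b * heat_cov H G"
    unfolding heat_cov_def
    by (intro set_integral_lincomb outer_integral(3)[OF H F] outer_integral(3)[OF H G])
       (auto intro!: set_integral_lincomb outer_integral(1)[OF H F] outer_integral(1)[OF H G] simp: 2)
qed

lemma evolved_derivative:
  assumes f: "f \<in> L2 D"
    and F: "\<And>s. s \<ge> 0 \<Longrightarrow> F s \<in> L2 D" "F' s \<in> L2 D" "A s \<in> L2 D"
    and F': "((\<lambda>q. nrm D (\<lambda>x. (F q x - F s x) / (q - s) - F' s x)) \<longlongrightarrow> 0) (at s)"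
    and A: "((\<lambda>h. nrm D (\<lambda>x. (S h (F s) x - F s x) / h - A s x)) \<longlongrightarrow> 0) (at_right 0)"
    and s: "s \<ge> 0" "s + v \<ge> 0" and U: "\<And>q. q \<in> U \<Longrightarrow> q \<ge> 0 \<and> q + v \<ge> 0"
  shows "((\<lambda>q. ip D f (S (q + v) (F q))) has_vector_derivative ip D f (S (s + v) (\<lambda>x. F' s x + A s x))) (at s within U)"
proof -
  let ?F = "at s within U"
  define q1 where "q1 = (\<lambda>q x. (F q x - F s x) / (q - s))"
  define q2 where "q2 = (\<lambda>q x. (S (q + v) (F s) x - S (s + v) (F s) x) / (q - s))"
  have ev: "\<forall>\<^sub>F q in ?F. q \<ge> 0 \<and> q + v \<ge> 0 \<and> q \<noteq> s"
    using U by (auto simp: eventually_at_filter)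
  have q1L2: "q1 q \<in> L2 D" if "q \<ge> 0" for q
    using L2_lincomb[OF F(1)[OF that] F(1)[OF s(1)], of "1/(q-s)" "-1/(q-s)"] by (simp add: q1_def diff_divide_distrib)
  have q2L2: "q2 q \<in> L2 D" if "q + v \<ge> 0" for q
    using L2_lincomb[OF S_L2[OF that F(1)[OF s(1)]] S_L2[OF s(2) F(1)[OF s(1)]], of "1/(q-s)" "-1/(q-s)"]
    by (simp add: q2_def diff_divide_distrib)
  have "((\<lambda>q. ip D f (S (q + v) (q1 q))) \<longlongrightarrow> ip D f (S (s + v) (F' s))) ?F"
  proof (rule ip_tendsto[OF _ _ S_tendsto f])
    show "\<forall>\<^sub>F q in ?F. S (q + v) (q1 q) \<in> L2 D" using ev by eventually_elim (auto intro: S_L2 q1L2)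
    show "\<forall>\<^sub>F q in ?F. q1 q \<in> L2 D" using ev by eventually_elim (auto intro: q1L2)
    show "((\<lambda>q. nrm D (\<lambda>x. q1 q x - F' s x)) \<longlongrightarrow> 0) ?F"
      using tendsto_mono[OF at_le F', of U] by (simp add: q1_def)
    show "((\<lambda>q. q + v) \<longlongrightarrow> s + v) ?F" by (intro tendsto_intros)
    show "\<forall>\<^sub>F q in ?F. 0 \<le> q + v" using ev by eventually_elim auto
  qed (use F s in \<open>auto intro: S_L2\<close>)
  moreover have "((\<lambda>q. ip D f (q2 q)) \<longlongrightarrow> ip D f (S (s + v) (A s))) ?F"
  proof (rule ip_tendsto[OF _ _ _ f])
    show "\<forall>\<^sub>F q in ?F. q2 q \<in> L2 D" using ev by eventually_elim (auto intro: q2L2)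
    have "((\<lambda>q. q + v) \<longlongrightarrow> s + v) ?F" by (intro tendsto_intros)
    hence "filterlim (\<lambda>q. q + v) (at (s + v) within {0..}) ?F"
      using ev by (auto simp: filterlim_at elim: eventually_mono)
    from filterlim_compose[OF S_deriv[OF F(1)[OF s(1)] F(3) s(2) A] this]
    show "((\<lambda>q. nrm D (\<lambda>x. q2 q x - S (s + v) (A s) x)) \<longlongrightarrow> 0) ?F"
      by (simp add: q2_def)
  qed (use F s in \<open>auto intro: S_L2\<close>)
  ultimately have lim: "((\<lambda>q. ip D f (S (q + v) (q1 q)) + ip D f (q2 q)) \<longlongrightarrow>
     ip D f (S (s + v) (F' s)) + ip D f (S (s + v) (A s))) ?F" by (rule tendsto_add)
  have sum: "ip D f (S (s + v) (F' s)) + ip D f (S (s + v) (A s)) = ip D f (S (s + v) (\<lambda>x. F' s x + A s x))"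
    using ip_S_lincomb[OF F(2,3) f s(2), of 1 1] by simp
  have "\<forall>\<^sub>F q in ?F. ip D f (S (q + v) (q1 q)) + ip D f (q2 q) =
      (ip D f (S (q + v) (F q)) - ip D f (S (s + v) (F s))) / (q - s)"
    using ev
  proof eventually_elim
    case (elim q)
    have "ip D f (S (q + v) (q1 q)) = (1/(q-s)) * ip D f (S (q + v) (F q)) + (-1/(q-s)) * ip D f (S (q + v) (F s))"
      using ip_S_lincomb[of "F q" "F s" f "q + v" "1/(q-s)" "-1/(q-s)"] elim F s f by (simp add: q1_def diff_divide_distrib)
    moreover have "ip D f (q2 q) = (1/(q-s)) * ip D f (S (q + v) (F s)) + (-1/(q-s)) * ip D f (S (s + v) (F s))"
      using ip_lincomb(2)[of "S (q + v) (F s)" D "S (s + v) (F s)" f "1/(q-s)" "-1/(q-s)"] elim F s f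
      by (simp add: q2_def diff_divide_distrib S_L2)
    ultimately show ?case by (simp add: divide_inverse algebra_simps)
  qed
  from Lim_transform_eventually[OF lim this] show ?thesis
    unfolding sum by (simp add: has_field_derivative_iff flip: has_real_derivative_iff_has_vector_derivative)
qed

text \<open>A test function living before time \<open>t\<^sub>0\<close> does not see the part of the equation after \<open>t\<^sub>0\<close>: after
  the shift \<open>r = s + v\<close> the integrand is the \<open>s\<close>-derivative of \<open>\<langle>H\<^sub>t, S(s + v) F\<^sub>s\<rangle>\<close>.\<close>

lemma heat_cov_adapted:
  assumes H: "supported_family T H" and F: "supported_family T F" and F': "supported_family T F'" and A: "supported_family T A"
    and t0: "0 \<le> t0" "t0 \<le> T" and Hz: "\<And>t. t > t0 \<Longrightarrow> H t = (\<lambda>x. 0)"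
    and Fz: "\<And>t. t \<le> t0 \<Longrightarrow> F t = (\<lambda>x. 0) \<and> F' t = (\<lambda>x. 0) \<and> A t = (\<lambda>x. 0)"
    and F'd: "\<And>s. s \<ge> 0 \<Longrightarrow> ((\<lambda>q. nrm D (\<lambda>x. (F q x - F s x) / (q - s) - F' s x)) \<longlongrightarrow> 0) (at s)"
    and gen: "\<And>s. s \<ge> 0 \<Longrightarrow> ((\<lambda>h. nrm D (\<lambda>x. (S h (F s) x - F s x) / h - A s x)) \<longlongrightarrow> 0) (at_right 0)"
  shows "heat_cov H (\<lambda>t x. F' t x + A t x) = 0"
proof -
  let ?G = "\<lambda>t x. F' t x + A t x"
  have G: "supported_family T ?G" using supported_family_lincomb[OF F' A, of 1 1] by simp
  have "(LINT s:{0..}|lebesgue. inner_cov H ?G t s) = 0" if t: "t \<ge> 0" for t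
  proof (cases "t > t0")
    case True
    have "(LINT s:{0..}|lebesgue. inner_cov H ?G t s) = (LINT s:{0::real..}|lebesgue. 0)"
      using t True Hz by (intro set_lebesgue_integral_cong) (auto intro!: inner_cov_vanish[OF H G])
    thus ?thesis by (simp add: set_lebesgue_integral_def)
  next
    case False
    hence tt0: "t \<le> t0" by simp
    have Ht: "H t \<in> L2 D" using supported_family_L2[OF H t] .
    have c: "continuous_on {0..T} (inner_cov H ?G t)"
      using continuous_on_compose2[OF inner_cov_continuous[OF H G] continuous_on_Pair[OF continuous_on_const continuous_on_id], of t "{0..T}"] t
      by force
    have "integral {0..T} (inner_cov H ?G t) = integral {0..t0} (inner_cov H ?G t) + integral {t0..T} (inner_cov H ?G t)"
      by (rule Henstock_Kurzweil_Integration.integral_combine[symmetric]) (use t0 c in \<open>auto intro: integrable_continuous_real\<close>)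
    \<comment> \<open>Before t0 both \<open>F'\<close> and \<open>A\<close> vanish.\<close>
    also have "integral {0..t0} (inner_cov H ?G t) = integral {0..t0} (\<lambda>s. 0)"
      using Fz t by (intro integral_cong inner_cov_vanish[OF H G]) auto
    \<comment> \<open>Now t \<le> t0 \<le> s, so |t - s| = s - t, and the substitution r = s + v
      gives a range for v that does not depend on s.\<close>
    also have "integral {t0..T} (inner_cov H ?G t) =
        integral {t0..T} (\<lambda>s. integral {-t..t} (\<lambda>v. ip D (H t) (S (s + v) (?G s))))"
    proof (rule integral_cong)
      fix s assume s: "s \<in> {t0..T}"
      have "inner_cov H ?G t s = integral {s - t..s + t} (\<lambda>r. ip D (H t) (S r (?G s)))"
        using s tt0 t0 t inner_cov_integral(2)[OF H G t, of s] by (simp add: add.commute[of t s])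
      also have "\<dots> = integral {-t..t} (\<lambda>v. ip D (H t) (S (s + v) (?G s)))"
        using integral_shift_Icc_real[of "-t" t "\<lambda>r. ip D (H t) (S r (?G s))" s] by (simp add: o_def add.commute)
      finally show "inner_cov H ?G t s = integral {-t..t} (\<lambda>v. ip D (H t) (S (s + v) (?G s)))" .
    qed
    \<comment> \<open>The exchange makes s the inner variable, so that for fixed v the fundamental
      theorem applies.\<close>
    also have "\<dots> = integral {-t..t} (\<lambda>v. integral {t0..T} (\<lambda>s. ip D (H t) (S (s + v) (?G s))))"
    proof -
      have "continuous_on (cbox (t0, -t) (T, t)) (\<lambda>(s, v). ip D (H t) (S (s + v) (?G s)))"
        unfolding split_beta
        by (rule kernel_continuous_compose[OF H G]) (use t tt0 t0 in \<open>auto intro!: continuous_intros simp: cbox_Pair_eq\<close>)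
      from integral_swap_continuous[OF this] show ?thesis by simp
    qed
    also have "\<dots> = integral {-t..t} (\<lambda>v. 0)"
    proof (rule integral_cong)
      fix v assume v: "v \<in> {-t..t}"
      have "((\<lambda>s. ip D (H t) (S (s + v) (?G s))) has_integral
          ip D (H t) (S (T + v) (F T)) - ip D (H t) (S (t0 + v) (F t0))) {t0..T}"
      proof (rule fundamental_theorem_of_calculus[OF t0(2)])
        fix s assume s: "s \<in> {t0..T}"
        hence "s \<ge> 0" "s + v \<ge> 0" using t0 tt0 v t by auto
        thus "((\<lambda>q. ip D (H t) (S (q + v) (F q))) has_vector_derivative ip D (H t) (S (s + v) (?G s))) (at s within {t0..T})"
          using t0 tt0 v by (intro evolved_derivative Ht F'd gen supported_family_L2[OF F] supported_family_L2[OF F'] supported_family_L2[OF A]) auto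
      qed
      \<comment> \<open>Both boundary terms vanish: the test function has died out at
        \<open>T\<close> and has not yet started at t0.\<close>
      moreover have "F T = (\<lambda>x. 0)" "F t0 = (\<lambda>x. 0)" using F Fz by (auto simp: supported_family_def)
      moreover have "T + v \<ge> 0" "t0 + v \<ge> 0" using t0 tt0 v t by auto
      ultimately have "((\<lambda>s. ip D (H t) (S (s + v) (?G s))) has_integral 0) {t0..T}"
        by (simp add: ip_S_zero Ht)
      thus "integral {t0..T} (\<lambda>s. ip D (H t) (S (s + v) (?G s))) = 0" by (rule integral_unique)
    qed
    finally show ?thesis using outer_integral(2)[OF H G t] by simp
  qed
  hence "heat_cov H ?G = (LINT t:{0::real..}|lebesgue. 0)"
    unfolding heat_cov_def by (intro set_lebesgue_integral_cong) auto
  thus ?thesis by (simp add: set_lebesgue_integral_def)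
qed

end

section \<open>Classical and weak derivatives\<close>

lemma pd_eq: "(f has_derivative f') (at x) \<Longrightarrow> pd b f x = f' b"
  unfolding pd_def by (simp add: frechet_derivative_at[symmetric])

lemma pd_has_derivative: "f differentiable (at x) \<Longrightarrow> (f has_derivative (\<lambda>b. pd b f x)) (at x)"
  unfolding pd_def using frechet_derivative_works by fastforce

lemma pd_zero_open:
  assumes "open U" "x \<in> U" "\<And>y. y \<in> U \<Longrightarrow> f y = 0"
  shows "pd b f x = 0" "f differentiable (at x)"
proof -
  have h: "(f has_derivative (\<lambda>_. 0)) (at x)"
    by (rule has_derivative_transform_within_open[of "\<lambda>_. 0" _ x UNIV U]) (use assms in auto)
  thus "pd b f x = 0" by (simp add: pd_eq)
  show "f differentiable (at x)" using h by (auto simp: differentiable_def)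
qed

lemma pd_mult:
  assumes "f differentiable (at x)" "g differentiable (at x)"
  shows "pd b (\<lambda>y. f y * g y) x = f x * pd b g x + pd b f x * g x"
  using pd_eq[OF has_derivative_mult[OF pd_has_derivative[OF assms(1)] pd_has_derivative[OF assms(2)]]] by simp

lemma Ck_imp_continuous: "Ck n f \<Longrightarrow> continuous_on UNIV f"
proof (cases n)
  case (Suc m)
  assume "Ck n f"
  hence "\<And>x. f differentiable (at x)" using Suc by simp
  thus ?thesis by (simp add: continuous_at_imp_continuous_on differentiable_imp_continuous_within)
qed simp

lemma smooth_continuous: "smooth f \<Longrightarrow> continuous_on UNIV f"
  using Ck_imp_continuous unfolding smooth_def by blast

lemma smooth_differentiable: "smooth f \<Longrightarrow> f differentiable (at x)"
  unfolding smooth_def using Ck.simps(2)[of 0 f] by blast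

lemma smooth_pd: "smooth f \<Longrightarrow> b \<in> Basis \<Longrightarrow> smooth (pd b f)"
  unfolding smooth_def using Ck.simps(2) by blast

text \<open>\<open>Ck\<close> only speaks of derivatives along basis vectors, so the induction
  closes for affine maps sending each basis vector to a multiple of a basis vector. This covers both
  time slices and the zoom of the kernel. The prefactor \<open>c\<close> varies in the induction
  because each derivative contributes a factor \<open>m b\<close>.\<close>

lemma Ck_affine:
  fixes f :: "'b::euclidean_space \<Rightarrow> real" and A :: "'a::euclidean_space \<Rightarrow> 'b"
  assumes A: "\<And>x. (A has_derivative A') (at x)" and m: "\<And>b. b \<in> Basis \<Longrightarrow> A' b = m b *\<^sub>R e b \<and> e b \<in> Basis"
  shows "Ck n f \<Longrightarrow> Ck n (\<lambda>x. c * f (A x))"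
proof (induction n arbitrary: f c)
  case 0
  have "continuous_on UNIV A"
    using A by (intro continuous_at_imp_continuous_on ballI has_derivative_continuous)
  thus ?case using 0 by (auto intro!: continuous_intros continuous_on_compose2[of UNIV f])
next
  case (Suc n)
  have d: "((\<lambda>x. c * f (A x)) has_derivative (\<lambda>v. c * pd (A' v) f (A x))) (at x)" for x
    using Suc.prems by (intro has_derivative_mult_right has_derivative_compose[OF A pd_has_derivative]) auto
  have "pd b (\<lambda>x. c * f (A x)) = (\<lambda>x. (c * m b) * pd (e b) f (A x))" if b: "b \<in> Basis" for b
  proof
    fix x
    have lin: "linear (\<lambda>v. pd v f (A x))"
      using pd_has_derivative[of f "A x"] Suc.prems by (auto intro: has_derivative_linear)
    show "pd b (\<lambda>x. c * f (A x)) x = (c * m b) * pd (e b) f (A x)"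
      using pd_eq[OF d, of b x] m[OF b] linear_scale[OF lin, of "m b" "e b"] by simp
  qed
  moreover have "Ck n (\<lambda>x. (c * m b) * pd (e b) f (A x))" if "b \<in> Basis" for b
    using Suc.prems m[OF that] by (intro Suc.IH) simp
  moreover have "(\<lambda>x. c * f (A x)) differentiable (at x)" for x
    using d by (auto simp: differentiable_def)
  ultimately show ?case by simp
qed

lemma pd_affine:
  fixes f :: "'b::euclidean_space \<Rightarrow> real" and A :: "'a::euclidean_space \<Rightarrow> 'b"
  assumes A: "(A has_derivative A') (at x)" and "A' b = m *\<^sub>R e" and f: "f differentiable (at (A x))"
  shows "pd b (\<lambda>x. c * f (A x)) x = (c * m) * pd e f (A x)"
proof -
  have d: "((\<lambda>x. c * f (A x)) has_derivative (\<lambda>v. c * pd (A' v) f (A x))) (at x)"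
    by (intro has_derivative_mult_right has_derivative_compose[OF A pd_has_derivative] f)
  have lin: "linear (\<lambda>v. pd v f (A x))"
    using pd_has_derivative[OF f] by (auto intro: has_derivative_linear)
  show ?thesis using pd_eq[OF d, of b] assms(2) linear_scale[OF lin, of m e] by simp
qed

lemma smooth_slice:
  fixes \<phi> :: "real \<times> 'a::euclidean_space \<Rightarrow> real"
  assumes "smooth \<phi>"
  shows "smooth (\<lambda>y. \<phi> (t, y))"
  unfolding smooth_def
proof
  fix n
  have "Ck n (\<lambda>y. 1 * \<phi> (t, y))"
    by (rule Ck_affine[where A'="\<lambda>y. (0, y)" and m="\<lambda>_. 1" and e="\<lambda>b. (0, b)"])
       (use assms in \<open>auto simp: smooth_def Basis_prod_def intro!: derivative_eq_intros\<close>)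
  thus "Ck n (\<lambda>y. \<phi> (t, y))" by simp
qed

lemma pd_slice:
  fixes \<phi> :: "real \<times> 'a::euclidean_space \<Rightarrow> real"
  assumes "smooth \<phi>"
  shows "pd b (\<lambda>y. \<phi> (t, y)) x = pd (0, b) \<phi> (t, x)"
  using pd_affine[where f=\<phi> and A="\<lambda>y. (t, y)" and A'="\<lambda>y. (0, y)" and m=1 and e="(0, b)" and c=1 and b=b and x=x] smooth_differentiable[OF assms]
  has_derivative_Pair[OF has_derivative_const has_derivative_ident, of t x UNIV]
  by simp

lemma basis_prod: "b \<in> Basis \<Longrightarrow> (0, b) \<in> (Basis :: (real \<times> 'a::euclidean_space) set)" "(1, 0) \<in> (Basis :: (real \<times> 'a::euclidean_space) set)"
  by (auto simp: Basis_prod_def)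

lemma Lap_eq:
  fixes \<phi> :: "real \<times> 'a::euclidean_space \<Rightarrow> real"
  assumes "smooth \<phi>"
  shows "Lap \<phi> = (\<lambda>z. \<Sum>b\<in>Basis. pd (0, b) (pd (0, b) \<phi>) z)"
proof
  fix z :: "real \<times> 'a"
  obtain t x where z: "z = (t, x)" by (cases z)
  show "Lap \<phi> z = (\<Sum>b\<in>Basis. pd (0, b) (pd (0, b) \<phi>) z)"
    unfolding Lap_def z laplacian_def prod.case
  proof (intro sum.cong refl)
    fix b :: 'a assume b: "b \<in> Basis"
    have "pd b (\<lambda>y. \<phi> (t, y)) = (\<lambda>y. pd (0, b) \<phi> (t, y))" using pd_slice[OF assms] by blast
    thus "pd b (pd b (\<lambda>y. \<phi> (t, y))) x = pd (0, b) (pd (0, b) \<phi>) (t, x)"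
      using pd_slice[OF smooth_pd[OF assms basis_prod(1)[OF b]]] by simp
  qed
qed

lemma time_derivative:
  fixes \<phi> :: "real \<times> 'a::euclidean_space \<Rightarrow> real"
  assumes "smooth \<phi>"
  shows "((\<lambda>s. \<phi> (s, x)) has_real_derivative pd (1, 0) \<phi> (t, x)) (at t)"
proof -
  have "((\<lambda>s. \<phi> (s, x)) has_derivative (\<lambda>h. pd (h, 0) \<phi> (t, x))) (at t)"
    by (rule has_derivative_compose[of "\<lambda>s. (s, x)" "\<lambda>h. (h, 0)" t UNIV, OF _ pd_has_derivative[OF smooth_differentiable[OF assms]]])
       (auto intro!: derivative_eq_intros)
  moreover have "(\<lambda>h. pd (h, 0) \<phi> (t, x)) = (\<lambda>h. pd (1, 0) \<phi> (t, x) * h)"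
  proof
    fix h :: real
    have lin: "linear (\<lambda>v. pd v \<phi> (t, x))"
      using pd_has_derivative[OF smooth_differentiable[OF assms]] by (auto intro: has_derivative_linear)
    have "(h, 0) = h *\<^sub>R (1 :: real, 0 :: 'a)" by simp
    thus "pd (h, 0) \<phi> (t, x) = pd (1, 0) \<phi> (t, x) * h"
      using linear_scale[OF lin, of h "(1, 0)"] by simp
  qed
  ultimately show ?thesis by (simp add: has_field_derivative_def)
qed

lemma dt_eq:
  fixes \<phi> :: "real \<times> 'a::euclidean_space \<Rightarrow> real"
  assumes "smooth \<phi>"
  shows "dt \<phi> = pd (1, 0) \<phi>"
  by (auto simp: dt_def fun_eq_iff intro!: DERIV_imp_deriv time_derivative[OF assms])

lemma supp_zero: "z \<notin> supp f \<Longrightarrow> f z = 0"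
  unfolding supp_def using closure_subset[of "{z. f z \<noteq> 0}"] by auto

lemma closed_supp: "closed (supp f)"
  by (simp add: supp_def)

lemma supp_minimal: "closed C \<Longrightarrow> (\<And>z. z \<notin> C \<Longrightarrow> f z = 0) \<Longrightarrow> supp f \<subseteq> C"
  unfolding supp_def by (rule closure_minimal) auto

lemma pd_off: "closed C \<Longrightarrow> (\<And>z. z \<notin> C \<Longrightarrow> f z = 0) \<Longrightarrow> z \<notin> C \<Longrightarrow> pd b f z = 0"
  by (rule pd_zero_open[of "- C"]) auto

text \<open>Translation invariance of Lebesgue measure makes the integral of every difference
  quotient zero, and dominated convergence passes to the derivative.\<close>

lemma integral_pd_zero:
  fixes F :: "'a::euclidean_space \<Rightarrow> real"
  assumes b: "b \<in> Basis" and F: "\<And>x. F differentiable (at x)" and c: "continuous_on UNIV (pd b F)"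
    and C: "compact C" "\<And>x. x \<notin> C \<Longrightarrow> F x = 0"
  shows "(\<integral>x. pd b F x \<partial>lborel) = 0"
proof -
  have cF: "continuous_on UNIV F"
    using F by (simp add: continuous_at_imp_continuous_on differentiable_imp_continuous_within)
  have [measurable]: "F \<in> borel_measurable borel" "pd b F \<in> borel_measurable borel"
    using cF c by (auto intro: borel_measurable_continuous_onI)
  \<comment> \<open>The set swept out by \<open>C\<close> under shifts of length at most 1; it
    contains the supports of all difference quotients with step at most 1 and so carries the
    dominating function.\<close>
  define K where "K = (\<lambda>(x, t). x + t *\<^sub>R b) ` (C \<times> {-1..0 :: real})"
  have K: "compact K" unfolding K_def
    by (intro compact_continuous_image compact_Times C) (auto simp: split_beta intro!: continuous_intros)
  have "compact (pd b F ` C)" by (intro compact_continuous_image C continuous_on_subset[OF c]) auto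
  then obtain M where M: "\<And>x. x \<in> C \<Longrightarrow> \<bar>pd b F x\<bar> \<le> M"
    using compact_imp_bounded bounded_iff by (metis imageI real_norm_def)
  have M': "\<bar>pd b F x\<bar> \<le> \<bar>M\<bar>" for x
  proof (cases "x \<in> C")
    case False
    hence "pd b F x = 0" using C by (intro pd_off[of C]) (auto intro: compact_imp_closed)
    thus ?thesis by simp
  qed (use M in force)
  define h where "h = (\<lambda>n. 1 / real (Suc n))"
  have h: "h n > 0" "h n \<le> 1" for n by (auto simp: h_def)
  have line: "((\<lambda>t. F (x + t *\<^sub>R b)) has_real_derivative pd b F (x + t *\<^sub>R b)) (at t)" for x t
  proof -
    have lin: "linear (\<lambda>v. pd v F (x + t *\<^sub>R b))"
      using pd_has_derivative[OF F] by (auto intro: has_derivative_linear)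
    have "((\<lambda>t. F (x + t *\<^sub>R b)) has_derivative (\<lambda>u. pd (u *\<^sub>R b) F (x + t *\<^sub>R b))) (at t)"
      by (rule has_derivative_compose[of "\<lambda>t. x + t *\<^sub>R b" "\<lambda>u. u *\<^sub>R b" t UNIV, OF _ pd_has_derivative[OF F]])
         (auto intro!: derivative_eq_intros)
    moreover have "(\<lambda>u. pd (u *\<^sub>R b) F (x + t *\<^sub>R b)) = (*) (pd b F (x + t *\<^sub>R b))"
      using linear_scale[OF lin, of _ b] by (simp add: fun_eq_iff mult.commute)
    ultimately show ?thesis by (simp add: has_field_derivative_def)
  qed
  define q where "q = (\<lambda>n x. (F (x + h n *\<^sub>R b) - F x) / h n)"
  have "(\<lambda>n. \<integral>x. q n x \<partial>lborel) \<longlonglongrightarrow> (\<integral>x. pd b F x \<partial>lborel)"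
  proof (rule integral_dominated_convergence)
    show "integrable lborel (\<lambda>x. indicator K x *\<^sub>R \<bar>M\<bar>)"
      by (rule borel_integrable_compact[OF K]) auto
    show "AE x in lborel. (\<lambda>n. q n x) \<longlonglongrightarrow> pd b F x"
    proof (intro AE_I2)
      fix x :: 'a
      have "((\<lambda>u. (F (x + u *\<^sub>R b) - F x) / u) \<longlongrightarrow> pd b F x) (at 0)"
        using line[of x 0] by (simp add: has_field_derivative_iff)
      moreover have "filterlim h (at 0) sequentially"
        unfolding filterlim_at using LIMSEQ_Suc[OF lim_1_over_n] by (auto simp: h_def)
      ultimately show "(\<lambda>n. q n x) \<longlonglongrightarrow> pd b F x" unfolding q_def by (rule filterlim_compose)
    qed
    fix n
    show "AE x in lborel. norm (q n x) \<le> indicator K x *\<^sub>R \<bar>M\<bar>"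
    proof (intro AE_I2)
      fix x :: 'a
      show "norm (q n x) \<le> indicator K x *\<^sub>R \<bar>M\<bar>"
      proof (cases "x \<in> K")
        case True
        obtain z where z: "0 < z" "z < h n" "F (x + h n *\<^sub>R b) - F (x + 0 *\<^sub>R b) = (h n - 0) * pd b F (x + z *\<^sub>R b)"
          using MVT2[OF h(1)[of n], of "\<lambda>t. F (x + t *\<^sub>R b)" "\<lambda>t. pd b F (x + t *\<^sub>R b)"] line by blast
        hence "q n x = pd b F (x + z *\<^sub>R b)" using h(1)[of n] by (simp add: q_def)
        thus ?thesis using M' True by simp
      next
        case False
        have "x \<notin> C" "x + h n *\<^sub>R b \<notin> C"
        proof -
          show "x \<notin> C" using False by (force simp: K_def)
          show "x + h n *\<^sub>R b \<notin> C"
          proof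
            assume "x + h n *\<^sub>R b \<in> C"
            moreover have "x = (x + h n *\<^sub>R b) + (- h n) *\<^sub>R b" by simp
            moreover have "- h n \<in> {-1..0}" using h[of n] by simp
            ultimately have "x \<in> K" unfolding K_def by (metis (mono_tags, lifting) SigmaI case_prod_conv image_eqI)
            thus False using False by simp
          qed
        qed
        thus ?thesis using False C by (simp add: q_def)
      qed
    qed
  qed (auto simp: q_def)
  moreover have "(\<integral>x. q n x \<partial>lborel) = 0" for n
  proof -
    have iF: "integrable lborel F"
    proof -
      have "integrable lborel (\<lambda>x. indicator C x *\<^sub>R F x)"
        by (rule borel_integrable_compact[OF C(1) continuous_on_subset[OF cF]]) auto
      moreover have "(\<lambda>x. indicator C x *\<^sub>R F x) = F" using C by (auto simp: indicator_def fun_eq_iff)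
      ultimately show ?thesis by simp
    qed
    have sh: "integrable lborel (\<lambda>x. F (h n *\<^sub>R b + x))" "(\<integral>x. F (h n *\<^sub>R b + x) \<partial>lborel) = (\<integral>x. F x \<partial>lborel)"
      using iF integrable_distr_eq[of "(+) (h n *\<^sub>R b)" lborel borel F] integral_distr[of "(+) (h n *\<^sub>R b)" lborel borel F]
      by (simp_all add: lborel_distr_plus)
    show ?thesis using iF sh by (simp add: q_def add.commute)
  qed
  ultimately show ?thesis by (simp add: LIMSEQ_const_iff)
qed

lemma ip_lborel:
  assumes "D \<in> sets lebesgue" "f \<in> borel_measurable borel" "g \<in> borel_measurable borel"
    and "\<And>x. x \<notin> D \<Longrightarrow> f x * g x = 0"
  shows "ip D f g = (\<integral>x. f x * g x \<partial>lborel)"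
proof -
  have "ip D f g = (\<integral>x. indicator D x *\<^sub>R (f x * g x) \<partial>lebesgue)"
    unfolding ip_def by (rule integral_restrict_space) (use assms in auto)
  also have "(\<lambda>x. indicator D x *\<^sub>R (f x * g x)) = (\<lambda>x. f x * g x)"
    using assms(4) by (auto simp: indicator_def fun_eq_iff)
  also have "(\<integral>x. f x * g x \<partial>lebesgue) = (\<integral>x. f x * g x \<partial>lborel)"
    by (rule integral_completion) (use assms in measurable)
  finally show ?thesis .
qed

lemma continuous_compact_support_L2:
  assumes "D \<in> sets lebesgue" "continuous_on UNIV f" "compact C" "\<And>x. x \<notin> C \<Longrightarrow> f x = 0"
  shows "f \<in> L2 D"
proof -
  have m: "f \<in> borel_measurable borel" using assms(2) by (rule borel_measurable_continuous_onI)
  have "integrable lborel (\<lambda>x. indicator C x *\<^sub>R (f x)^2)"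
    by (rule borel_integrable_compact[OF assms(3)]) (intro continuous_intros continuous_on_subset[OF assms(2)], auto)
  moreover have "(\<lambda>x. indicator C x *\<^sub>R (f x)^2) = (\<lambda>x. (f x)^2)" using assms(4) by (auto simp: indicator_def fun_eq_iff)
  ultimately have "integrable lebesgue (\<lambda>x. (f x)^2)" using m by (simp add: integrable_completion)
  hence "integrable (lebesgue_on D) (\<lambda>x. (f x)^2)"
    using assms(1) integrable_mult_indicator[of D lebesgue "\<lambda>x. (f x)^2"] by (simp add: integrable_restrict_space)
  thus ?thesis using continuous_imp_measurable_on_sets_lebesgue[OF continuous_on_subset[OF assms(2)] assms(1)]
    by (auto simp: L2_def)
qed

text \<open>Integration by parts: \<open>integral_pd_zero\<close> for the product of g with the test
  function. The statement is for C1 functions g so that it applies to \<theta> times a derivative,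
  where \<theta> is only C1.\<close>

lemma weak_pd_classical:
  assumes D: "open D" and b: "b \<in> Basis"
    and g: "\<And>x. g differentiable (at x)" "continuous_on UNIV (pd b g)"
    and C: "compact C" "\<And>x. x \<notin> C \<Longrightarrow> g x = 0" "C \<subseteq> D"
  shows "weak_pd D b g (pd b g)"
  unfolding weak_pd_def
proof
  fix \<eta> assume "\<eta> \<in> Cc_smooth D"
  hence \<eta>: "smooth \<eta>" by (simp add: Cc_smooth_def)
  have D': "D \<in> sets lebesgue" using D by auto
  have cg: "continuous_on UNIV g"
    using g(1) by (simp add: continuous_at_imp_continuous_on differentiable_imp_continuous_within)
  note c = cg g(2) smooth_continuous[OF \<eta>] smooth_continuous[OF smooth_pd[OF \<eta> b]]
  note [measurable] = c[THEN borel_measurable_continuous_onI]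
  have off: "g x = 0 \<and> pd b g x = 0" if "x \<notin> C" for x
    using that C pd_off[of C g x b] compact_imp_closed by auto
  have i: "integrable lborel (\<lambda>x. f x * k x)" if "continuous_on UNIV f" "continuous_on UNIV k" "\<And>x. x \<notin> C \<Longrightarrow> f x = 0" for f k :: "'a \<Rightarrow> real"
  proof -
    have "integrable lborel (\<lambda>x. indicator C x *\<^sub>R (f x * k x))"
      by (rule borel_integrable_compact[OF C(1)]) (intro continuous_intros continuous_on_subset[OF that(1)] continuous_on_subset[OF that(2)], auto)
    moreover have "(\<lambda>x. indicator C x *\<^sub>R (f x * k x)) = (\<lambda>x. f x * k x)" using that(3) by (auto simp: indicator_def fun_eq_iff)
    ultimately show ?thesis by simp
  qed
  have p: "pd b (\<lambda>x. g x * \<eta> x) = (\<lambda>x. g x * pd b \<eta> x + pd b g x * \<eta> x)"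
    by (intro ext pd_mult g smooth_differentiable \<eta>)
  have "(\<integral>x. pd b (\<lambda>x. g x * \<eta> x) x \<partial>lborel) = 0"
  proof (rule integral_pd_zero[OF b _ _ C(1)])
    show "(\<lambda>x. g x * \<eta> x) differentiable (at x)" for x by (intro differentiable_mult g smooth_differentiable \<eta>)
    show "continuous_on UNIV (pd b (\<lambda>x. g x * \<eta> x))" unfolding p by (intro continuous_intros c)
  qed (use C in auto)
  hence "(\<integral>x. g x * pd b \<eta> x \<partial>lborel) + (\<integral>x. pd b g x * \<eta> x \<partial>lborel) = 0"
    unfolding p using off by (subst (asm) Bochner_Integration.integral_add) (auto intro!: i c)
  moreover have "ip D g (pd b \<eta>) = (\<integral>x. g x * pd b \<eta> x \<partial>lborel)" 
    by (rule ip_lborel[OF D']) (use C in \<open>auto, measurable\<close>)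
  moreover have "ip D (pd b g) \<eta> = (\<integral>x. pd b g x * \<eta> x \<partial>lborel)"
    by (rule ip_lborel[OF D']) (use C off in \<open>auto, measurable\<close>)
  ultimately show "ip D g (pd b \<eta>) = - ip D (pd b g) \<eta>" by simp
qed

lemma C1_closureD:
  assumes "C1_closure D \<theta>" "open D"
  shows "x \<in> D \<Longrightarrow> \<theta> differentiable (at x)" "continuous_on D \<theta>" "b \<in> Basis \<Longrightarrow> continuous_on D (pd b \<theta>)"
proof -
  show "x \<in> D \<Longrightarrow> \<theta> differentiable (at x)" "continuous_on D \<theta>"
    using assms(1) closure_subset[of D] by (auto simp: C1_closure_def intro: continuous_on_subset)
  show "continuous_on D (pd b \<theta>)" if bB: "b \<in> Basis"
  proof -
    obtain g where "continuous_on (closure D) g" "\<forall>x\<in>D. g x = pd b \<theta> x"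
      using assms(1) bB unfolding C1_closure_def by blast
    thus ?thesis using continuous_on_subset[OF _ closure_subset[of D], of g] by (simp cong: continuous_on_cong)
  qed
qed

text \<open>The coefficient is differentiable only inside \<open>D\<close>, but its product with a function vanishing off a
  compact subset of \<open>D\<close> is \<open>C\<^sup>1\<close> on the whole space.\<close>

lemma product_extended_by_zero:
  fixes g :: "'p::euclidean_space \<Rightarrow> real"
  assumes D: "open D" and \<theta>: "\<And>x. x \<in> D \<Longrightarrow> \<theta> differentiable (at x)"
    and g: "\<And>x. g differentiable (at x)" and C: "closed C" "\<And>x. x \<notin> C \<Longrightarrow> g x = 0" "C \<subseteq> D"
  shows "(\<lambda>y. \<theta> y * g y) differentiable (at x)"
    and "pd b (\<lambda>y. \<theta> y * g y) x = (if x \<in> D then \<theta> x * pd b g x + pd b \<theta> x * g x else 0)"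
proof -
  have "(\<lambda>y. \<theta> y * g y) differentiable (at x) \<and>
    pd b (\<lambda>y. \<theta> y * g y) x = (if x \<in> D then \<theta> x * pd b g x + pd b \<theta> x * g x else 0)"
  proof (cases "x \<in> D")
    case True thus ?thesis using \<theta> g by (auto intro!: pd_mult)
  next
    case False
    hence "x \<in> - C" using C by auto
    thus ?thesis using False C pd_zero_open[of "- C" x "\<lambda>y. \<theta> y * g y"] by auto
  qed
  thus "(\<lambda>y. \<theta> y * g y) differentiable (at x)"
    and "pd b (\<lambda>y. \<theta> y * g y) x = (if x \<in> D then \<theta> x * pd b g x + pd b \<theta> x * g x else 0)" by auto
qed

lemma continuous_extended_by_zero:
  fixes f :: "'p::topological_space \<Rightarrow> real"
  assumes "open U" "continuous_on U f" "closed C" "C \<subseteq> U" "\<And>x. x \<notin> C \<Longrightarrow> f x = 0"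
  shows "continuous_on UNIV f"
proof -
  have "continuous_on (- C) f" by (rule continuous_on_eq[OF continuous_on_const, of _ 0]) (use assms(5) in auto)
  hence "continuous_on (U \<union> - C) f" using assms by (intro continuous_on_open_Un) auto
  moreover have "U \<union> - C = UNIV" using assms by auto
  ultimately show ?thesis by simp
qed

text \<open>The generator is given through weak derivatives, while the test functions of the model
  are differentiated classically. This lemma places smooth compactly supported functions in the
  domain and identifies the two operators there.\<close>

lemma div_grad_graph_classical:
  assumes D: "open D" and \<theta>: "C1_closure D \<theta>" and f: "f \<in> Cc_smooth D"
  shows "div_grad_graph D \<theta> f (div_grad \<theta> f)" and "div_grad \<theta> f \<in> L2 D" and "f \<in> L2 D"
proof -
  define C where "C = supp f"
  have sm: "smooth f" and C: "compact C" "C \<subseteq> D" using f by (auto simp: Cc_smooth_def C_def)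
  have cl: "closed C" using C compact_imp_closed by blast
  have z: "f x = 0" if "x \<notin> C" for x using that unfolding C_def by (rule supp_zero)
  have z1: "pd b f x = 0" if "x \<notin> C" for x b using that z cl by (intro pd_off[of C]) auto
  have z2: "pd b (pd c f) x = 0" if "x \<notin> C" for x b c by (rule pd_off[OF cl z1 that])
  have D': "D \<in> sets lebesgue" using D by auto
  note d\<theta> = C1_closureD[OF \<theta> D]
  have L: "f \<in> L2 D" by (rule continuous_compact_support_L2[OF D' smooth_continuous[OF sm] C(1) z])
  have L1: "pd b f \<in> L2 D" if "b \<in> Basis" for b
    by (rule continuous_compact_support_L2[OF D' smooth_continuous[OF smooth_pd[OF sm that]] C(1) z1])
  have L12: "pd c (pd b f) \<in> L2 D" if "b \<in> Basis" "c \<in> Basis" for b c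
    by (rule continuous_compact_support_L2[OF D' smooth_continuous[OF smooth_pd[OF smooth_pd[OF sm that(1)] that(2)]] C(1) z2])
  have w1: "weak_pd D b f (pd b f)" if "b \<in> Basis" for b
    by (rule weak_pd_classical[OF D that smooth_differentiable[OF sm] smooth_continuous[OF smooth_pd[OF sm that]] C(1) z C(2)])
  have w2: "weak_pd D c (pd b f) (pd c (pd b f))" if "b \<in> Basis" "c \<in> Basis" for b c
    by (rule weak_pd_classical[OF D that(2) smooth_differentiable[OF smooth_pd[OF sm that(1)]]
       smooth_continuous[OF smooth_pd[OF smooth_pd[OF sm that(1)] that(2)]] C(1) z1 C(2)])
  define H where "H = (\<lambda>b. pd b (\<lambda>y. \<theta> y * pd b f y))"
  have ext: "(\<lambda>y. \<theta> y * pd b f y) differentiable (at x)"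
    "H b x = (if x \<in> D then \<theta> x * pd b (pd b f) x + pd b \<theta> x * pd b f x else 0)" if "b \<in> Basis" for b x
    unfolding H_def
    by (rule product_extended_by_zero[OF D d\<theta>(1) smooth_differentiable[OF smooth_pd[OF sm that]] cl z1 C(2)], assumption+)+
  have Hz: "H b x = 0" if "b \<in> Basis" "x \<notin> C" for b x
    using ext(2)[OF that(1), of x] z1 z2 that(2) by auto
  have cH: "continuous_on UNIV (H b)" if b: "b \<in> Basis" for b
  proof (rule continuous_extended_by_zero[OF D _ cl C(2) Hz[OF b]])
    have "continuous_on D (\<lambda>x. \<theta> x * pd b (pd b f) x + pd b \<theta> x * pd b f x)"
      by (intro continuous_intros d\<theta> b continuous_on_subset[OF smooth_continuous[OF smooth_pd[OF sm b]]]
          continuous_on_subset[OF smooth_continuous[OF smooth_pd[OF smooth_pd[OF sm b] b]]]) auto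
    thus "continuous_on D (H b)" using ext(2)[OF b] by (simp cong: continuous_on_cong)
  qed
  have LH: "H b \<in> L2 D" if b: "b \<in> Basis" for b
    by (rule continuous_compact_support_L2[OF D' cH[OF b] C(1) Hz[OF b]])
  have wH: "weak_pd D b (\<lambda>y. \<theta> y * pd b f y) (H b)" if b: "b \<in> Basis" for b
    unfolding H_def by (rule weak_pd_classical[OF D b ext(1)[OF b] cH[OF b, unfolded H_def] C(1) _ C(2)]) (simp add: z1)
  have W22: "f \<in> W22 D"
  proof -
    have "pd b f \<in> W12 D" if "b \<in> Basis" for b unfolding W12_def using L1 L12 w2 that by blast
    thus ?thesis using L w1 by (auto simp: W22_def)
  qed
  \<comment> \<open>The constant sequence f serves as the approximating sequence.\<close>
  have W120: "f \<in> W12_0 D"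
    using L f L1 w1 by (auto simp: W12_0_def intro!: exI[of _ "\<lambda>_. f"] bexI[of _ "pd _ f"])
  have e: "div_grad \<theta> f = (\<lambda>x. \<Sum>b\<in>Basis. H b x)" by (simp add: div_grad_def H_def fun_eq_iff)
  show Lu: "div_grad \<theta> f \<in> L2 D" unfolding e using L2_sum[of Basis H D "\<lambda>_. 1"] LH by simp
  show "div_grad_graph D \<theta> f (div_grad \<theta> f)"
  proof -
    have "\<forall>b\<in>Basis. pd b f \<in> L2 D \<and> weak_pd D b f (pd b f) \<and> H b \<in> L2 D \<and> weak_pd D b (\<lambda>x. \<theta> x * pd b f x) (H b)"
      using L1 w1 LH wH by blast
    moreover have "AE x in lebesgue_on D. div_grad \<theta> f x = (\<Sum>b\<in>Basis. H b x)" using e by simp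
    ultimately have "\<exists>G H. (\<forall>b\<in>Basis. G b \<in> L2 D \<and> weak_pd D b f (G b) \<and> H b \<in> L2 D \<and> weak_pd D b (\<lambda>x. \<theta> x * G b x) (H b)) \<and>
        (AE x in lebesgue_on D. div_grad \<theta> f x = (\<Sum>b\<in>Basis. H b x))"
      by (intro exI[where x="\<lambda>b. pd b f"] exI[where x=H] conjI)
    thus ?thesis using W22 W120 Lu unfolding div_grad_graph_def by blast
  qed
  show "f \<in> L2 D" by (rule L)
qed

section \<open>Test functions\<close>

text \<open>Unlike \<^const>\<open>Cc_st\<close>, this also constrains the values at negative times, so that no one-sided
  limits at time 0 occur. All test functions built from the kernel are of this kind.\<close>

definition Cc_fun :: "real \<Rightarrow> 'a::euclidean_space set \<Rightarrow> (real \<times> 'a \<Rightarrow> real) \<Rightarrow> bool" where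
  "Cc_fun T D f \<longleftrightarrow> continuous_on UNIV f \<and> (\<exists>K. compact K \<and> K \<subseteq> {0..<T} \<times> D \<and> (\<forall>z. z \<notin> K \<longrightarrow> f z = 0))"

definition test_function :: "real \<Rightarrow> 'a::euclidean_space set \<Rightarrow> (real \<times> 'a \<Rightarrow> real) \<Rightarrow> bool" where
  "test_function T D \<phi> \<longleftrightarrow> smooth \<phi> \<and> compact (supp \<phi>) \<and> supp \<phi> \<subseteq> {0..<T} \<times> D"

lemma Cc_funI: "continuous_on UNIV f \<Longrightarrow> compact K \<Longrightarrow> K \<subseteq> {0..<T} \<times> D \<Longrightarrow> (\<And>z. z \<notin> K \<Longrightarrow> f z = 0) \<Longrightarrow> Cc_fun T D f"
  unfolding Cc_fun_def by blast

lemma Cc_fun_lincomb: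
  assumes "Cc_fun T D f" "Cc_fun T D g"
  shows "Cc_fun T D (\<lambda>z. a * f z + b * g z)"
proof -
  obtain K L where "compact K" "K \<subseteq> {0..<T} \<times> D" "\<And>z. z \<notin> K \<Longrightarrow> f z = 0"
    "compact L" "L \<subseteq> {0..<T} \<times> D" "\<And>z. z \<notin> L \<Longrightarrow> g z = 0"
    using assms unfolding Cc_fun_def by blast
  thus ?thesis using assms by (intro Cc_funI[of _ "K \<union> L"]) (auto simp: Cc_fun_def intro!: continuous_intros)
qed

lemma Cc_fun_Cc_st:
  assumes "Cc_fun T D f" shows "f \<in> Cc_st T D"
proof -
  obtain K where "compact K" "K \<subseteq> {0..<T} \<times> D" "\<And>z. z \<notin> K \<Longrightarrow> f z = 0"
    using assms unfolding Cc_fun_def by blast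
  thus ?thesis using assms continuous_on_subset[of UNIV f "{0..} \<times> UNIV"]
    by (auto simp: Cc_st_def vanishes_off_def Cc_fun_def)
qed

lemma Cc_fun_L2:
  assumes "open D" "Cc_fun T D f" shows "f \<in> L2 ({0..<T} \<times> D)"
proof -
  obtain K where "compact K" "\<And>z. z \<notin> K \<Longrightarrow> f z = 0"
    using assms unfolding Cc_fun_def by blast
  moreover have "{0..<T} \<times> D \<in> sets borel"
    using assms(1) by (intro borel_Times) auto
  ultimately show ?thesis
    using assms by (intro continuous_compact_support_L2) (auto simp: Cc_fun_def)
qed

lemma test_function_derivatives:
  assumes \<phi>: "test_function T D \<phi>" and D: "open D" and \<theta>: "C1_closure D \<theta>"
  shows "z \<notin> supp \<phi> \<Longrightarrow> dt \<phi> z = 0" "z \<notin> supp \<phi> \<Longrightarrow> Lap \<phi> z = 0" "z \<notin> supp \<phi> \<Longrightarrow> Div_grad \<theta> \<phi> z = 0"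
    and "Cc_fun T D \<phi>" "Cc_fun T D (dt \<phi>)" "Cc_fun T D (Lap \<phi>)" "Cc_fun T D (Div_grad \<theta> \<phi>)"
    and "\<phi> \<in> Cc_smooth_st T D"
    and "(\<lambda>x. \<phi> (t, x)) \<in> Cc_smooth D"
proof -
  define C where "C = supp \<phi>"
  have sm: "smooth \<phi>" and C: "compact C" "C \<subseteq> {0..<T} \<times> D"
    using \<phi> by (auto simp: test_function_def C_def)
  have cl: "closed C" using C compact_imp_closed by blast
  have z: "\<phi> z = 0" if "z \<notin> C" for z using that unfolding C_def by (rule supp_zero)
  have z1: "pd b \<phi> z = 0" if "z \<notin> C" for b z by (rule pd_off[OF cl z that])
  have z2: "pd c (pd b \<phi>) z = 0" if "z \<notin> C" for b c z by (rule pd_off[OF cl z1 that])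
  show "Cc_fun T D \<phi>" using smooth_continuous[OF sm] C z by (rule Cc_funI)
  have dt0: "dt \<phi> z = 0" if "z \<notin> C" for z using z1 that by (simp add: dt_eq[OF sm])
  have Lap0: "Lap \<phi> z = 0" if "z \<notin> C" for z using z2 that by (simp add: Lap_eq[OF sm])
  show "Cc_fun T D (dt \<phi>)"
    using smooth_continuous[OF smooth_pd[OF sm basis_prod(2)]] C dt0 by (intro Cc_funI) (auto simp: dt_eq[OF sm])
  show "Cc_fun T D (Lap \<phi>)"
    using smooth_continuous[OF smooth_pd[OF smooth_pd[OF sm basis_prod(1)] basis_prod(1)]] C Lap0
    by (intro Cc_funI) (auto simp: Lap_eq[OF sm] intro!: continuous_on_sum)
  have sl: "closed {x. (t, x) \<in> C}" "{x. (t, x) \<in> C} \<subseteq> D" "\<And>x. x \<notin> {x. (t, x) \<in> C} \<Longrightarrow> pd (0, b) \<phi> (t, x) = 0" for t and b :: 'a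
  proof -
    have "closed ((\<lambda>x. (t, x)) -` C)" by (intro closed_vimage cl) (auto intro!: continuous_intros)
    thus "closed {x. (t, x) \<in> C}" by (simp add: vimage_def)
  qed (use C z1 in auto)
  have DG: "Div_grad \<theta> \<phi> (t, x) = (if x \<in> D then \<Sum>b\<in>Basis. \<theta> x * pd (0, b) (pd (0, b) \<phi>) (t, x) + pd b \<theta> x * pd (0, b) \<phi> (t, x) else 0)" for t x
  proof -
    have "pd b (\<lambda>y. \<theta> y * pd b (\<lambda>y. \<phi> (t, y)) y) x =
       (if x \<in> D then \<theta> x * pd (0, b) (pd (0, b) \<phi>) (t, x) + pd b \<theta> x * pd (0, b) \<phi> (t, x) else 0)" if b: "b \<in> Basis" for b
    proof -
      note s = smooth_pd[OF sm basis_prod(1)[OF b]]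
      have "pd b (\<lambda>y. \<theta> y * pd (0, b) \<phi> (t, y)) x =
        (if x \<in> D then \<theta> x * pd b (\<lambda>y. pd (0, b) \<phi> (t, y)) x + pd b \<theta> x * pd (0, b) \<phi> (t, x) else 0)"
        by (rule product_extended_by_zero(2)[OF D C1_closureD(1)[OF \<theta> D] smooth_differentiable[OF smooth_slice[OF s]] sl(1) sl(3) sl(2)])
      thus ?thesis using pd_slice[OF sm] pd_slice[OF s] by simp
    qed
    thus ?thesis by (simp add: Div_grad_def div_grad_def)
  qed
  have DG0: "Div_grad \<theta> \<phi> z = 0" if "z \<notin> C" for z
    using that z1 z2 by (cases z) (simp add: DG)
  have "continuous_on UNIV (Div_grad \<theta> \<phi>)"
  proof (rule continuous_extended_by_zero[OF open_Times[OF open_UNIV D] _ cl _ DG0])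
    have "continuous_on (UNIV \<times> D) (\<lambda>z. \<Sum>b\<in>Basis. \<theta> (snd z) * pd (0, b) (pd (0, b) \<phi>) z + pd b \<theta> (snd z) * pd (0, b) \<phi> z)"
    proof (intro continuous_intros)
      show "continuous_on (UNIV \<times> D) (\<lambda>z :: real \<times> 'a. \<theta> (snd z))"
        by (rule continuous_on_compose2[OF C1_closureD(2)[OF \<theta> D]]) (auto intro!: continuous_intros)
      fix b :: 'a assume b: "b \<in> Basis"
      show "continuous_on (UNIV \<times> D) (\<lambda>z :: real \<times> 'a. pd b \<theta> (snd z))"
        by (rule continuous_on_compose2[OF C1_closureD(3)[OF \<theta> D b]]) (auto intro!: continuous_intros)
      show "continuous_on (UNIV \<times> D) (pd (0, b) \<phi>)" "continuous_on (UNIV \<times> D) (pd (0, b) (pd (0, b) \<phi>))"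
        using smooth_continuous[OF smooth_pd[OF sm basis_prod(1)[OF b]]]
          smooth_continuous[OF smooth_pd[OF smooth_pd[OF sm basis_prod(1)[OF b]] basis_prod(1)[OF b]]]
        by (auto intro: continuous_on_subset)
    qed
    thus "continuous_on (UNIV \<times> D) (Div_grad \<theta> \<phi>)"
      by (rule continuous_on_eq) (auto simp: DG)
  qed (use C in auto)
  thus "Cc_fun T D (Div_grad \<theta> \<phi>)" using C DG0 by (rule Cc_funI)
  show "z \<notin> supp \<phi> \<Longrightarrow> dt \<phi> z = 0" "z \<notin> supp \<phi> \<Longrightarrow> Lap \<phi> z = 0" "z \<notin> supp \<phi> \<Longrightarrow> Div_grad \<theta> \<phi> z = 0"
    using dt0 Lap0 DG0 by (auto simp: C_def)
  show "\<phi> \<in> Cc_smooth_st T D"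
    using sm C z by (auto simp: Cc_smooth_st_def vanishes_off_def)
  have sup: "supp (\<lambda>x. \<phi> (t, x)) \<subseteq> {x. (t, x) \<in> C}"
    by (rule supp_minimal[OF sl(1)]) (use z in auto)
  have "compact (snd ` C)" using C by (intro compact_continuous_image continuous_intros)
  hence "bounded (supp (\<lambda>x. \<phi> (t, x)))"
    using sup by (elim bounded_subset[OF compact_imp_bounded]) force
  hence "compact (supp (\<lambda>x. \<phi> (t, x)))" using closed_supp compact_eq_bounded_closed by blast
  thus "(\<lambda>x. \<phi> (t, x)) \<in> Cc_smooth D"
    using smooth_slice[OF sm] sup sl(2) by (auto simp: Cc_smooth_def)
qed

lemma nrm_bounded:
  fixes f :: "'a::euclidean_space \<Rightarrow> real"
  assumes D: "open D" "bounded D" and f: "f \<in> borel_measurable (lebesgue_on D)" and c: "c \<ge> 0" "\<And>x. x \<in> D \<Longrightarrow> \<bar>f x\<bar> \<le> c"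
  shows "f \<in> L2 D" "nrm D f \<le> c * sqrt (measure lebesgue D)"
proof -
  have D': "D \<in> lmeasurable" using D by (simp add: bounded_set_imp_lmeasurable)
  have "(\<integral>\<^sup>+x. ennreal ((f x)\<^sup>2) \<partial>lebesgue_on D) \<le> (\<integral>\<^sup>+x. ennreal (c^2) \<partial>lebesgue_on D)"
    using c by (intro nn_integral_mono) (auto simp: space_restrict_space intro!: ennreal_leI abs_le_square_iff[THEN iffD1])
  also have "\<dots> = ennreal (c^2) * emeasure lebesgue D"
    using D' by (simp add: emeasure_restrict_space space_restrict_space fmeasurableD)
  also have "\<dots> = ennreal ((c * sqrt (measure lebesgue D))^2)"
    unfolding emeasure_eq_measure2[OF D'] by (simp add: power_mult_distrib ennreal_mult')
  finally show "f \<in> L2 D" "nrm D f \<le> c * sqrt (measure lebesgue D)"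
    using nrm_le_of_nn_integral[OF f, of "c * sqrt (measure lebesgue D)"] c by auto
qed

text \<open>Uniform continuity on the compact set [t - 1, t + 1] times the closure of D; restricting
  d to at most 1 keeps s in this time window.\<close>

lemma uniformly_continuous_slices:
  fixes f :: "real \<times> 'a::euclidean_space \<Rightarrow> real"
  assumes D: "bounded D" and f: "continuous_on UNIV f" and e: "e > 0"
  obtains d where "d > 0" "d \<le> 1" "\<And>s x. \<bar>s - t\<bar> < d \<Longrightarrow> x \<in> D \<Longrightarrow> \<bar>f (s, x) - f (t, x)\<bar> < e"
proof -
  have "compact ({t - 1..t + 1} \<times> closure D)" using D by (intro compact_Times) (auto simp: compact_closure)
  hence "uniformly_continuous_on ({t - 1..t + 1} \<times> closure D) f"
    by (intro compact_uniformly_continuous continuous_on_subset[OF f]) auto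
  then obtain d where d: "d > 0" "\<And>z z'. z \<in> {t - 1..t + 1} \<times> closure D \<Longrightarrow> z' \<in> {t - 1..t + 1} \<times> closure D \<Longrightarrow>
      dist z' z < d \<Longrightarrow> dist (f z') (f z) < e"
    using e unfolding uniformly_continuous_on_def by metis
  show thesis
  proof (rule that[of "min d 1"])
    fix s x assume "\<bar>s - t\<bar> < min d 1" "x \<in> D"
    thus "\<bar>f (s, x) - f (t, x)\<bar> < e"
      using d(2)[of "(t, x)" "(s, x)"] closure_subset[of D] by (auto simp: dist_Pair_Pair dist_real_def abs_less_iff subset_iff)
  qed (use d in auto)
qed

lemma slice_measurable:
  fixes f :: "real \<times> 'a::euclidean_space \<Rightarrow> real"
  assumes "open D" "continuous_on UNIV f"
  shows "(\<lambda>x. f (t, x)) \<in> borel_measurable (lebesgue_on D)"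
  using assms by (intro continuous_imp_measurable_on_sets_lebesgue)
    (auto intro!: continuous_on_compose2[OF assms(2)] continuous_intros)

locale heat_domain = l2_semigroup D S
  for D :: "'a::euclidean_space set" and S :: "real \<Rightarrow> ('a \<Rightarrow> real) \<Rightarrow> 'a \<Rightarrow> real" +
  fixes T :: real and \<theta> :: "'a \<Rightarrow> real"
  assumes open_D: "open D" and bounded_D: "bounded D" and T_pos: "T > 0"
    and \<theta>_C1: "C1_closure D \<theta>" and generator: "generates D (div_grad_graph D \<theta>) S"
begin

text \<open>On a set of finite measure, uniform smallness implies smallness in L2.\<close>

lemma nrm_tendsto_0_uniform:
  assumes m: "\<And>q. f q \<in> borel_measurable (lebesgue_on D)"
    and u: "\<And>e. e > 0 \<Longrightarrow> \<forall>\<^sub>F q in F. \<forall>x\<in>D. \<bar>f q x\<bar> \<le> e"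
  shows "((\<lambda>q. nrm D (f q)) \<longlongrightarrow> 0) F"
proof (rule tendstoI)
  fix e :: real assume e: "e > 0"
  define c where "c = sqrt (measure lebesgue D)"
  have c: "c \<ge> 0" by (simp add: c_def)
  have "e / (c + 1) > 0" using e c by simp
  from u[OF this] show "\<forall>\<^sub>F q in F. dist (nrm D (f q)) 0 < e"
  proof eventually_elim
    case (elim q)
    have "nrm D (f q) \<le> e / (c + 1) * c"
      unfolding c_def by (rule nrm_bounded[OF open_D bounded_D m]) (use elim e c in \<open>auto simp: c_def\<close>)
    also have "\<dots> < e" using e c by (simp add: field_simps)
    finally show ?case by (simp add: dist_real_def)
  qed
qed

lemma Cc_fun_slice_L2: "Cc_fun T D f \<Longrightarrow> (\<lambda>x. f (t, x)) \<in> L2 D"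
proof -
  assume f: "Cc_fun T D f"
  then obtain K where K: "compact K" "\<And>z. z \<notin> K \<Longrightarrow> f z = 0" unfolding Cc_fun_def by blast
  have "compact (snd ` K)" using K by (intro compact_continuous_image continuous_intros)
  thus ?thesis
  proof (rule continuous_compact_support_L2[rotated 2])
    show "x \<notin> snd ` K \<Longrightarrow> f (t, x) = 0" for x using K(2)[of "(t, x)"] by force
  qed (use f open_D in \<open>auto simp: Cc_fun_def intro!: continuous_on_compose2[of UNIV f] continuous_intros\<close>)
qed

lemma Cc_fun_supported_family:
  assumes f: "Cc_fun T D f"
  shows "supported_family T (\<lambda>t x. f (t, x))"
  unfolding supported_family_def
proof
  have cf: "continuous_on UNIV f" using f by (simp add: Cc_fun_def)
  show "L2cont {0..} (\<lambda>t x. f (t, x))"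
    unfolding L2cont_iff
  proof (intro ballI conjI Cc_fun_slice_L2 f nrm_tendsto_0_uniform)
    show "(\<lambda>x. f (q, x) - f (p, x)) \<in> borel_measurable (lebesgue_on D)" for p q
      by (intro borel_measurable_diff slice_measurable open_D cf)
    fix p e :: real assume "e > 0"
    then obtain d where d: "d > 0" "\<And>s x. \<bar>s - p\<bar> < d \<Longrightarrow> x \<in> D \<Longrightarrow> \<bar>f (s, x) - f (p, x)\<bar> < e"
      using uniformly_continuous_slices[OF bounded_D cf] by metis
    show "\<forall>\<^sub>F q in at p within {0..}. \<forall>x\<in>D. \<bar>f (q, x) - f (p, x)\<bar> \<le> e"
      unfolding eventually_at using d by (intro exI[of _ d]) (auto simp: dist_real_def less_imp_le)
  qed
  obtain K where "K \<subseteq> {0..<T} \<times> D" "\<And>z. z \<notin> K \<Longrightarrow> f z = 0" using f unfolding Cc_fun_def by blast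
  thus "\<forall>t\<ge>T. (\<lambda>x. f (t, x)) = (\<lambda>x. 0)" by (auto simp: fun_eq_iff) force
qed

text \<open>By the mean value theorem each quotient is a value of \<open>dt \<phi>\<close> at an
  intermediate time, and \<open>dt \<phi>\<close> is uniformly continuous in time over D.\<close>

lemma slice_time_derivative:
  assumes \<phi>: "test_function T D \<phi>"
  shows "((\<lambda>q. nrm D (\<lambda>x. (\<phi> (q, x) - \<phi> (s, x)) / (q - s) - dt \<phi> (s, x))) \<longlongrightarrow> 0) (at s)"
proof (rule nrm_tendsto_0_uniform)
  have sm: "smooth \<phi>" using \<phi> by (simp add: test_function_def)
  have c: "continuous_on UNIV (dt \<phi>)"
    using smooth_continuous[OF smooth_pd[OF sm basis_prod(2)]] by (simp add: dt_eq[OF sm])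
  show "(\<lambda>x. (\<phi> (q, x) - \<phi> (s, x)) / (q - s) - dt \<phi> (s, x)) \<in> borel_measurable (lebesgue_on D)" for q
    by (intro borel_measurable_diff borel_measurable_divide slice_measurable open_D c smooth_continuous[OF sm] borel_measurable_const)
  fix e :: real assume "e > 0"
  then obtain d where d: "d > 0" "\<And>r x. \<bar>r - s\<bar> < d \<Longrightarrow> x \<in> D \<Longrightarrow> \<bar>dt \<phi> (r, x) - dt \<phi> (s, x)\<bar> < e"
    using uniformly_continuous_slices[OF bounded_D c] by metis
  have "\<bar>(\<phi> (q, x) - \<phi> (s, x)) / (q - s) - dt \<phi> (s, x)\<bar> \<le> e" if q: "q \<noteq> s" "\<bar>q - s\<bar> < d" and x: "x \<in> D" for q x
  proof -
    have der: "((\<lambda>r. \<phi> (r, x)) has_real_derivative dt \<phi> (r, x)) (at r)" for r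
      using time_derivative[OF sm] by (simp add: dt_eq[OF sm])
    have "\<exists>r. \<bar>r - s\<bar> < d \<and> (\<phi> (q, x) - \<phi> (s, x)) / (q - s) = dt \<phi> (r, x)"
    proof (cases "q > s")
      case True
      then obtain r where "s < r" "r < q" "\<phi> (q, x) - \<phi> (s, x) = (q - s) * dt \<phi> (r, x)"
        using MVT2[of s q "\<lambda>r. \<phi> (r, x)" "\<lambda>r. dt \<phi> (r, x)"] der by blast
      thus ?thesis using q by (intro exI[of _ r]) auto
    next
      case False
      hence "q < s" using q by simp
      then obtain r where "q < r" "r < s" "\<phi> (s, x) - \<phi> (q, x) = (s - q) * dt \<phi> (r, x)"
        using MVT2[of q s "\<lambda>r. \<phi> (r, x)" "\<lambda>r. dt \<phi> (r, x)"] der by blast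
      thus ?thesis using q by (intro exI[of _ r]) (auto simp: field_simps)
    qed
    thus ?thesis using d(2) x by (auto simp: less_imp_le)
  qed
  thus "\<forall>\<^sub>F q in at s. \<forall>x\<in>D. \<bar>(\<phi> (q, x) - \<phi> (s, x)) / (q - s) - dt \<phi> (s, x)\<bar> \<le> e"
    unfolding eventually_at using d(1) by (intro exI[of _ d]) (auto simp: dist_real_def)
qed

lemma slice_generator:
  assumes \<phi>: "test_function T D \<phi>"
  shows "((\<lambda>h. nrm D (\<lambda>x. (S h (\<lambda>x. \<phi> (s, x)) x - \<phi> (s, x)) / h - Div_grad \<theta> \<phi> (s, x))) \<longlongrightarrow> 0) (at_right 0)"
proof -
  have "(\<lambda>x. \<phi> (s, x)) \<in> Cc_smooth D" using test_function_derivatives(9)[OF \<phi> open_D \<theta>_C1] .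
  from div_grad_graph_classical[OF open_D \<theta>_C1 this] show ?thesis
    using generator unfolding generates_def by (simp add: Div_grad_def)
qed

lemma heat_cov_test_function_adapted:
  assumes f: "Cc_fun T D f" and \<phi>: "test_function T D \<phi>" and t0: "0 \<le> t0" "t0 \<le> T"
    and fz: "\<And>t x. t > t0 \<Longrightarrow> f (t, x) = 0" and supp: "supp \<phi> \<subseteq> {t0<..} \<times> UNIV"
  shows "heat_cov (\<lambda>t x. f (t, x)) (\<lambda>t x. dt \<phi> (t, x) + Div_grad \<theta> \<phi> (t, x)) = 0"
proof (rule heat_cov_adapted[where F="\<lambda>t x. \<phi> (t, x)"])
  note d = test_function_derivatives[OF \<phi> open_D \<theta>_C1]
  show "supported_family T (\<lambda>t x. f (t, x))" "supported_family T (\<lambda>t x. \<phi> (t, x))"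
    "supported_family T (\<lambda>t x. dt \<phi> (t, x))" "supported_family T (\<lambda>t x. Div_grad \<theta> \<phi> (t, x))"
    by (intro Cc_fun_supported_family f d)+
  show "(\<lambda>x. \<phi> (t, x)) = (\<lambda>x. 0) \<and> (\<lambda>x. dt \<phi> (t, x)) = (\<lambda>x. 0) \<and> (\<lambda>x. Div_grad \<theta> \<phi> (t, x)) = (\<lambda>x. 0)" if "t \<le> t0" for t
  proof -
    have "(t, x) \<notin> supp \<phi>" for x using that supp by auto
    thus ?thesis using d(1-3) supp_zero[of _ \<phi>] by simp
  qed
  show "t0 < t \<Longrightarrow> (\<lambda>x. f (t, x)) = (\<lambda>x. 0)" for t using fz by auto
qed (use t0 slice_time_derivative[OF \<phi>] slice_generator[OF \<phi>] in auto)

end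

section \<open>The Gaussian space of the observations\<close>

context gaussian_space
begin

lemma covariance_eq:
  assumes "A \<in> G" "B \<in> G"
  shows "covariance M A B = expectation (\<lambda>\<omega>. A \<omega> * B \<omega>) - expectation A * expectation B"
proof -
  have "covariance M A B = expectation (\<lambda>\<omega>. A \<omega> * B \<omega> - expectation B * A \<omega> - expectation A * B \<omega> + expectation A * expectation B)"
    unfolding covariance_def by (rule Bochner_Integration.integral_cong) (auto simp: algebra_simps)
  also have "\<dots> = expectation (\<lambda>\<omega>. A \<omega> * B \<omega>) - expectation A * expectation B"
    using assms by (simp add: integrable_prod2 integrable_G prob_space)
  finally show ?thesis .
qed

lemma covariance_lincomb:
  assumes "A \<in> G" "B \<in> G" "C \<in> G"
  shows "covariance M (\<lambda>\<omega>. a * A \<omega> + b * B \<omega>) C = a * covariance M A C + b * covariance M B C"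
    and "covariance M C (\<lambda>\<omega>. a * A \<omega> + b * B \<omega>) = a * covariance M C A + b * covariance M C B"
  using assms by (simp_all add: covariance_eq lincomb integrable_prod2 integrable_G algebra_simps)

text \<open>The difference C - a A - b B is centred with variance zero, hence vanishes almost
  surely. This is how linearity of \<open>X\<close> and \<open>V\<close> in the test function is
  obtained, as their definitions prescribe only Gaussianity, means and covariances.\<close>

lemma AE_lincomb:
  assumes G: "A \<in> G" "B \<in> G" "C \<in> G"
    and m: "expectation C = a * expectation A + b * expectation B"
    and c: "\<And>Z. Z \<in> {A, B, C} \<Longrightarrow> covariance M C Z = a * covariance M A Z + b * covariance M B Z"
  shows "AE \<omega> in M. C \<omega> = a * A \<omega> + b * B \<omega>"
proof -
  define L where "L = (\<lambda>\<omega>. a * A \<omega> + b * B \<omega>)"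
  define Z where "Z = (\<lambda>\<omega>. 1 * C \<omega> + (-1) * L \<omega>)"
  have LG: "L \<in> G" unfolding L_def using G by (intro lincomb)
  have ZG: "Z \<in> G" unfolding Z_def using G LG by (intro lincomb)
  have Z0: "covariance M Z U = 0" if "U \<in> {A, B, C}" for U
    using c[OF that] G LG that unfolding Z_def by (subst covariance_lincomb) (auto simp: L_def covariance_lincomb)
  have "covariance M Z Z = covariance M Z C - (a * covariance M Z A + b * covariance M Z B)"
    using covariance_lincomb(2)[OF G(3) LG ZG, of 1 "-1"] covariance_lincomb(2)[OF G(1,2) ZG, of a b]
    by (simp only: Z_def[symmetric] L_def[symmetric]) simp
  hence "covariance M Z Z = 0" using Z0 by simp
  moreover have "expectation Z = 0"
    using m G LG by (simp add: Z_def L_def integrable_G)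
  ultimately have "expectation (\<lambda>\<omega>. (Z \<omega>)^2) = 0"
    using covariance_eq[OF ZG ZG] by (simp add: power2_eq_square)
  hence "AE \<omega> in M. (Z \<omega>)^2 = 0"
    using integrable_power_G[OF ZG, of 2] by (subst (asm) integral_nonneg_eq_0_iff_AE) auto
  thus ?thesis by eventually_elim (simp add: Z_def L_def)
qed

end

definition span_of :: "'i set \<Rightarrow> ('i \<Rightarrow> 'w \<Rightarrow> real) \<Rightarrow> ('w \<Rightarrow> real) set" where
  "span_of J Z = {\<lambda>\<omega>. \<Sum>i\<in>F. c i * Z i \<omega> | F c. finite F \<and> F \<subseteq> J}"

lemma span_of_lincomb:
  assumes "A \<in> span_of J Z" "B \<in> span_of J Z"
  shows "(\<lambda>\<omega>. a * A \<omega> + b * B \<omega>) \<in> span_of J Z"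
proof -
  obtain F c where F: "finite F" "F \<subseteq> J" "A = (\<lambda>\<omega>. \<Sum>i\<in>F. c i * Z i \<omega>)"
    using assms(1) unfolding span_of_def by blast
  obtain E e where E: "finite E" "E \<subseteq> J" "B = (\<lambda>\<omega>. \<Sum>i\<in>E. e i * Z i \<omega>)"
    using assms(2) unfolding span_of_def by blast
  define k where "k = (\<lambda>i. a * (if i \<in> F then c i else 0) + b * (if i \<in> E then e i else 0))"
  have "a * A \<omega> + b * B \<omega> = (\<Sum>i\<in>F \<union> E. k i * Z i \<omega>)" for \<omega>
  proof -
    have "A \<omega> = (\<Sum>i\<in>F \<union> E. (if i \<in> F then c i else 0) * Z i \<omega>)"
      unfolding F(3) by (rule sum.mono_neutral_cong_left) (use F E in auto)
    moreover have "B \<omega> = (\<Sum>i\<in>F \<union> E. (if i \<in> E then e i else 0) * Z i \<omega>)"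
      unfolding E(3) by (rule sum.mono_neutral_cong_left) (use F E in auto)
    ultimately show ?thesis by (simp only: k_def sum_distrib_left distrib_right sum.distrib mult.assoc)
  qed
  thus ?thesis unfolding span_of_def using F E by (auto intro!: exI[of _ "F \<union> E"] exI[of _ k])
qed

lemma span_of_base: "i \<in> J \<Longrightarrow> Z i \<in> span_of J Z"
  unfolding span_of_def by (intro CollectI exI[of _ "{i}"] exI[of _ "\<lambda>_. 1"]) auto

lemma span_of_zero: "(\<lambda>\<omega>. 0) \<in> span_of J Z"
  unfolding span_of_def by (intro CollectI exI[of _ "{}"]) auto

lemma span_of_measurable:
  assumes "A \<in> span_of J Z" "\<And>i. i \<in> J \<Longrightarrow> Z i \<in> borel_measurable N"
  shows "A \<in> borel_measurable N"
proof -
  obtain F c where F: "finite F" "F \<subseteq> J" "A = (\<lambda>\<omega>. \<Sum>i\<in>F. c i * Z i \<omega>)"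
    using assms(1) unfolding span_of_def by blast
  thus ?thesis using assms(2) by (auto intro!: borel_measurable_sum borel_measurable_times)
qed

text \<open>Finite linear combinations are measurable for the sigma-algebra generated by the
  coordinate events. This transports the assumed independence from the processes to their
  spans.\<close>

lemma preimage_in_sigma_sets:
  assumes A: "A \<in> span_of J Z" and J: "process_events M J Z \<subseteq> E" and E: "E \<subseteq> Pow (space M)" and B: "B \<in> sets borel"
  shows "A -` B \<inter> space M \<in> sigma_sets (space M) E"
proof -
  let ?N = "sigma (space M) E"
  have "Z i \<in> borel_measurable ?N" if "i \<in> J" for i
  proof (rule measurableI)
    fix B :: "real set" assume "B \<in> sets borel"
    hence "Z i -` B \<inter> space M \<in> E" using J that by (intro subsetD[OF J[unfolded process_events_def]] CollectI exI[of _ i] exI[of _ B]) simp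
    thus "Z i -` B \<inter> space ?N \<in> sets ?N"
      unfolding space_measure_of[OF E] sets_measure_of[OF E] by (rule sigma_sets.Basic)
  qed simp
  with A have "A \<in> borel_measurable ?N" by (rule span_of_measurable)
  from measurable_sets[OF this B] show ?thesis unfolding space_measure_of[OF E] sets_measure_of[OF E] .
qed

locale heat_model = prob_space M + heat_domain D S T \<theta>
  for M :: "'w measure" and D :: "'a::euclidean_space set" and S T \<theta> +
  fixes \<sigma> :: real and \<xi> :: "'a \<Rightarrow> real" and X W V :: "(real \<times> 'a \<Rightarrow> real) \<Rightarrow> 'w \<Rightarrow> real"
  assumes \<xi>: "\<xi> \<in> L2 D" and W: "isonormal M ({0..<T} \<times> D) W" and X: "heat_process M T D S \<sigma> \<xi> X"
    and eqn: "solves_heat_equation M T D \<theta> \<sigma> \<xi> X W" and V: "isonormal M ({0..<T} \<times> D) V"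
    and indep: "independent_of_pair M T D V X W"
begin

abbreviation "Q \<equiv> {0..<T} \<times> D"

text \<open>Kept as an X-part plus a V-part because these are independent, so that every element is
  a sum of two independent Gaussian variables and hence Gaussian.\<close>

definition observations :: "('w \<Rightarrow> real) set" where
  "observations = {\<lambda>\<omega>. A \<omega> + B \<omega> | A B. A \<in> span_of (Cc_st T D) X \<and> B \<in> span_of (L2 Q) V}"

lemma gaussian_span:
  assumes "gaussian_process M J Z" "A \<in> span_of J Z"
  shows "gaussian_rv M A"
  using assms unfolding gaussian_process_def span_of_def by auto

lemma X_gaussian: "A \<in> span_of (Cc_st T D) X \<Longrightarrow> gaussian_rv M A"
  using X gaussian_span unfolding heat_process_def by blast

lemma V_gaussian: "A \<in> span_of (L2 Q) V \<Longrightarrow> gaussian_rv M A"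
  using V gaussian_span unfolding isonormal_def by blast

lemma span_indep:
  assumes A: "A \<in> span_of (Cc_st T D) X" and B: "B \<in> span_of (L2 Q) V"
  shows "indep_var borel A borel B"
proof -
  let ?EX = "process_events M (Cc_st T D) X \<union> process_events M (L2 Q) W" and ?EV = "process_events M (L2 Q) V"
  have A': "A \<in> borel_measurable M" and B': "B \<in> borel_measurable M"
    using X_gaussian[OF A] V_gaussian[OF B] by (auto simp: gaussian_rv_def)
  have "indep_set (sigma_sets (space M) ?EX) (sigma_sets (space M) ?EV)"
    using indep unfolding independent_of_pair_def indep_sets2_eq by (metis Int_commute mult.commute)
  moreover have "sigma_sets (space M) {A -` b \<inter> space M |b. b \<in> sets borel} \<subseteq> sigma_sets (space M) ?EX"
    by (intro sigma_sets_mono) (auto intro!: preimage_in_sigma_sets[OF A] simp: process_events_def)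
  moreover have "sigma_sets (space M) {B -` b \<inter> space M |b. b \<in> sets borel} \<subseteq> sigma_sets (space M) ?EV"
    by (intro sigma_sets_mono) (auto intro!: preimage_in_sigma_sets[OF B] simp: process_events_def)
  ultimately have "indep_set (sigma_sets (space M) {A -` b \<inter> space M |b. b \<in> sets borel})
      (sigma_sets (space M) {B -` b \<inter> space M |b. b \<in> sets borel})"
    unfolding indep_sets2_eq by blast
  thus ?thesis unfolding indep_var_eq using A' B' by simp
qed

sublocale gaussian_space M observations
proof
  fix Z Z' a b assume "Z \<in> observations"
  then obtain A B where AB: "A \<in> span_of (Cc_st T D) X" "B \<in> span_of (L2 Q) V" "Z = (\<lambda>\<omega>. A \<omega> + B \<omega>)"
    unfolding observations_def by blast
  show "gaussian_rv M Z"
    unfolding AB(3) using prob_space_axioms AB by (intro gaussian_rv_add_indep X_gaussian V_gaussian span_indep)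
  assume "Z' \<in> observations"
  then obtain A' B' where AB': "A' \<in> span_of (Cc_st T D) X" "B' \<in> span_of (L2 Q) V" "Z' = (\<lambda>\<omega>. A' \<omega> + B' \<omega>)"
    unfolding observations_def by blast
  have "(\<lambda>\<omega>. a * Z \<omega> + b * Z' \<omega>) = (\<lambda>\<omega>. (a * A \<omega> + b * A' \<omega>) + (a * B \<omega> + b * B' \<omega>))"
    by (simp add: AB(3) AB'(3) algebra_simps)
  thus "(\<lambda>\<omega>. a * Z \<omega> + b * Z' \<omega>) \<in> observations"
    using span_of_lincomb[OF AB(1) AB'(1), of a b] span_of_lincomb[OF AB(2) AB'(2), of a b]
    unfolding observations_def by (intro CollectI exI conjI)
qed

lemma X_obs: "f \<in> Cc_st T D \<Longrightarrow> X f \<in> observations"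
  unfolding observations_def by (intro CollectI exI[of _ "X f"] exI[of _ "\<lambda>\<omega>. 0"]) (auto intro: span_of_base span_of_zero)

lemma V_obs: "f \<in> L2 Q \<Longrightarrow> V f \<in> observations"
  unfolding observations_def by (intro CollectI exI[of _ "\<lambda>\<omega>. 0"] exI[of _ "V f"]) (auto intro: span_of_base span_of_zero)

lemma V_mean: "f \<in> L2 Q \<Longrightarrow> expectation (V f) = 0"
  and V_cov: "f \<in> L2 Q \<Longrightarrow> g \<in> L2 Q \<Longrightarrow> covariance M (V f) (V g) = ip Q f g"
  using V by (auto simp: isonormal_def)

lemma VV: "f \<in> L2 Q \<Longrightarrow> g \<in> L2 Q \<Longrightarrow> expectation (\<lambda>\<omega>. V f \<omega> * V g \<omega>) = ip Q f g"
  using V_cov covariance_eq[OF V_obs V_obs] V_mean by simp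

lemma X_cov: "f \<in> Cc_st T D \<Longrightarrow> g \<in> Cc_st T D \<Longrightarrow>
    covariance M (X f) (X g) = \<sigma>\<^sup>2 / 2 * heat_cov (\<lambda>t x. f (t, x)) (\<lambda>t x. g (t, x))"
  using X by (simp add: heat_process_def heat_cov_def inner_cov_def)

lemma XV:
  assumes "f \<in> Cc_st T D" "g \<in> L2 Q"
  shows "expectation (\<lambda>\<omega>. X f \<omega> * V g \<omega>) = 0"
  using indep_var_lebesgue_integral[OF span_indep[OF span_of_base span_of_base]] integrable_G[OF X_obs] integrable_G[OF V_obs] assms V_mean
  by simp

lemma mean_integrable:
  assumes "Cc_fun T D f"
  shows "set_integrable lebesgue {0..<T} (\<lambda>t. ip D (S t \<xi>) (\<lambda>x. f (t, x)))"
proof (rule set_integrable_subset)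
  have "continuous_on {0..} (\<lambda>t. ip D (S t \<xi>) (\<lambda>x. f (t, x)))"
    using Cc_fun_supported_family[OF assms] by (intro L2cont_ip L2cont_S_const \<xi>) (simp add: supported_family_def)
  thus "set_integrable lebesgue {0..T} (\<lambda>t. ip D (S t \<xi>) (\<lambda>x. f (t, x)))"
    by (intro set_lebesgue_integral_interval continuous_on_subset[where t="{0..T}"]) auto
qed auto

text \<open>Means and covariances of \<open>X\<close> are linear in the test function because the
  inner product, the semigroup and the integrals are; \<open>AE_lincomb\<close> turns this into
  almost sure linearity.\<close>

lemma X_lincomb:
  assumes f: "Cc_fun T D f" and g: "Cc_fun T D g"
  shows "AE \<omega> in M. X (\<lambda>z. a * f z + b * g z) \<omega> = a * X f \<omega> + b * X g \<omega>"
proof (rule AE_lincomb)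
  let ?h = "\<lambda>z. a * f z + b * g z"
  have h: "Cc_fun T D ?h" by (rule Cc_fun_lincomb[OF f g])
  note C = Cc_fun_Cc_st[OF f] Cc_fun_Cc_st[OF g] Cc_fun_Cc_st[OF h]
  show "X f \<in> observations" "X g \<in> observations" "X ?h \<in> observations" by (intro X_obs C)+
  have "(LINT t:{0..<T}|lebesgue. ip D (S t \<xi>) (\<lambda>x. ?h (t, x))) =
      a * (LINT t:{0..<T}|lebesgue. ip D (S t \<xi>) (\<lambda>x. f (t, x))) + b * (LINT t:{0..<T}|lebesgue. ip D (S t \<xi>) (\<lambda>x. g (t, x)))"
    by (intro set_integral_lincomb mean_integrable f g) (auto intro!: ip_lincomb Cc_fun_slice_L2 f g S_L2 \<xi>)
  thus "expectation (X ?h) = a * expectation (X f) + b * expectation (X g)"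
    using X C by (simp add: heat_process_def)
  fix Z assume "Z \<in> {X f, X g, X ?h}"
  then obtain k where k: "Cc_fun T D k" "Z = X k" using f g h by blast
  have "heat_cov (\<lambda>t x. ?h (t, x)) (\<lambda>t x. k (t, x)) = a * heat_cov (\<lambda>t x. f (t, x)) (\<lambda>t x. k (t, x)) + b * heat_cov (\<lambda>t x. g (t, x)) (\<lambda>t x. k (t, x))"
    by (intro heat_cov_lincomb[where T=T] Cc_fun_supported_family f g k)
  thus "covariance M (X ?h) Z = a * covariance M (X f) Z + b * covariance M (X g) Z"
    using C Cc_fun_Cc_st[OF k(1)] by (simp add: k X_cov algebra_simps)
qed

lemma V_lincomb:
  assumes f: "f \<in> L2 Q" and g: "g \<in> L2 Q"
  shows "AE \<omega> in M. V (\<lambda>z. a * f z + b * g z) \<omega> = a * V f \<omega> + b * V g \<omega>"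
proof (rule AE_lincomb)
  let ?h = "\<lambda>z. a * f z + b * g z"
  have h: "?h \<in> L2 Q" by (rule L2_lincomb[OF f g])
  show "V f \<in> observations" "V g \<in> observations" "V ?h \<in> observations" by (intro V_obs f g h)+
  show "expectation (V ?h) = a * expectation (V f) + b * expectation (V g)"
    using V_mean f g h by simp
  fix Z assume "Z \<in> {V f, V g, V ?h}"
  then obtain k where k: "k \<in> L2 Q" "Z = V k" using f g h by blast
  thus "covariance M (V ?h) Z = a * covariance M (V f) Z + b * covariance M (V g) Z"
    using f g h by (simp add: V_cov ip_lincomb)
qed

text \<open>The equation identifies \<open>\<zeta> \<phi>\<close> with \<open>\<sigma> W \<phi>\<close>; in this form it lies in the Gaussian space
  generated by \<open>X\<close> and \<open>V\<close>, so no joint law with \<open>W\<close> is needed.\<close>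

definition \<zeta> :: "(real \<times> 'a \<Rightarrow> real) \<Rightarrow> 'w \<Rightarrow> real" where
  "\<zeta> \<phi> = (\<lambda>\<omega>. (-1) * X (dt \<phi>) \<omega> + (-1) * X (Div_grad \<theta> \<phi>) \<omega>)"

lemmas test_Cc_fun = test_function_derivatives(4-7)[OF _ open_D \<theta>_C1]
lemmas test_Cc_st = test_Cc_fun[THEN Cc_fun_Cc_st]
lemmas test_L2 = test_Cc_fun[THEN Cc_fun_L2[OF open_D]]

lemma \<zeta>_obs: "test_function T D \<phi> \<Longrightarrow> \<zeta> \<phi> \<in> observations"
  unfolding \<zeta>_def by (intro lincomb X_obs test_Cc_st)

lemma V_\<zeta>:
  assumes \<phi>: "test_function T D \<phi>" and f: "f \<in> L2 Q"
  shows "expectation (\<lambda>\<omega>. V f \<omega> * \<zeta> \<phi> \<omega>) = 0"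
proof -
  note i = integrable_prod2[OF X_obs V_obs, OF _ f]
  note C = test_Cc_st[OF \<phi>]
  have "expectation (\<lambda>\<omega>. V f \<omega> * \<zeta> \<phi> \<omega>) = expectation (\<lambda>\<omega>. (-1) * (X (dt \<phi>) \<omega> * V f \<omega>) + (-1) * (X (Div_grad \<theta> \<phi>) \<omega> * V f \<omega>))"
    unfolding \<zeta>_def by (rule Bochner_Integration.integral_cong) (auto simp: algebra_simps)
  also have "\<dots> = 0"
    using i[OF C(2)] i[OF C(4)] XV[OF _ f] C by (subst Bochner_Integration.integral_add) auto
  finally show ?thesis .
qed

context
  fixes \<phi> assumes \<phi>: "test_function T D \<phi>" and pos: "supp \<phi> \<subseteq> {0<..} \<times> UNIV"
begin

lemma \<zeta>_AE: "AE \<omega> in M. \<zeta> \<phi> \<omega> = \<sigma> * W \<phi> \<omega>"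
proof -
  \<comment> \<open>The support avoids time 0, so the initial condition drops out of the
    equation.\<close>
  have "(\<lambda>x. \<phi> (0, x)) = (\<lambda>x. 0)" using pos by (intro ext supp_zero) auto
  hence "ip D \<xi> (\<lambda>x. \<phi> (0, x)) = 0" by (simp add: ip_def)
  moreover have "AE \<omega> in M. - X (dt \<phi>) \<omega> = ip D \<xi> (\<lambda>x. \<phi> (0, x)) + X (Div_grad \<theta> \<phi>) \<omega> + \<sigma> * W \<phi> \<omega>"
    using eqn test_function_derivatives(8)[OF \<phi> open_D \<theta>_C1] by (simp add: solves_heat_equation_def)
  ultimately show ?thesis by (auto simp: \<zeta>_def elim!: eventually_mono)
qed

lemma W_measurable: "W \<phi> \<in> borel_measurable M" "expectation (W \<phi>) = 0"
proof -
  have "gaussian_process M (L2 Q) W" using W by (simp add: isonormal_def)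
  hence "gaussian_rv M (W \<phi>)" by (rule gaussian_span[OF _ span_of_base[OF test_L2(1)[OF \<phi>]]])
  thus "W \<phi> \<in> borel_measurable M" by (simp add: gaussian_rv_def)
  show "expectation (W \<phi>) = 0" using W test_L2(1)[OF \<phi>] by (simp add: isonormal_def)
qed

lemma \<zeta>_mean: "expectation (\<zeta> \<phi>) = 0"
proof -
  have "expectation (\<zeta> \<phi>) = expectation (\<lambda>\<omega>. \<sigma> * W \<phi> \<omega>)"
    by (rule integral_cong_AE) (use \<zeta>_AE W_measurable measurable_G[OF \<zeta>_obs[OF \<phi>]] in auto)
  thus ?thesis by (simp add: W_measurable)
qed

text \<open>Adaptedness: the covariance is -\<sigma>^2 / 2 times \<open>heat_cov\<close> against
  \<open>dt \<phi>\<close> + \<open>Div_grad \<theta> \<phi>\<close>, which vanishes for a test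
  function supported after t0. The product moment equals the covariance because
  \<open>\<zeta> \<phi>\<close> is centred.\<close>

lemma X_\<zeta>:
  assumes f: "Cc_fun T D f" and t0: "0 \<le> t0" "t0 \<le> T" "\<And>t x. t > t0 \<Longrightarrow> f (t, x) = 0" and supp: "supp \<phi> \<subseteq> {t0<..} \<times> UNIV"
  shows "expectation (\<lambda>\<omega>. X f \<omega> * \<zeta> \<phi> \<omega>) = 0"
proof -
  have "covariance M (X f) (\<zeta> \<phi>) = - covariance M (X f) (X (dt \<phi>)) - covariance M (X f) (X (Div_grad \<theta> \<phi>))"
    unfolding \<zeta>_def by (subst covariance_lincomb) (auto intro!: X_obs test_Cc_st[OF \<phi>] Cc_fun_Cc_st[OF f])
  also have "\<dots> = - \<sigma>\<^sup>2 / 2 * (1 * heat_cov (\<lambda>t x. f (t, x)) (\<lambda>t x. dt \<phi> (t, x)) + 1 * heat_cov (\<lambda>t x. f (t, x)) (\<lambda>t x. Div_grad \<theta> \<phi> (t, x)))"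
    using Cc_fun_Cc_st[OF f] test_Cc_st[OF \<phi>] by (simp add: X_cov algebra_simps)
  also have "\<dots> = - \<sigma>\<^sup>2 / 2 * heat_cov (\<lambda>t x. f (t, x)) (\<lambda>t x. 1 * dt \<phi> (t, x) + 1 * Div_grad \<theta> \<phi> (t, x))"
    by (subst heat_cov_lincomb(2)[where T=T]) (auto intro!: Cc_fun_supported_family test_Cc_fun \<phi> f)
  also have "\<dots> = 0"
    using heat_cov_test_function_adapted[OF f \<phi> t0 supp] by simp
  finally show ?thesis
    using covariance_eq[OF X_obs[OF Cc_fun_Cc_st[OF f]] \<zeta>_obs[OF \<phi>]] \<zeta>_mean by simp
qed

end

text \<open>The second moments are taken from the isonormal process through the almost sure identity
  with \<sigma> W, which avoids evaluating the heat covariance on overlapping time ranges.\<close>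

lemma \<zeta>_\<zeta>:
  assumes \<phi>: "test_function T D \<phi>" "supp \<phi> \<subseteq> {0<..} \<times> UNIV" and \<psi>: "test_function T D \<psi>" "supp \<psi> \<subseteq> {0<..} \<times> UNIV"
  shows "expectation (\<lambda>\<omega>. \<zeta> \<phi> \<omega> * \<zeta> \<psi> \<omega>) = \<sigma>\<^sup>2 * ip Q \<phi> \<psi>"
proof -
  have [measurable]: "W \<phi> \<in> borel_measurable M" "W \<psi> \<in> borel_measurable M" "\<zeta> \<phi> \<in> borel_measurable M" "\<zeta> \<psi> \<in> borel_measurable M"
    using W_measurable \<phi> \<psi> \<zeta>_obs measurable_G by blast+
  have "expectation (\<lambda>\<omega>. \<zeta> \<phi> \<omega> * \<zeta> \<psi> \<omega>) = expectation (\<lambda>\<omega>. \<sigma>\<^sup>2 * (W \<phi> \<omega> * W \<psi> \<omega>))"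
  proof (rule integral_cong_AE)
    show "AE \<omega> in M. \<zeta> \<phi> \<omega> * \<zeta> \<psi> \<omega> = \<sigma>\<^sup>2 * (W \<phi> \<omega> * W \<psi> \<omega>)"
      using \<zeta>_AE[OF \<phi>] \<zeta>_AE[OF \<psi>] by eventually_elim (simp add: power2_eq_square)
  qed measurable
  moreover have "covariance M (W \<phi>) (W \<psi>) = ip Q \<phi> \<psi>"
    using W test_L2(1)[OF \<phi>(1)] test_L2(1)[OF \<psi>(1)] by (simp add: isonormal_def)
  ultimately show ?thesis
    using W_measurable(2)[OF \<phi>] W_measurable(2)[OF \<psi>] by (simp add: covariance_def)
qed

end

section \<open>Rescaled kernels\<close>

lemma ip_disjoint: "(\<And>z. f z = 0 \<or> g z = 0) \<Longrightarrow> ip A f g = 0"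
proof -
  assume h: "\<And>z. f z = 0 \<or> g z = 0"
  have "(\<lambda>z. f z * g z) = (\<lambda>z. 0)" using h by (auto simp: fun_eq_iff)
  thus ?thesis by (simp add: ip_def)
qed

context heat_model
begin

text \<open>The backward heat operator with constant coefficient a. In the application a is \<theta>
  frozen at the point of estimation.\<close>

definition symbol :: "real \<Rightarrow> (real \<times> 'a \<Rightarrow> real) \<Rightarrow> real \<times> 'a \<Rightarrow> real" where
  "symbol a \<phi> = (\<lambda>z. dt \<phi> z + a * Lap \<phi> z)"

text \<open>The error of one regression equation: the dynamic noise \<sigma> W, present as
  \<open>\<zeta> \<phi>\<close>, together with the observation noise, which enters both the time
  derivative and the Laplacian and combines into \<open>V (symbol a \<phi>)\<close>.\<close>

definition noise :: "real \<Rightarrow> real \<Rightarrow> (real \<times> 'a \<Rightarrow> real) \<Rightarrow> 'w \<Rightarrow> real" where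
  "noise a \<epsilon> \<phi> = (\<lambda>\<omega>. 1 * \<zeta> \<phi> \<omega> + (- \<epsilon>) * V (symbol a \<phi>) \<omega>)"

definition lap_obs :: "real \<Rightarrow> (real \<times> 'a \<Rightarrow> real) \<Rightarrow> 'w \<Rightarrow> real" where
  "lap_obs \<epsilon> \<phi> = (\<lambda>\<omega>. 1 * X (Lap \<phi>) \<omega> + \<epsilon> * V (Lap \<phi>) \<omega>)"

context
  fixes \<phi> assumes \<phi>: "test_function T D \<phi>"
begin

lemma symbol_Cc_fun: "Cc_fun T D (symbol a \<phi>)"
  using Cc_fun_lincomb[OF test_Cc_fun(2)[OF \<phi>] test_Cc_fun(3)[OF \<phi>], of 1 a] by (simp add: symbol_def)

lemma symbol_L2: "symbol a \<phi> \<in> L2 Q"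
  by (rule Cc_fun_L2[OF open_D symbol_Cc_fun])

lemma symbol_off: "z \<notin> supp \<phi> \<Longrightarrow> symbol a \<phi> z = 0"
  using test_function_derivatives(1,2)[OF \<phi> open_D \<theta>_C1] by (simp add: symbol_def)

lemma noise_obs: "noise a \<epsilon> \<phi> \<in> observations"
  unfolding noise_def by (intro lincomb \<zeta>_obs[OF \<phi>] V_obs symbol_L2)

lemma noise_mean: "supp \<phi> \<subseteq> {0<..} \<times> UNIV \<Longrightarrow> expectation (noise a \<epsilon> \<phi>) = 0"
  unfolding noise_def using \<zeta>_mean[OF \<phi>] V_mean[OF symbol_L2]
    integrable_G[OF \<zeta>_obs[OF \<phi>]] integrable_G[OF V_obs[OF symbol_L2]] by simp

lemma lap_obs_obs: "lap_obs \<epsilon> \<phi> \<in> observations"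
  unfolding lap_obs_def by (intro lincomb X_obs V_obs test_Cc_st test_L2 \<phi>)

text \<open>The regression of the time derivative on the Laplacian has two residuals: the effect of
  freezing the coefficient, and the noise. The equation is absorbed in the definition of
  \<open>\<zeta>\<close>, so only the almost sure linearity of \<open>X\<close> and \<open>V\<close>
  enters.\<close>

lemma residual_AE:
  "AE \<omega> in M. - (X (dt \<phi>) \<omega> + \<epsilon> * V (dt \<phi>) \<omega>) - a * (X (Lap \<phi>) \<omega> + \<epsilon> * V (Lap \<phi>) \<omega>)
      = X (\<lambda>z. Div_grad \<theta> \<phi> z - a * Lap \<phi> z) \<omega> + noise a \<epsilon> \<phi> \<omega>"
proof -
  have "AE \<omega> in M. X (\<lambda>z. Div_grad \<theta> \<phi> z - a * Lap \<phi> z) \<omega> = X (Div_grad \<theta> \<phi>) \<omega> - a * X (Lap \<phi>) \<omega>"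
    using X_lincomb[OF test_Cc_fun(4)[OF \<phi>] test_Cc_fun(3)[OF \<phi>], of 1 "-a"] by simp
  moreover have "AE \<omega> in M. V (symbol a \<phi>) \<omega> = V (dt \<phi>) \<omega> + a * V (Lap \<phi>) \<omega>"
    using V_lincomb[OF test_L2(2)[OF \<phi>] test_L2(3)[OF \<phi>], of 1 a] by (simp add: symbol_def)
  ultimately show ?thesis by eventually_elim (simp add: noise_def \<zeta>_def algebra_simps)
qed

end

lemma noise_noise:
  assumes \<phi>: "test_function T D \<phi>" "supp \<phi> \<subseteq> {0<..} \<times> UNIV" and \<psi>: "test_function T D \<psi>" "supp \<psi> \<subseteq> {0<..} \<times> UNIV"
  shows "expectation (\<lambda>\<omega>. noise a \<epsilon> \<phi> \<omega> * noise a \<epsilon> \<psi> \<omega>) = \<sigma>\<^sup>2 * ip Q \<phi> \<psi> + \<epsilon>\<^sup>2 * ip Q (symbol a \<phi>) (symbol a \<psi>)"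
proof -
  note o = \<zeta>_obs[OF \<phi>(1)] \<zeta>_obs[OF \<psi>(1)] V_obs[OF symbol_L2[OF \<phi>(1)]] V_obs[OF symbol_L2[OF \<psi>(1)]]
  have "expectation (\<lambda>\<omega>. noise a \<epsilon> \<phi> \<omega> * noise a \<epsilon> \<psi> \<omega>) = expectation (\<lambda>\<omega>. \<zeta> \<phi> \<omega> * \<zeta> \<psi> \<omega> + (-\<epsilon>) * (V (symbol a \<phi>) \<omega> * \<zeta> \<psi> \<omega>)
      + (-\<epsilon>) * (V (symbol a \<psi>) \<omega> * \<zeta> \<phi> \<omega>) + \<epsilon>^2 * (V (symbol a \<phi>) \<omega> * V (symbol a \<psi>) \<omega>))"
    by (rule Bochner_Integration.integral_cong) (auto simp: noise_def algebra_simps power2_eq_square)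
  also have "\<dots> = expectation (\<lambda>\<omega>. \<zeta> \<phi> \<omega> * \<zeta> \<psi> \<omega>) + (-\<epsilon>) * expectation (\<lambda>\<omega>. V (symbol a \<phi>) \<omega> * \<zeta> \<psi> \<omega>)
      + (-\<epsilon>) * expectation (\<lambda>\<omega>. V (symbol a \<psi>) \<omega> * \<zeta> \<phi> \<omega>) + \<epsilon>^2 * expectation (\<lambda>\<omega>. V (symbol a \<phi>) \<omega> * V (symbol a \<psi>) \<omega>)"
    using o by (simp add: integrable_prod2)
  finally show ?thesis
    using \<zeta>_\<zeta>[OF \<phi> \<psi>] V_\<zeta>[OF \<psi>(1) symbol_L2[OF \<phi>(1)]] V_\<zeta>[OF \<phi>(1) symbol_L2[OF \<psi>(1)]]
      VV[OF symbol_L2[OF \<phi>(1)] symbol_L2[OF \<psi>(1)]] by simp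
qed

text \<open>Of the four products, \<open>X\<close> with \<open>\<zeta>\<close> vanishes by
  adaptedness at time t0, the two mixed ones by independence of \<open>V\<close>, and
  \<open>V\<close> with \<open>V\<close> because the supports are separated by t0.\<close>

lemma lap_obs_noise:
  assumes \<phi>: "test_function T D \<phi>" "supp \<phi> \<subseteq> {t0<..} \<times> UNIV" and \<psi>: "test_function T D \<psi>" "supp \<psi> \<subseteq> {..t0} \<times> UNIV"
    and t0: "0 \<le> t0" "t0 \<le> T"
  shows "expectation (\<lambda>\<omega>. lap_obs \<epsilon> \<psi> \<omega> * noise a \<epsilon> \<phi> \<omega>) = 0"
proof -
  have pos: "supp \<phi> \<subseteq> {0<..} \<times> UNIV" using \<phi>(2) t0 by fastforce
  note o = \<zeta>_obs[OF \<phi>(1)] V_obs[OF symbol_L2[OF \<phi>(1)]] X_obs[OF test_Cc_st(3)[OF \<psi>(1)]] V_obs[OF test_L2(3)[OF \<psi>(1)]]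
  have off: "Lap \<psi> z = 0" if "z \<notin> supp \<psi>" for z
    using test_function_derivatives(2)[OF \<psi>(1) open_D \<theta>_C1 that] .
  have "expectation (\<lambda>\<omega>. lap_obs \<epsilon> \<psi> \<omega> * noise a \<epsilon> \<phi> \<omega>) = expectation (\<lambda>\<omega>. X (Lap \<psi>) \<omega> * \<zeta> \<phi> \<omega> + (-\<epsilon>) * (X (Lap \<psi>) \<omega> * V (symbol a \<phi>) \<omega>)
      + \<epsilon> * (V (Lap \<psi>) \<omega> * \<zeta> \<phi> \<omega>) + (- (\<epsilon>^2)) * (V (Lap \<psi>) \<omega> * V (symbol a \<phi>) \<omega>))"
    by (rule Bochner_Integration.integral_cong) (auto simp: noise_def lap_obs_def algebra_simps power2_eq_square)
  also have "\<dots> = expectation (\<lambda>\<omega>. X (Lap \<psi>) \<omega> * \<zeta> \<phi> \<omega>) + (-\<epsilon>) * expectation (\<lambda>\<omega>. X (Lap \<psi>) \<omega> * V (symbol a \<phi>) \<omega>)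
      + \<epsilon> * expectation (\<lambda>\<omega>. V (Lap \<psi>) \<omega> * \<zeta> \<phi> \<omega>) + (- (\<epsilon>^2)) * expectation (\<lambda>\<omega>. V (Lap \<psi>) \<omega> * V (symbol a \<phi>) \<omega>)"
    using o by (simp add: integrable_prod2)
  also have "expectation (\<lambda>\<omega>. X (Lap \<psi>) \<omega> * \<zeta> \<phi> \<omega>) = 0"
  proof (rule X_\<zeta>[OF \<phi>(1) pos test_Cc_fun(3)[OF \<psi>(1)] t0 _ \<phi>(2)])
    show "Lap \<psi> (t, x) = 0" if "t > t0" for t x by (rule off) (use \<psi>(2) that in auto)
  qed
  also have "expectation (\<lambda>\<omega>. X (Lap \<psi>) \<omega> * V (symbol a \<phi>) \<omega>) = 0"
    by (rule XV[OF test_Cc_st(3)[OF \<psi>(1)] symbol_L2[OF \<phi>(1)]])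
  also have "expectation (\<lambda>\<omega>. V (Lap \<psi>) \<omega> * \<zeta> \<phi> \<omega>) = 0" by (rule V_\<zeta>[OF \<phi>(1) test_L2(3)[OF \<psi>(1)]])
  also have "expectation (\<lambda>\<omega>. V (Lap \<psi>) \<omega> * V (symbol a \<phi>) \<omega>) = ip Q (Lap \<psi>) (symbol a \<phi>)"
    by (rule VV[OF test_L2(3)[OF \<psi>(1)] symbol_L2[OF \<phi>(1)]])
  also have "ip Q (Lap \<psi>) (symbol a \<phi>) = 0"
  proof (rule ip_disjoint)
    fix z
    have "z \<notin> supp \<psi> \<or> z \<notin> supp \<phi>" using subsetD[OF \<phi>(2), of z] subsetD[OF \<psi>(2), of z] by (cases z) auto
    thus "Lap \<psi> z = 0 \<or> symbol a \<phi> z = 0" using off symbol_off[OF \<phi>(1)] by blast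
  qed
  finally show ?thesis by simp
qed

end

definition zoom :: "real \<Rightarrow> 'a::euclidean_space \<Rightarrow> nat \<Rightarrow> 'a \<Rightarrow> real \<times> 'a \<Rightarrow> real \<times> 'a" where
  "zoom \<epsilon> x\<^sub>0 k x = (\<lambda>z. (fst z / \<epsilon> - real k, (\<epsilon> powr (- 1 / 2)) *\<^sub>R (snd z - x\<^sub>0) - x))"

lemma rescaled_shifted:
  fixes K :: "real \<times> 'a::euclidean_space \<Rightarrow> real"
  shows "rescaled (shifted K k x) \<epsilon> x\<^sub>0 = (\<lambda>z. \<epsilon> powr (- 1 / 2 - real DIM('a) / 4) * K (zoom \<epsilon> x\<^sub>0 k x z))"
  by (auto simp: rescaled_def shifted_def zoom_def)

lemma zoom_has_derivative:
  "(zoom \<epsilon> x\<^sub>0 k x has_derivative (\<lambda>v. (fst v / \<epsilon>, (\<epsilon> powr (- 1 / 2)) *\<^sub>R snd v))) (at z)"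
  unfolding zoom_def divide_inverse by (auto intro!: derivative_eq_intros)

lemma continuous_zoom: "continuous_on UNIV (zoom \<epsilon> x\<^sub>0 k x)"
  unfolding zoom_def divide_inverse by (intro continuous_intros)

lemma Basis_prod_cases:
  assumes "b \<in> (Basis :: (real \<times> 'a::euclidean_space) set)"
  obtains "b = (1, 0)" | c where "c \<in> Basis" "b = (0, c)"
  using assms unfolding Basis_prod_def by auto

context
  fixes K :: "real \<times> 'a::euclidean_space \<Rightarrow> real" and \<epsilon> :: real
  assumes K: "smooth K" and \<epsilon>: "\<epsilon> > 0"
begin

lemma smooth_rescaled: "smooth (rescaled (shifted K k x) \<epsilon> x\<^sub>0)"
  unfolding smooth_def rescaled_shifted
  by (intro allI Ck_affine[where A'="\<lambda>v. (fst v / \<epsilon>, (\<epsilon> powr (- 1 / 2)) *\<^sub>R snd v)" and e="\<lambda>b. b" and m="\<lambda>b. if fst b = 0 then \<epsilon> powr (- 1 / 2) else 1 / \<epsilon>"] zoom_has_derivative)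
     (use K in \<open>auto simp: smooth_def elim!: Basis_prod_cases\<close>)

lemma pd_rescaled:
  assumes f: "smooth f"
  shows "pd (1, 0) (\<lambda>z. c * f (zoom \<epsilon> x\<^sub>0 k x z)) z = (c / \<epsilon>) * pd (1, 0) f (zoom \<epsilon> x\<^sub>0 k x z)"
    and "pd (0, b) (\<lambda>z. c * f (zoom \<epsilon> x\<^sub>0 k x z)) z = (c * \<epsilon> powr (- 1 / 2)) * pd (0, b) f (zoom \<epsilon> x\<^sub>0 k x z)"
  using pd_affine[OF zoom_has_derivative, where m="1/\<epsilon>" and e="(1,0)" and b="(1,0)" and f=f]
    pd_affine[OF zoom_has_derivative, where m="\<epsilon> powr (- 1 / 2)" and e="(0,b)" and b="(0,b)" and f=f] smooth_differentiable[OF f]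
  by auto

text \<open>Parabolic scaling: one time derivative contributes 1 / \<epsilon>, two space derivatives
  contribute the square of \<epsilon>^(-1/2), so both terms pick up the same factor.\<close>

lemma symbol_rescaled:
  "dt (rescaled (shifted K k x) \<epsilon> x\<^sub>0) z + a * Lap (rescaled (shifted K k x) \<epsilon> x\<^sub>0) z
    = (\<epsilon> powr (- 1 / 2 - real DIM('a) / 4) / \<epsilon>) * (dt K (zoom \<epsilon> x\<^sub>0 k x z) + a * Lap K (zoom \<epsilon> x\<^sub>0 k x z))"
proof -
  let ?c = "\<epsilon> powr (- 1 / 2 - real DIM('a) / 4)" and ?d = "\<epsilon> powr (- 1 / 2)" and ?f = "rescaled (shifted K k x) \<epsilon> x\<^sub>0"
  have dd: "?d * ?d = 1 / \<epsilon>" using \<epsilon> by (simp add: powr_minus_divide flip: powr_add)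
  have "dt ?f z = ?c / \<epsilon> * dt K (zoom \<epsilon> x\<^sub>0 k x z)"
    unfolding dt_eq[OF smooth_rescaled] dt_eq[OF K] unfolding rescaled_shifted by (rule pd_rescaled(1)[OF K])
  moreover have "Lap ?f z = ?c / \<epsilon> * Lap K (zoom \<epsilon> x\<^sub>0 k x z)"
  proof -
    have "pd (0, b) (pd (0, b) ?f) z = ?c / \<epsilon> * pd (0, b) (pd (0, b) K) (zoom \<epsilon> x\<^sub>0 k x z)" if b: "b \<in> Basis" for b :: 'a
    proof -
      have "pd (0, b) ?f = (\<lambda>z. (?c * ?d) * pd (0, b) K (zoom \<epsilon> x\<^sub>0 k x z))"
        unfolding rescaled_shifted using pd_rescaled(2)[OF K] by blast
      hence "pd (0, b) (pd (0, b) ?f) z = (?c * ?d * ?d) * pd (0, b) (pd (0, b) K) (zoom \<epsilon> x\<^sub>0 k x z)"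
        using pd_rescaled(2)[OF smooth_pd[OF K basis_prod(1)[OF b]]] by metis
      moreover have "?c * ?d * ?d = ?c / \<epsilon>" using dd by (simp add: mult.assoc)
      ultimately show ?thesis by simp
    qed
    thus ?thesis unfolding Lap_eq[OF smooth_rescaled] Lap_eq[OF K] by (simp add: sum_distrib_left)
  qed
  ultimately show ?thesis by (simp only: distrib_left mult.left_commute)
qed

text \<open>The linear part of \<open>zoom\<close> is diagonal with entry 1 / \<epsilon> in time and
  \<epsilon>^(-1/2) in the d space directions. Its determinant \<epsilon>^(-1 - d/2) is the square
  of the prefactor.\<close>

lemma zoom_isometry:
  fixes F :: "real \<times> 'a \<Rightarrow> real"
  assumes F: "continuous_on UNIV F"
  shows "(\<integral>z. (\<epsilon> powr (- 1 / 2 - real DIM('a) / 4) * F (zoom \<epsilon> x\<^sub>0 k x z))\<^sup>2 \<partial>lborel) = (\<integral>z. (F z)\<^sup>2 \<partial>lborel)"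
proof -
  let ?c = "\<epsilon> powr (- 1 / 2 - real DIM('a) / 4)" and ?d = "\<epsilon> powr (- 1 / 2)"
  note [measurable] = borel_measurable_continuous_onI[OF F] borel_measurable_continuous_onI[OF continuous_zoom[of \<epsilon> x\<^sub>0 k x]]
  define c where "c = (\<lambda>b :: real \<times> 'a. if fst b = 0 then ?d else 1 / \<epsilon>)"
  define t where "t = zoom \<epsilon> x\<^sub>0 k x 0"
  have T: "zoom \<epsilon> x\<^sub>0 k x = (\<lambda>z. t + (\<Sum>j\<in>Basis. (c j * (z \<bullet> j)) *\<^sub>R j))"
  proof (rule ext, rule euclidean_eqI)
    fix z b :: "real \<times> 'a" assume b: "b \<in> Basis"
    show "zoom \<epsilon> x\<^sub>0 k x z \<bullet> b = (t + (\<Sum>j\<in>Basis. (c j * (z \<bullet> j)) *\<^sub>R j)) \<bullet> b"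
      using b by (cases z, cases b rule: Basis_prod_cases)
        (auto simp: inner_add_left inner_sum_left_Basis c_def t_def zoom_def inner_diff_left algebra_simps)
  qed
  have "(\<Prod>b\<in>(Basis :: (real \<times> 'a) set). \<bar>c b\<bar>) = 1 / \<epsilon> * ?d ^ DIM('a)"
    unfolding Basis_prod_def
    by (subst prod.union_disjoint) (use \<epsilon> in \<open>auto simp: prod.reindex inj_on_def c_def\<close>)
  also have "\<dots> = \<epsilon> powr (-1) * \<epsilon> powr (- real DIM('a) / 2)"
  proof -
    have "1 / \<epsilon> = \<epsilon> powr (-1)" using \<epsilon> by (simp add: powr_minus_divide)
    moreover have "?d ^ DIM('a) = ?d powr real DIM('a)" using \<epsilon> by (intro powr_realpow[symmetric]) simp
    moreover have "?d powr real DIM('a) = \<epsilon> powr (- real DIM('a) / 2)" by (simp only: powr_powr) simp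
    ultimately show ?thesis by (simp only:)
  qed
  also have "\<dots> = ?c\<^sup>2"
    by (simp only: power2_eq_square flip: powr_add) simp
  finally have p: "(\<Prod>b\<in>(Basis :: (real \<times> 'a) set). \<bar>c b\<bar>) = ?c\<^sup>2" .
  have "(\<integral>z. (F z)\<^sup>2 \<partial>lborel) = (\<integral>z. (F z)\<^sup>2 \<partial>density (distr lborel borel (zoom \<epsilon> x\<^sub>0 k x)) (\<lambda>_. \<Prod>b\<in>(Basis :: (real \<times> 'a) set). \<bar>c b\<bar>))"
    unfolding T by (subst lborel_affine_euclidean[of c t]) (use \<epsilon> in \<open>auto simp: c_def\<close>)
  also have "\<dots> = (\<integral>z. ?c\<^sup>2 * (F (zoom \<epsilon> x\<^sub>0 k x z))\<^sup>2 \<partial>lborel)"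
    unfolding p by (subst integral_density, measurable) (auto simp: integral_distr)
  finally show ?thesis by (simp add: power_mult_distrib)
qed

lemma supp_rescaled: "supp (rescaled (shifted K k x) \<epsilon> x\<^sub>0) \<subseteq> zoom \<epsilon> x\<^sub>0 k x -` supp K"
proof (rule supp_minimal)
  show "closed (zoom \<epsilon> x\<^sub>0 k x -` supp K)" by (intro closed_vimage closed_supp continuous_zoom)
  fix z assume "z \<notin> zoom \<epsilon> x\<^sub>0 k x -` supp K"
  thus "rescaled (shifted K k x) \<epsilon> x\<^sub>0 z = 0" using supp_zero[of "zoom \<epsilon> x\<^sub>0 k x z" K] by (simp add: rescaled_shifted)
qed

text \<open>The grid hypotheses are stated for k = 0 only; this shift by k \<epsilon> in time
  carries them to all k.\<close>

lemma supp_rescaled_translate: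
  "supp (rescaled (shifted K k x) \<epsilon> x\<^sub>0) \<subseteq> {z. z - (real k * \<epsilon>, 0) \<in> supp (rescaled (shifted K 0 x) \<epsilon> x\<^sub>0)}" (is "_ \<subseteq> ?C")
proof (rule supp_minimal)
  have "closed ((\<lambda>z. z - (real k * \<epsilon>, 0)) -` supp (rescaled (shifted K 0 x) \<epsilon> x\<^sub>0))"
    by (intro closed_vimage closed_supp continuous_intros)
  thus "closed ?C" by (simp add: vimage_def)
  fix z assume "z \<notin> ?C"
  hence "rescaled (shifted K 0 x) \<epsilon> x\<^sub>0 (z - (real k * \<epsilon>, 0)) = 0" using supp_zero by blast
  moreover have "zoom \<epsilon> x\<^sub>0 0 x (z - (real k * \<epsilon>, 0)) = zoom \<epsilon> x\<^sub>0 k x z"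
    using \<epsilon> by (simp add: zoom_def diff_divide_distrib)
  ultimately show "rescaled (shifted K k x) \<epsilon> x\<^sub>0 z = 0" by (simp add: rescaled_shifted)
qed

lemma supp_rescaled_time:
  assumes "supp K \<subseteq> {0<..<1} \<times> box (- One) One"
  shows "supp (rescaled (shifted K k x) \<epsilon> x\<^sub>0) \<subseteq> {real k * \<epsilon><..<(real k + 1) * \<epsilon>} \<times> UNIV"
proof
  fix z assume "z \<in> supp (rescaled (shifted K k x) \<epsilon> x\<^sub>0)"
  hence "zoom \<epsilon> x\<^sub>0 k x z \<in> {0<..<1} \<times> box (- One) One" using supp_rescaled assms by blast
  thus "z \<in> {real k * \<epsilon><..<(real k + 1) * \<epsilon>} \<times> UNIV" using \<epsilon> by (cases z) (auto simp: zoom_def field_simps)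
qed

lemma compact_supp_rescaled:
  assumes "supp K \<subseteq> {0<..<1} \<times> box (- One) One"
  shows "compact (supp (rescaled (shifted K k x) \<epsilon> x\<^sub>0))"
proof -
  have "bounded (supp K)" by (rule bounded_subset[OF _ assms]) (intro bounded_Times bounded_box, auto)
  hence cK: "compact (supp K)" using closed_supp compact_eq_bounded_closed by blast
  define inv where "inv = (\<lambda>z :: real \<times> 'a. ((fst z + real k) * \<epsilon>, (1 / \<epsilon> powr (- 1 / 2)) *\<^sub>R (snd z + x) + x\<^sub>0))"
  have "compact (inv ` supp K)"
    unfolding inv_def by (intro compact_continuous_image cK continuous_intros)
  moreover have "inv (zoom \<epsilon> x\<^sub>0 k x z) = z" for z using \<epsilon> by (simp add: inv_def zoom_def)
  hence "zoom \<epsilon> x\<^sub>0 k x -` supp K \<subseteq> inv ` supp K" by (metis image_eqI subsetI vimage_eq)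
  ultimately have "bounded (supp (rescaled (shifted K k x) \<epsilon> x\<^sub>0))"
    using supp_rescaled compact_imp_bounded bounded_subset by (metis (no_types, lifting))
  thus ?thesis using closed_supp compact_eq_bounded_closed by blast
qed

end

lemma (in gaussian_space) square_integrable_sum_prod:
  assumes "\<And>i. i \<in> J \<Longrightarrow> A i \<in> G" "\<And>i. i \<in> J \<Longrightarrow> B i \<in> G"
  shows "(\<lambda>\<omega>. \<Sum>i\<in>J. c i * A i \<omega> * B i \<omega>) \<in> borel_measurable M"
    and "integrable M (\<lambda>\<omega>. (\<Sum>i\<in>J. c i * A i \<omega> * B i \<omega>)^2)"
proof -
  have e: "(\<Sum>i\<in>J. c i * A i \<omega> * B i \<omega>)^2 = (\<Sum>i\<in>J. \<Sum>j\<in>J. c i * c j * (A i \<omega> * B i \<omega> * (A j \<omega> * B j \<omega>)))" for \<omega>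
    by (simp add: power2_eq_square sum_product mult_ac)
  show "integrable M (\<lambda>\<omega>. (\<Sum>i\<in>J. c i * A i \<omega> * B i \<omega>)^2)"
    unfolding e using assms by (intro Bochner_Integration.integrable_sum integrable_mult_right integrable_prod4)
  show "(\<lambda>\<omega>. \<Sum>i\<in>J. c i * A i \<omega> * B i \<omega>) \<in> borel_measurable M"
    using assms measurable_G by (intro borel_measurable_sum borel_measurable_times) auto
qed

text \<open>The situation at one fixed noise level. The bound on \<open>N\<close> ensures that the
  last time block, from N \<epsilon> to (N + 1) \<epsilon>, still ends by \<open>T\<close>.\<close>

locale kernel_grid = heat_model M D S T \<theta> \<sigma> \<xi> X W V
  for M :: "'w measure" and D :: "'a::euclidean_space set" and S T \<theta> \<sigma> \<xi> X W V +
  fixes K :: "real \<times> 'a \<Rightarrow> real" and \<epsilon> a :: real and x\<^sub>0 :: 'a and N :: nat and Xs :: "'a set"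
  assumes K: "smooth K" and supp_K: "supp K \<subseteq> {0<..<1} \<times> box (- One) One"
    and \<epsilon>: "\<epsilon> > 0" and N: "(real N + 1) * \<epsilon> \<le> T" and fin: "finite Xs"
    and supp_Xs: "\<And>x. x \<in> Xs \<Longrightarrow> supp (rescaled (shifted K 0 x) \<epsilon> x\<^sub>0) \<subseteq> {0..<T} \<times> D"
    and disj: "pairwise (\<lambda>x y. disjnt (supp (rescaled (shifted K 0 x) \<epsilon> x\<^sub>0)) (supp (rescaled (shifted K 0 y) \<epsilon> x\<^sub>0))) Xs"
begin

abbreviation kf :: "nat \<Rightarrow> 'a \<Rightarrow> real \<times> 'a \<Rightarrow> real" where
  "kf k x \<equiv> rescaled (shifted K k x) \<epsilon> x\<^sub>0"

lemma kf_time: "supp (kf k x) \<subseteq> {real k * \<epsilon><..<(real k + 1) * \<epsilon>} \<times> UNIV"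
  by (rule supp_rescaled_time[OF K \<epsilon> supp_K])

lemma kf_pos: "supp (kf k x) \<subseteq> {0<..} \<times> UNIV"
proof -
  have "0 \<le> real k * \<epsilon>" using \<epsilon> by simp
  thus ?thesis using kf_time[of k x] by fastforce
qed

lemma kf_test: 
  assumes "k \<le> N" "x \<in> Xs"
  shows "test_function T D (kf k x)"
  unfolding test_function_def
proof (intro conjI smooth_rescaled compact_supp_rescaled K \<epsilon> supp_K)
  show "supp (kf k x) \<subseteq> {0..<T} \<times> D"
  proof
    fix z assume z: "z \<in> supp (kf k x)"
    hence "z - (real k * \<epsilon>, 0) \<in> supp (kf 0 x)"
      using supp_rescaled_translate[OF K \<epsilon>] by blast
    hence "z - (real k * \<epsilon>, 0) \<in> {0..<T} \<times> D" using supp_Xs[OF assms(2)] by blast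
    moreover have "z \<in> {real k * \<epsilon><..<(real k + 1) * \<epsilon>} \<times> UNIV" using z kf_time by blast
    moreover have "(real k + 1) * \<epsilon> \<le> (real N + 1) * \<epsilon>" using assms(1) \<epsilon> by (intro mult_right_mono) auto
    moreover have "0 \<le> real k * \<epsilon>" using \<epsilon> by simp
    ultimately show "z \<in> {0..<T} \<times> D" using N by (cases z) auto
  qed
qed

text \<open>Kernels with different k live in different open time blocks; for equal k a time shift
  reduces to the assumed disjointness at k = 0.\<close>

lemma kf_disjoint:
  assumes "x \<in> Xs" "y \<in> Xs" "(k, x) \<noteq> (l, y)"
  shows "z \<notin> supp (kf k x) \<or> z \<notin> supp (kf l y)"
proof (rule ccontr)
  assume "\<not> ?thesis"
  hence z: "z \<in> supp (kf k x)" "z \<in> supp (kf l y)" by auto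
  hence t: "real k * \<epsilon> < fst z" "fst z < (real k + 1) * \<epsilon>" "real l * \<epsilon> < fst z" "fst z < (real l + 1) * \<epsilon>"
    using kf_time by fastforce+
  have "real k * \<epsilon> < (real l + 1) * \<epsilon>" "real l * \<epsilon> < (real k + 1) * \<epsilon>" using t by linarith+
  hence "real k < real l + 1" "real l < real k + 1" using \<epsilon> by simp_all
  hence kl: "k = l" by linarith
  hence "x \<noteq> y" using assms by simp
  hence "disjnt (supp (kf 0 x)) (supp (kf 0 y))" using disj assms by (auto simp: pairwise_def)
  moreover have "z - (real k * \<epsilon>, 0) \<in> supp (kf 0 x)" "z - (real k * \<epsilon>, 0) \<in> supp (kf 0 y)"
    using z supp_rescaled_translate[OF K \<epsilon>] kl by blast+
  ultimately show False by (auto simp: disjnt_def)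
qed

lemma Q_measurable: "Q \<in> sets lebesgue"
proof -
  have "Q \<in> sets borel" using open_D by (intro borel_Times) auto
  thus ?thesis by simp
qed

lemma zoomed_norm:
  assumes F: "continuous_on UNIV F" and f: "\<And>z. f z = \<epsilon> powr (- 1 / 2 - real DIM('a) / 4) * F (zoom \<epsilon> x\<^sub>0 k x z)"
    and c: "continuous_on UNIV f" and z: "\<And>z. z \<notin> Q \<Longrightarrow> f z = 0"
  shows "ip Q f f = (nrm UNIV F)\<^sup>2"
proof -
  have "ip Q f f = (\<integral>z. f z * f z \<partial>lborel)"
    using c z by (intro ip_lborel Q_measurable borel_measurable_continuous_onI) auto
  also have "\<dots> = (\<integral>z. (F z)\<^sup>2 \<partial>lborel)"
    using zoom_isometry[OF K \<epsilon> F, of x\<^sub>0 k x] by (simp add: f power2_eq_square)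
  also have "\<dots> = ip UNIV F F"
    using F by (subst ip_lborel) (auto intro!: borel_measurable_continuous_onI simp: power2_eq_square)
  finally show ?thesis by (simp add: nrm_square)
qed

text \<open>The source of \<sigma>_K^2: rescaling preserves the L2 norm of the kernel, and the
  factor \<epsilon> of the observation noise cancels the 1 / \<epsilon> that the heat operator
  produces.\<close>

lemma noise_variance:
  assumes "k \<le> N" "x \<in> Xs"
  shows "expectation (\<lambda>\<omega>. (noise a \<epsilon> (kf k x) \<omega>)\<^sup>2) =
    \<sigma>\<^sup>2 * (nrm UNIV K)\<^sup>2 + (nrm UNIV (\<lambda>z. dt K z + a * Lap K z))\<^sup>2"
proof -
  note t = kf_test[OF assms]
  have sub: "z \<notin> Q \<Longrightarrow> z \<notin> supp (kf k x)" for z using t by (auto simp: test_function_def)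
  have cF: "continuous_on UNIV (\<lambda>z. dt K z + a * Lap K z)"
    unfolding dt_eq[OF K] Lap_eq[OF K]
    by (intro continuous_intros smooth_continuous smooth_pd K basis_prod)
  have 1: "ip Q (kf k x) (kf k x) = (nrm UNIV K)\<^sup>2"
  proof (rule zoomed_norm[OF smooth_continuous[OF K], of _ k x])
    show "kf k x z = \<epsilon> powr (- 1 / 2 - real DIM('a) / 4) * K (zoom \<epsilon> x\<^sub>0 k x z)" for z
      by (simp add: rescaled_shifted)
    show "continuous_on UNIV (kf k x)" by (intro smooth_continuous smooth_rescaled K \<epsilon>)
    show "z \<notin> Q \<Longrightarrow> kf k x z = 0" for z using sub by (intro supp_zero)
  qed
  define f where "f = (\<lambda>z. \<epsilon> * symbol a (kf k x) z)"
  have cs: "continuous_on UNIV (symbol a (kf k x))" using symbol_Cc_fun[OF t] by (simp add: Cc_fun_def)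
  have 2: "ip Q f f = (nrm UNIV (\<lambda>z. dt K z + a * Lap K z))\<^sup>2"
  proof (rule zoomed_norm[OF cF, of _ k x])
    show "f z = \<epsilon> powr (- 1 / 2 - real DIM('a) / 4) * (dt K (zoom \<epsilon> x\<^sub>0 k x z) + a * Lap K (zoom \<epsilon> x\<^sub>0 k x z))" for z
      unfolding f_def symbol_def symbol_rescaled[OF K \<epsilon>] using \<epsilon> by simp
    show "continuous_on UNIV f" unfolding f_def by (intro continuous_intros cs)
    show "z \<notin> Q \<Longrightarrow> f z = 0" for z using sub symbol_off[OF t] by (simp add: f_def)
  qed
  have "ip Q f f = \<epsilon>\<^sup>2 * ip Q (symbol a (kf k x)) (symbol a (kf k x))"
    unfolding f_def ip_def by (subst integral_mult_right_zero[symmetric]) (simp add: power2_eq_square mult_ac)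
  thus ?thesis using noise_noise[OF t kf_pos t kf_pos, of a \<epsilon>] 1 2 by (simp add: power2_eq_square)
qed

text \<open>The lag in the first factor is essential: the observation with index k - 1 uses the time
  block just before that of the noise with index k, so even the two factors of one summand are
  uncorrelated.\<close>

lemma estimator_martingale:
  defines "J \<equiv> {1..N} \<times> Xs"
  shows "integrable M (\<lambda>\<omega>. (\<Sum>(k, x)\<in>J. c x * lap_obs \<epsilon> (kf (k - 1) x) \<omega> * noise a \<epsilon> (kf k x) \<omega>)\<^sup>2)"
    and "expectation (\<lambda>\<omega>. (\<Sum>(k, x)\<in>J. c x * lap_obs \<epsilon> (kf (k - 1) x) \<omega> * noise a \<epsilon> (kf k x) \<omega>)\<^sup>2)
      = (\<sigma>\<^sup>2 * (nrm UNIV K)\<^sup>2 + (nrm UNIV (\<lambda>z. dt K z + a * Lap K z))\<^sup>2) *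
        (\<Sum>(k, x)\<in>J. (c x)\<^sup>2 * expectation (\<lambda>\<omega>. (lap_obs \<epsilon> (kf (k - 1) x) \<omega>)\<^sup>2))"
proof -
  let ?A = "\<lambda>i. lap_obs \<epsilon> (kf (fst i - 1) (snd i))" and ?\<xi> = "\<lambda>i. noise a \<epsilon> (kf (fst i) (snd i))"
  let ?s = "\<sigma>\<^sup>2 * (nrm UNIV K)\<^sup>2 + (nrm UNIV (\<lambda>z. dt K z + a * Lap K z))\<^sup>2"
  have J: "1 \<le> fst i" "fst i \<le> N" "fst i - 1 \<le> N" "snd i \<in> Xs" if "i \<in> J" for i using that by (auto simp: J_def)
  have finJ: "finite J" using fin by (simp add: J_def)
  have A: "?A i \<in> observations" if "i \<in> J" for i
    by (rule lap_obs_obs[OF kf_test[OF J(3,4)[OF that]]])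
  have X: "?\<xi> i \<in> observations" if "i \<in> J" for i
    by (rule noise_obs[OF kf_test[OF J(2,4)[OF that]]])
  have X0: "expectation (?\<xi> i) = 0" if "i \<in> J" for i
    by (rule noise_mean[OF kf_test[OF J(2,4)[OF that]] kf_pos])
  have X2: "expectation (\<lambda>\<omega>. (?\<xi> i \<omega>)^2) = ?s" if "i \<in> J" for i
    by (rule noise_variance[OF J(2,4)[OF that]])
  have XX: "expectation (\<lambda>\<omega>. ?\<xi> i \<omega> * ?\<xi> j \<omega>) = 0" if ij: "i \<in> J" "j \<in> J" "i \<noteq> j" for i j
  proof -
    note ti = kf_test[OF J(2,4)[OF ij(1)]] and tj = kf_test[OF J(2,4)[OF ij(2)]]
    have d: "z \<notin> supp (kf (fst i) (snd i)) \<or> z \<notin> supp (kf (fst j) (snd j))" for z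
      using J(4)[OF ij(1)] J(4)[OF ij(2)] ij(3) by (intro kf_disjoint) (auto simp: prod_eq_iff)
    have "ip Q (kf (fst i) (snd i)) (kf (fst j) (snd j)) = 0"
      by (rule ip_disjoint) (use d supp_zero in blast)
    moreover have "ip Q (symbol a (kf (fst i) (snd i))) (symbol a (kf (fst j) (snd j))) = 0"
      by (rule ip_disjoint) (use d symbol_off[OF ti] symbol_off[OF tj] in blast)
    ultimately show ?thesis using noise_noise[OF ti kf_pos tj kf_pos, of a \<epsilon>] by simp
  qed
  have AX: "expectation (\<lambda>\<omega>. ?A i \<omega> * ?\<xi> j \<omega>) = 0" if ij: "i \<in> J" "j \<in> J" "fst i \<le> fst j" for i j
  \<comment> \<open>The separating time is the start of the noise block. The lagged kernel ends by
    its own index times \<epsilon>, since (fst i - 1) + 1 = fst i; this uses 1 \<le> fst i because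
    the subtraction is on naturals.\<close>
  proof (rule lap_obs_noise[OF kf_test[OF J(2,4)[OF ij(2)]] _ kf_test[OF J(3,4)[OF ij(1)]], of "real (fst j) * \<epsilon>"])
    show "supp (kf (fst j) (snd j)) \<subseteq> {real (fst j) * \<epsilon><..} \<times> UNIV" using kf_time by fastforce
    have "(real (fst i - 1) + 1) * \<epsilon> \<le> real (fst j) * \<epsilon>"
      using J(1)[OF ij(1)] ij(3) \<epsilon> by (intro mult_right_mono) auto
    thus "supp (kf (fst i - 1) (snd i)) \<subseteq> {..real (fst j) * \<epsilon>} \<times> UNIV" using kf_time[of "fst i - 1" "snd i"] by fastforce
    show "0 \<le> real (fst j) * \<epsilon>" using \<epsilon> by simp
    have "real (fst j) * \<epsilon> \<le> (real N + 1) * \<epsilon>" using J(2)[OF ij(2)] \<epsilon> by (intro mult_right_mono) auto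
    thus "real (fst j) * \<epsilon> \<le> T" using N by simp
  qed
  note m = martingale_variance[where t=fst and c="\<lambda>i. c (snd i)", OF finJ A X X0 X2 XX AX]
  show "integrable M (\<lambda>\<omega>. (\<Sum>(k, x)\<in>J. c x * lap_obs \<epsilon> (kf (k - 1) x) \<omega> * noise a \<epsilon> (kf k x) \<omega>)\<^sup>2)"
    using m(2) by (simp add: split_beta)
  show "expectation (\<lambda>\<omega>. (\<Sum>(k, x)\<in>J. c x * lap_obs \<epsilon> (kf (k - 1) x) \<omega> * noise a \<epsilon> (kf k x) \<omega>)\<^sup>2)
      = ?s * (\<Sum>(k, x)\<in>J. (c x)\<^sup>2 * expectation (\<lambda>\<omega>. (lap_obs \<epsilon> (kf (k - 1) x) \<omega>)\<^sup>2))"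
    using m(1) by (simp add: split_beta)
qed

end

section \<open>Rates\<close>

lemma grid_size_bounds:
  assumes T: "T > 0" and \<epsilon>: "0 < \<epsilon>" "\<epsilon> < T / 4"
  defines "n \<equiv> nat (\<lfloor>T / \<epsilon>\<rfloor> - 1)"
  shows "n \<ge> 1" "(real n + 1) * \<epsilon> \<le> T" "T / 2 * (1 / \<epsilon>) \<le> real n" "real n \<le> T * (1 / \<epsilon>)"
proof -
  \<comment> \<open>Having T / \<epsilon> \<ge> 4 makes T / \<epsilon> - 2, the lower bound coming
    from the floor, at least half of T / \<epsilon>, and keeps the argument of \<open>nat\<close>
    positive.\<close>
  have 4: "T / \<epsilon> \<ge> 4" using \<epsilon> by (simp add: field_simps)
  hence f: "\<lfloor>T / \<epsilon>\<rfloor> \<ge> 4" by (simp add: le_floor_iff)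
  have n: "real n = of_int \<lfloor>T / \<epsilon>\<rfloor> - 1" using f by (simp add: n_def)
  show "n \<ge> 1" unfolding n_def using f by linarith
  have "real n + 1 \<le> T / \<epsilon>" unfolding n by linarith
  thus "(real n + 1) * \<epsilon> \<le> T" "real n \<le> T * (1 / \<epsilon>)" using \<epsilon> by (simp_all add: field_simps)
  have "real n \<ge> T / \<epsilon> - 2" unfolding n by linarith
  thus "T / 2 * (1 / \<epsilon>) \<le> real n" using 4 by simp
qed

lemma grid_size_asymptotics:
  assumes T: "T > 0"
  defines "n \<equiv> \<lambda>\<epsilon>. nat (\<lfloor>T / \<epsilon>\<rfloor> - 1)"
  shows "\<forall>\<^sub>F \<epsilon> in at_right 0. \<epsilon> > 0 \<and> n \<epsilon> \<ge> 1 \<and> (real (n \<epsilon>) + 1) * \<epsilon> \<le> T"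
    and "(\<lambda>\<epsilon>. real (n \<epsilon>)) \<in> \<Theta>[at_right 0](\<lambda>\<epsilon>. 1 / \<epsilon>)"
proof -
  have ev: "\<forall>\<^sub>F \<epsilon> in at_right 0. 0 < \<epsilon> \<and> \<epsilon> < T / 4"
    unfolding eventually_at_right_field using T by (intro exI[of _ "T / 4"]) auto
  show "\<forall>\<^sub>F \<epsilon> in at_right 0. \<epsilon> > 0 \<and> n \<epsilon> \<ge> 1 \<and> (real (n \<epsilon>) + 1) * \<epsilon> \<le> T"
    using ev by eventually_elim (use grid_size_bounds[OF T] in \<open>auto simp: n_def\<close>)
  show "(\<lambda>\<epsilon>. real (n \<epsilon>)) \<in> \<Theta>[at_right 0](\<lambda>\<epsilon>. 1 / \<epsilon>)"
  proof (rule bigthetaI)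
    show "(\<lambda>\<epsilon>. real (n \<epsilon>)) \<in> O[at_right 0](\<lambda>\<epsilon>. 1 / \<epsilon>)"
    proof (rule landau_o.bigI[of T])
      show "\<forall>\<^sub>F \<epsilon> in at_right 0. norm (real (n \<epsilon>)) \<le> T * norm (1 / \<epsilon>)"
        using ev by eventually_elim (use grid_size_bounds(4)[OF T] in \<open>auto simp: n_def\<close>)
    qed (use T in auto)
    show "(\<lambda>\<epsilon>. real (n \<epsilon>)) \<in> \<Omega>[at_right 0](\<lambda>\<epsilon>. 1 / \<epsilon>)"
    proof (rule landau_omega.bigI[of "T / 2"])
      show "\<forall>\<^sub>F \<epsilon> in at_right 0. norm (real (n \<epsilon>)) \<ge> T / 2 * norm (1 / \<epsilon>)"
        using ev by eventually_elim (use grid_size_bounds(3)[OF T] in \<open>auto simp: n_def\<close>)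
    qed (use T in auto)
  qed
qed

lemma bigtheta_powr_pos:
  fixes f g :: "real \<Rightarrow> real"
  assumes "f \<in> \<Theta>[F](g)" "\<forall>\<^sub>F x in F. f x > 0" "\<forall>\<^sub>F x in F. g x > 0"
  shows "(\<lambda>x. f x powr p) \<in> \<Theta>[F](\<lambda>x. g x powr p)"
proof -
  have "(\<lambda>x. f x powr p) \<in> \<Theta>[F](\<lambda>x. \<bar>f x\<bar> powr p)"
    using assms(2) by (intro bigthetaI_cong) (auto elim!: eventually_mono)
  also have "(\<lambda>x. \<bar>f x\<bar> powr p) \<in> \<Theta>[F](\<lambda>x. \<bar>g x\<bar> powr p)" by (rule bigtheta_powr[OF assms(1)])
  also have "(\<lambda>x. \<bar>g x\<bar> powr p) \<in> \<Theta>[F](\<lambda>x. g x powr p)"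
    using assms(3) by (intro bigthetaI_cong) (auto elim!: eventually_mono)
  finally show ?thesis .
qed

text \<open>The number of time points contributes \<epsilon>^(1/2) and the number of spatial points
  \<epsilon>^(m/4). The bandwidth is kept as it is, since its rate enters only when the two errors
  are balanced.\<close>

lemma stochastic_error_rate:
  fixes n c h :: "real \<Rightarrow> real" and m :: nat
  assumes n: "n \<in> \<Theta>[at_right 0](\<lambda>\<epsilon>. 1 / \<epsilon>)" "\<forall>\<^sub>F \<epsilon> in at_right 0. n \<epsilon> > 0"
    and c: "c \<in> \<Theta>[at_right 0](\<lambda>\<epsilon>. \<epsilon> powr (- real m / 2))" "\<forall>\<^sub>F \<epsilon> in at_right 0. c \<epsilon> > 0"
    and h: "\<forall>\<^sub>F \<epsilon> in at_right 0. h \<epsilon> > 0"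
  shows "(\<lambda>\<epsilon>. 1 / sqrt (n \<epsilon> * c \<epsilon> * h \<epsilon> ^ m)) \<in> \<Theta>[at_right 0](\<lambda>\<epsilon>. \<epsilon> powr (1 / 2 + real m / 4) * h \<epsilon> powr (- real m / 2))"
proof -
  have pos: "\<forall>\<^sub>F \<epsilon> in at_right 0. \<epsilon> > (0 :: real)" by (simp add: eventually_at_right_less)
  have "(\<lambda>\<epsilon>. 1 / sqrt (n \<epsilon> * c \<epsilon> * h \<epsilon> ^ m)) \<in> \<Theta>[at_right 0](\<lambda>\<epsilon>. n \<epsilon> powr (-1/2) * c \<epsilon> powr (-1/2) * h \<epsilon> powr (- real m / 2))"
  proof (rule bigthetaI_cong)
    show "\<forall>\<^sub>F \<epsilon> in at_right 0. 1 / sqrt (n \<epsilon> * c \<epsilon> * h \<epsilon> ^ m) = n \<epsilon> powr (-1/2) * c \<epsilon> powr (-1/2) * h \<epsilon> powr (- real m / 2)"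
      using n(2) c(2) h
    proof eventually_elim
      case (elim \<epsilon>)
      have "h \<epsilon> powr (real m) = h \<epsilon> ^ m" using elim by (simp add: powr_realpow)
      hence "sqrt (n \<epsilon> * c \<epsilon> * h \<epsilon> ^ m) = n \<epsilon> powr (1/2) * c \<epsilon> powr (1/2) * h \<epsilon> powr (real m / 2)"
        using elim by (simp add: powr_half_sqrt[symmetric] powr_mult powr_powr flip: \<open>h \<epsilon> powr (real m) = h \<epsilon> ^ m\<close>)
      thus ?case using elim by (simp add: powr_minus_divide)
    qed
  qed
  also have "(\<lambda>\<epsilon>. n \<epsilon> powr (-1/2) * c \<epsilon> powr (-1/2) * h \<epsilon> powr (- real m / 2)) \<in>
      \<Theta>[at_right 0](\<lambda>\<epsilon>. (1 / \<epsilon>) powr (-1/2) * (\<epsilon> powr (- real m / 2)) powr (-1/2) * h \<epsilon> powr (- real m / 2))"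
    by (intro landau_theta.mult bigtheta_powr_pos n c bigtheta_refl) (use pos in \<open>eventually_elim; simp\<close>)+
  also have "(\<lambda>\<epsilon>. (1 / \<epsilon>) powr (-1/2) * (\<epsilon> powr (- real m / 2)) powr (-1/2) * h \<epsilon> powr (- real m / 2)) \<in>
      \<Theta>[at_right 0](\<lambda>\<epsilon>. \<epsilon> powr (1 / 2 + real m / 4) * h \<epsilon> powr (- real m / 2))"
  proof (rule bigthetaI_cong)
    show "\<forall>\<^sub>F \<epsilon> in at_right 0. (1 / \<epsilon>) powr (-1/2) * (\<epsilon> powr (- real m / 2)) powr (-1/2) * h \<epsilon> powr (- real m / 2)
       = \<epsilon> powr (1 / 2 + real m / 4) * h \<epsilon> powr (- real m / 2)"
      using pos
    proof eventually_elim
      case (elim \<epsilon>)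
      have "(1 / \<epsilon>) powr (-1/2) = \<epsilon> powr (1/2)" using elim by (simp add: powr_minus_divide powr_divide)
      moreover have "(\<epsilon> powr (- real m / 2)) powr (-1/2) = \<epsilon> powr (real m / 4)" by (simp only: powr_powr) simp
      ultimately show ?case by (simp only: powr_add)
    qed
  qed
  finally show ?thesis .
qed

text \<open>At \<open>h = \<epsilon>\<^sup>\<alpha>\<close> with \<open>\<alpha> = (2 + d) / (4 \<gamma> + 2 d)\<close> both error terms equal \<open>\<epsilon>\<^sup>\<alpha>\<^sup>\<gamma>\<close>; any other bandwidth
  makes one of them larger, because the first decreases and the second increases in the bandwidth.\<close>

lemma optimal_bandwidth:
  fixes \<gamma> d :: real and h :: "real \<Rightarrow> real"
  assumes \<gamma>: "\<gamma> \<ge> 1" and d: "d > 0" and h: "h \<in> \<Theta>[at_right 0](\<lambda>\<epsilon>. \<epsilon> powr ((2 + d) / (4 * \<gamma> + 2 * d)))"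
    and hpos: "\<forall>\<^sub>F \<epsilon> in at_right 0. h \<epsilon> > 0"
  shows "(\<lambda>\<epsilon>. \<epsilon> powr (1 / 2 + d / 4) * h \<epsilon> powr (- d / 2)) \<in> O[at_right 0](\<lambda>\<epsilon>. \<epsilon> powr ((2 + d) * \<gamma> / (4 * \<gamma> + 2 * d)))"
    and "(\<lambda>\<epsilon>. h \<epsilon> powr \<gamma>) \<in> O[at_right 0](\<lambda>\<epsilon>. \<epsilon> powr ((2 + d) * \<gamma> / (4 * \<gamma> + 2 * d)))"
    and "\<forall>\<^sub>F \<epsilon> in at_right 0. g \<epsilon> > 0 \<Longrightarrow>
      (\<lambda>\<epsilon>. \<epsilon> powr ((2 + d) * \<gamma> / (4 * \<gamma> + 2 * d))) \<in> O[at_right 0](\<lambda>\<epsilon>. \<epsilon> powr (1 / 2 + d / 4) * g \<epsilon> powr (- d / 2) + g \<epsilon> powr \<gamma>)"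
proof -
  define \<alpha> where "\<alpha> = (2 + d) / (4 * \<gamma> + 2 * d)"
  have pos: "\<forall>\<^sub>F \<epsilon> in at_right 0. \<epsilon> > (0 :: real)" by (simp add: eventually_at_right_less)
  have den: "4 * \<gamma> + 2 * d > 0" using \<gamma> d by simp
  have r: "(2 + d) * \<gamma> / (4 * \<gamma> + 2 * d) = \<alpha> * \<gamma>" by (simp add: \<alpha>_def)
  have balance: "1 / 2 + d / 4 + \<alpha> * (- d / 2) = \<alpha> * \<gamma>"
    using den by (simp add: \<alpha>_def field_simps)
  have hp: "(\<lambda>\<epsilon>. h \<epsilon> powr p) \<in> \<Theta>[at_right 0](\<lambda>\<epsilon>. \<epsilon> powr (\<alpha> * p))" for p
    using bigtheta_powr_pos[OF h hpos, of p] pos by (simp add: powr_powr \<alpha>_def eventually_mono)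
  show "(\<lambda>\<epsilon>. h \<epsilon> powr \<gamma>) \<in> O[at_right 0](\<lambda>\<epsilon>. \<epsilon> powr ((2 + d) * \<gamma> / (4 * \<gamma> + 2 * d)))"
    unfolding r using hp by (rule bigthetaD1)
  have "(\<lambda>\<epsilon>. \<epsilon> powr (1 / 2 + d / 4) * h \<epsilon> powr (- d / 2)) \<in> O[at_right 0](\<lambda>\<epsilon>. \<epsilon> powr (1 / 2 + d / 4) * \<epsilon> powr (\<alpha> * (- d / 2)))"
    by (intro landau_o.big.mult bigthetaD1[OF hp] landau_o.big_refl)
  thus "(\<lambda>\<epsilon>. \<epsilon> powr (1 / 2 + d / 4) * h \<epsilon> powr (- d / 2)) \<in> O[at_right 0](\<lambda>\<epsilon>. \<epsilon> powr ((2 + d) * \<gamma> / (4 * \<gamma> + 2 * d)))"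
    unfolding r balance[symmetric] powr_add .
  assume g: "\<forall>\<^sub>F \<epsilon> in at_right 0. g \<epsilon> > 0"
  show "(\<lambda>\<epsilon>. \<epsilon> powr ((2 + d) * \<gamma> / (4 * \<gamma> + 2 * d))) \<in> O[at_right 0](\<lambda>\<epsilon>. \<epsilon> powr (1 / 2 + d / 4) * g \<epsilon> powr (- d / 2) + g \<epsilon> powr \<gamma>)"
  proof (rule landau_o.bigI[of 1])
    show "\<forall>\<^sub>F \<epsilon> in at_right 0. norm (\<epsilon> powr ((2 + d) * \<gamma> / (4 * \<gamma> + 2 * d))) \<le> 1 * norm (\<epsilon> powr (1 / 2 + d / 4) * g \<epsilon> powr (- d / 2) + g \<epsilon> powr \<gamma>)"
      using pos g
    proof eventually_elim
      case (elim \<epsilon>)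
      have "\<epsilon> powr (\<alpha> * \<gamma>) \<le> \<epsilon> powr (1 / 2 + d / 4) * g \<epsilon> powr (- d / 2) + g \<epsilon> powr \<gamma>"
      proof (cases "g \<epsilon> \<ge> \<epsilon> powr \<alpha>")
        case True
        have "(\<epsilon> powr \<alpha>) powr \<gamma> \<le> g \<epsilon> powr \<gamma>" using True \<gamma> by (intro powr_mono2) auto
        thus ?thesis by (simp add: powr_powr add_increasing)
      next
        case False
        have "(\<epsilon> powr \<alpha>) powr (- d / 2) \<le> g \<epsilon> powr (- d / 2)" using False elim d by (intro powr_mono2') auto
        hence "\<epsilon> powr (1 / 2 + d / 4) * \<epsilon> powr (\<alpha> * (- d / 2)) \<le> \<epsilon> powr (1 / 2 + d / 4) * g \<epsilon> powr (- d / 2)"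
          by (intro mult_left_mono) (simp_all only: powr_powr powr_ge_zero)
        hence "\<epsilon> powr (\<alpha> * \<gamma>) \<le> \<epsilon> powr (1 / 2 + d / 4) * g \<epsilon> powr (- d / 2)"
          by (simp only: powr_add[symmetric] balance)
        thus ?thesis by (simp add: add_increasing2)
      qed
      thus ?case unfolding r by simp
    qed
  qed simp
qed

theorem theorem4p8:
  fixes M :: "'w measure"
    and D :: "'a::euclidean_space set"
    and T \<sigma> \<gamma> :: real
    and \<theta> \<xi> :: "'a \<Rightarrow> real"
    and S :: "real \<Rightarrow> ('a \<Rightarrow> real) \<Rightarrow> 'a \<Rightarrow> real"
    and X W V :: "(real \<times> 'a \<Rightarrow> real) \<Rightarrow> 'w \<Rightarrow> real"
    and Y :: "real \<Rightarrow> (real \<times> 'a \<Rightarrow> real) \<Rightarrow> 'w \<Rightarrow> real"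
    and K :: "real \<times> 'a \<Rightarrow> real"
    and x\<^sub>0 :: 'a
    and h :: "real \<Rightarrow> real"
    and N :: "real \<Rightarrow> nat"
    and Xs :: "real \<Rightarrow> 'a set"
    and w :: "real \<Rightarrow> real \<Rightarrow> 'a \<Rightarrow> real"
    and k\<^sub>\<epsilon> :: "real \<Rightarrow> nat \<Rightarrow> 'a \<Rightarrow> real \<times> 'a \<Rightarrow> real"
    and X' X\<Delta> :: "real \<Rightarrow> nat \<Rightarrow> 'a \<Rightarrow> 'w \<Rightarrow> real"
    and I B QM est :: "real \<Rightarrow> 'w \<Rightarrow> real"
    and \<sigma>K2 :: real
    and d :: real
  defines "d \<equiv> real DIM('a)"
  \<comment> \<open>model\<close>
  assumes "prob_space M"
    and "T > 0" and "\<sigma> > 0"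
    and "bounded_smooth_domain D"
    and "C1_closure D \<theta>" and "\<exists>c>0. \<forall>x\<in>closure D. c \<le> \<theta> x"
    and "generates D (div_grad_graph D \<theta>) S"
    and "\<xi> \<in> L2 D"
    and "isonormal M ({0..<T} \<times> D) W"
    and "heat_process M T D S \<sigma> \<xi> X"
    and "solves_heat_equation M T D \<theta> \<sigma> \<xi> X W"
    and "isonormal M ({0..<T} \<times> D) V"
    and "independent_of_pair M T D V X W"
    and Y: "\<And>\<epsilon> \<phi> \<omega>. Y \<epsilon> \<phi> \<omega> = X \<phi> \<omega> + \<epsilon> * V \<phi> \<omega>"
  \<comment> \<open>kernel, grids, bandwidth\<close>
    and "x\<^sub>0 \<in> D"
    and "smooth K" and "supp K \<subseteq> {0<..<1} \<times> box (- One) One"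
    and k\<^sub>\<epsilon>: "\<And>\<epsilon> k x. k\<^sub>\<epsilon> \<epsilon> k x = rescaled (shifted K k x) \<epsilon> x\<^sub>0"
    and N: "\<And>\<epsilon>. N \<epsilon> = nat (\<lfloor>T / \<epsilon>\<rfloor> - 1)"
    and "\<forall>\<^sub>F \<epsilon> in at_right 0. finite (Xs \<epsilon>) \<and>
           (\<forall>x\<in>Xs \<epsilon>. supp (k\<^sub>\<epsilon> \<epsilon> 0 x) \<subseteq> {0..<T} \<times> D) \<and>
           pairwise (\<lambda>x y. disjnt (supp (k\<^sub>\<epsilon> \<epsilon> 0 x)) (supp (k\<^sub>\<epsilon> \<epsilon> 0 y))) (Xs \<epsilon>)"
    and "\<forall>\<^sub>F \<epsilon> in at_right 0. h \<epsilon> > 0"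
    and "(\<lambda>\<epsilon>. \<epsilon>) \<in> O[at_right 0](\<lambda>\<epsilon>. (h \<epsilon>)\<^sup>2)"
  \<comment> \<open>estimator and associated quantities\<close>
    and X': "\<And>\<epsilon> k x \<omega>. X' \<epsilon> k x \<omega> = - Y \<epsilon> (dt (k\<^sub>\<epsilon> \<epsilon> k x)) \<omega>"
    and X\<Delta>: "\<And>\<epsilon> k x \<omega>. X\<Delta> \<epsilon> k x \<omega> = Y \<epsilon> (Lap (k\<^sub>\<epsilon> \<epsilon> k x)) \<omega>"
    and I: "\<And>\<epsilon> \<omega>. I \<epsilon> \<omega> =
      (\<Sum>k=1..N \<epsilon>. \<Sum>x\<in>Xs \<epsilon>. w \<epsilon> (h \<epsilon>) x * X\<Delta> \<epsilon> (k - 1) x \<omega> * X\<Delta> \<epsilon> k x \<omega>)"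
    and est: "\<And>\<epsilon> \<omega>. est \<epsilon> \<omega> = inverse (I \<epsilon> \<omega>) *
      (\<Sum>k=1..N \<epsilon>. \<Sum>x\<in>Xs \<epsilon>. w \<epsilon> (h \<epsilon>) x * X\<Delta> \<epsilon> (k - 1) x \<omega> * X' \<epsilon> k x \<omega>)"
    and B: "\<And>\<epsilon> \<omega>. B \<epsilon> \<omega> =
      (\<Sum>k=1..N \<epsilon>. \<Sum>x\<in>Xs \<epsilon>. w \<epsilon> (h \<epsilon>) x * X\<Delta> \<epsilon> (k - 1) x \<omega> *
         X (\<lambda>z. Div_grad \<theta> (k\<^sub>\<epsilon> \<epsilon> k x) z - \<theta> x\<^sub>0 * Lap (k\<^sub>\<epsilon> \<epsilon> k x) z) \<omega>)"
    and \<sigma>K2: "\<sigma>K2 = \<sigma>\<^sup>2 * (nrm UNIV K)\<^sup>2 + (nrm UNIV (\<lambda>z. dt K z + \<theta> x\<^sub>0 * Lap K z))\<^sup>2"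
    and QM: "\<And>\<epsilon> \<omega>. QM \<epsilon> \<omega> =
      \<sigma>K2 * (\<Sum>k=1..N \<epsilon>. \<Sum>x\<in>Xs \<epsilon>. (w \<epsilon> (h \<epsilon>) x)\<^sup>2 * (X\<Delta> \<epsilon> (k - 1) x \<omega>)\<^sup>2)"
  \<comment> \<open>hypotheses of the theorem\<close>
    and "\<gamma> \<ge> 1"
    and "h \<in> \<Theta>[at_right 0](\<lambda>\<epsilon>. \<epsilon> powr ((2 + d) / (4 * \<gamma> + 2 * d)))"
    and a1: "(\<lambda>\<epsilon>. \<integral>\<omega>. I \<epsilon> \<omega> \<partial>M) \<in> \<Theta>[at_right 0](\<lambda>\<epsilon>. real (N \<epsilon>))"
    and a2: "(\<lambda>\<epsilon>. prob_space.variance M (I \<epsilon>)) \<in> o[at_right 0](\<lambda>\<epsilon>. (real (N \<epsilon>))\<^sup>2)"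
    and b: "(\<lambda>\<epsilon>. \<integral>\<omega>. QM \<epsilon> \<omega> \<partial>M)
      \<in> O[at_right 0](\<lambda>\<epsilon>. real (N \<epsilon>) / (real (card (Xs \<epsilon>)) * h \<epsilon> ^ DIM('a)))"
    and c: "(\<lambda>\<epsilon>. \<integral>\<omega>. (B \<epsilon> \<omega>)\<^sup>2 \<partial>M)
      \<in> O[at_right 0](\<lambda>\<epsilon>. h \<epsilon> powr (2 * \<gamma>) * (real (N \<epsilon>))\<^sup>2)"
  shows
    "bigo_prob M (\<lambda>\<epsilon> \<omega>. est \<epsilon> \<omega> - \<theta> x\<^sub>0)
       (\<lambda>\<epsilon>. 1 / sqrt (real (N \<epsilon>) * real (card (Xs \<epsilon>)) * h \<epsilon> ^ DIM('a)) + h \<epsilon> powr \<gamma>)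
     \<and> (\<lambda>\<epsilon>. real (N \<epsilon>)) \<in> \<Theta>[at_right 0](\<lambda>\<epsilon>. 1 / \<epsilon>)
     \<and> ((\<lambda>\<epsilon>. real (card (Xs \<epsilon>))) \<in> \<Theta>[at_right 0](\<lambda>\<epsilon>. \<epsilon> powr (- d / 2)) \<longrightarrow>
          (\<exists>R1 R2. (\<forall>\<epsilon>>0. \<forall>\<omega>\<in>space M. est \<epsilon> \<omega> - \<theta> x\<^sub>0 = R1 \<epsilon> \<omega> + R2 \<epsilon> \<omega>) \<and>
             bigo_prob M R1 (\<lambda>\<epsilon>. \<epsilon> powr (1 / 2 + d / 4) * h \<epsilon> powr (- d / 2)) \<and>
             bigo_prob M R2 (\<lambda>\<epsilon>. h \<epsilon> powr \<gamma>)) \<and>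
          (\<forall>g. (\<forall>\<^sub>F \<epsilon> in at_right 0. g \<epsilon> > 0) \<longrightarrow>
             (\<lambda>\<epsilon>. \<epsilon> powr (1 / 2 + d / 4) * h \<epsilon> powr (- d / 2) + h \<epsilon> powr \<gamma>)
               \<in> O[at_right 0](\<lambda>\<epsilon>. \<epsilon> powr (1 / 2 + d / 4) * g \<epsilon> powr (- d / 2) + g \<epsilon> powr \<gamma>)) \<and>
          bigo_prob M (\<lambda>\<epsilon> \<omega>. est \<epsilon> \<omega> - \<theta> x\<^sub>0)
            (\<lambda>\<epsilon>. \<epsilon> powr ((2 + d) * \<gamma> / (4 * \<gamma> + 2 * d))))"
proof -
  note d_def = assms(1)
  interpret prob_space M by fact
  have C0: "C0_semigroup D S" using \<open>generates D (div_grad_graph D \<theta>) S\<close> by (simp add: generates_def)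
  interpret hm: heat_model M D S T \<theta> \<sigma> \<xi> X W V
    by unfold_locales (use assms C0 in \<open>simp_all add: bounded_smooth_domain_def\<close>)
  note grid = \<open>\<forall>\<^sub>F \<epsilon> in at_right 0. finite (Xs \<epsilon>) \<and>
           (\<forall>x\<in>Xs \<epsilon>. supp (k\<^sub>\<epsilon> \<epsilon> 0 x) \<subseteq> {0..<T} \<times> D) \<and>
           pairwise (\<lambda>x y. disjnt (supp (k\<^sub>\<epsilon> \<epsilon> 0 x)) (supp (k\<^sub>\<epsilon> \<epsilon> 0 y))) (Xs \<epsilon>)\<close>
  note hpos = \<open>\<forall>\<^sub>F \<epsilon> in at_right 0. h \<epsilon> > 0\<close>
  define a where "a = \<theta> x\<^sub>0"
  have N': "N = (\<lambda>\<epsilon>. nat (\<lfloor>T / \<epsilon>\<rfloor> - 1))" using N by blast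
  have Nev: "\<forall>\<^sub>F \<epsilon> in at_right 0. \<epsilon> > 0 \<and> N \<epsilon> \<ge> 1 \<and> (real (N \<epsilon>) + 1) * \<epsilon> \<le> T"
    unfolding N' by (rule grid_size_asymptotics(1)[OF \<open>T > 0\<close>])
  have N\<Theta>: "(\<lambda>\<epsilon>. real (N \<epsilon>)) \<in> \<Theta>[at_right 0](\<lambda>\<epsilon>. 1 / \<epsilon>)"
    unfolding N' by (rule grid_size_asymptotics(2)[OF \<open>T > 0\<close>])
  have Npos: "\<forall>\<^sub>F \<epsilon> in at_right 0. real (N \<epsilon>) > 0" using Nev by eventually_elim simp

  \<comment> \<open>Decomposition of the error and second moments at a fixed noise level\<close>
  define J where "J = (\<lambda>\<epsilon>. {1..N \<epsilon>} \<times> Xs \<epsilon>)"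
  have dbl: "(\<Sum>k=1..N \<epsilon>. \<Sum>x\<in>Xs \<epsilon>. f k x) = (\<Sum>(k, x)\<in>J \<epsilon>. f k x)" for f :: "nat \<Rightarrow> 'a \<Rightarrow> real" and \<epsilon>
    unfolding J_def by (rule sum.cartesian_product)
  have X\<Delta>': "X\<Delta> \<epsilon> k x = hm.lap_obs \<epsilon> (k\<^sub>\<epsilon> \<epsilon> k x)" for \<epsilon> k x
    by (rule ext) (simp add: X\<Delta> Y hm.lap_obs_def)
  define P where "P = (\<lambda>\<epsilon> \<omega>. \<Sum>(k, x)\<in>J \<epsilon>. w \<epsilon> (h \<epsilon>) x * X\<Delta> \<epsilon> (k - 1) x \<omega> * hm.noise a \<epsilon> (k\<^sub>\<epsilon> \<epsilon> k x) \<omega>)"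

  have pointwise: "I \<epsilon> \<in> borel_measurable M \<and> integrable M (\<lambda>\<omega>. (I \<epsilon> \<omega>)\<^sup>2) \<and>
      B \<epsilon> \<in> borel_measurable M \<and> integrable M (\<lambda>\<omega>. (B \<epsilon> \<omega>)\<^sup>2) \<and>
      P \<epsilon> \<in> borel_measurable M \<and> integrable M (\<lambda>\<omega>. (P \<epsilon> \<omega>)\<^sup>2) \<and>
      est \<epsilon> \<in> borel_measurable M \<and>
      (\<integral>\<omega>. (P \<epsilon> \<omega>)\<^sup>2 \<partial>M) = (\<integral>\<omega>. QM \<epsilon> \<omega> \<partial>M) \<and>
      (AE \<omega> in M. I \<epsilon> \<omega> \<noteq> 0 \<longrightarrow> (est \<epsilon> \<omega> - \<theta> x\<^sub>0) * I \<epsilon> \<omega> = B \<epsilon> \<omega> + P \<epsilon> \<omega>)"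
    if \<epsilon>: "\<epsilon> > 0" "(real (N \<epsilon>) + 1) * \<epsilon> \<le> T"
      and g: "finite (Xs \<epsilon>) \<and> (\<forall>x\<in>Xs \<epsilon>. supp (k\<^sub>\<epsilon> \<epsilon> 0 x) \<subseteq> {0..<T} \<times> D) \<and>
           pairwise (\<lambda>x y. disjnt (supp (k\<^sub>\<epsilon> \<epsilon> 0 x)) (supp (k\<^sub>\<epsilon> \<epsilon> 0 y))) (Xs \<epsilon>)" for \<epsilon>
  proof -
    interpret kg: kernel_grid M D S T \<theta> \<sigma> \<xi> X W V K \<epsilon> a x\<^sub>0 "N \<epsilon>" "Xs \<epsilon>"
      by unfold_locales (use \<epsilon> g \<open>smooth K\<close> \<open>supp K \<subseteq> {0<..<1} \<times> box (- One) One\<close> in \<open>simp_all add: k\<^sub>\<epsilon>\<close>)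
    have test: "test_function T D (k\<^sub>\<epsilon> \<epsilon> k x)" if "k \<le> N \<epsilon>" "x \<in> Xs \<epsilon>" for k x
      unfolding k\<^sub>\<epsilon> by (rule kg.kf_test[OF that])
    have JD: "fst i \<le> N \<epsilon>" "fst i - 1 \<le> N \<epsilon>" "snd i \<in> Xs \<epsilon>" if "i \<in> J \<epsilon>" for i using that by (auto simp: J_def)
    have obs: "X\<Delta> \<epsilon> k x \<in> hm.observations" if "k \<le> N \<epsilon>" "x \<in> Xs \<epsilon>" for k x
      unfolding X\<Delta>' by (rule hm.lap_obs_obs[OF test[OF that]])
    define Z where "Z = (\<lambda>k x. X (\<lambda>z. Div_grad \<theta> (k\<^sub>\<epsilon> \<epsilon> k x) z - \<theta> x\<^sub>0 * Lap (k\<^sub>\<epsilon> \<epsilon> k x) z))"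
    have Zobs: "Z k x \<in> hm.observations" if "k \<le> N \<epsilon>" "x \<in> Xs \<epsilon>" for k x
    proof -
      have "Cc_fun T D (\<lambda>z. 1 * Div_grad \<theta> (k\<^sub>\<epsilon> \<epsilon> k x) z + (- \<theta> x\<^sub>0) * Lap (k\<^sub>\<epsilon> \<epsilon> k x) z)"
        by (intro Cc_fun_lincomb hm.test_Cc_fun test that)
      hence "Cc_fun T D (\<lambda>z. Div_grad \<theta> (k\<^sub>\<epsilon> \<epsilon> k x) z - \<theta> x\<^sub>0 * Lap (k\<^sub>\<epsilon> \<epsilon> k x) z)" by simp
      thus ?thesis unfolding Z_def by (intro hm.X_obs Cc_fun_Cc_st)
    qed
    have nobs: "hm.noise a \<epsilon> (k\<^sub>\<epsilon> \<epsilon> k x) \<in> hm.observations" if "k \<le> N \<epsilon>" "x \<in> Xs \<epsilon>" for k x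
      by (rule hm.noise_obs[OF test[OF that]])
    have I': "I \<epsilon> = (\<lambda>\<omega>. \<Sum>i\<in>J \<epsilon>. w \<epsilon> (h \<epsilon>) (snd i) * X\<Delta> \<epsilon> (fst i - 1) (snd i) \<omega> * X\<Delta> \<epsilon> (fst i) (snd i) \<omega>)"
      by (rule ext, unfold I dbl split_beta) (rule refl)
    have B': "B \<epsilon> = (\<lambda>\<omega>. \<Sum>i\<in>J \<epsilon>. w \<epsilon> (h \<epsilon>) (snd i) * X\<Delta> \<epsilon> (fst i - 1) (snd i) \<omega> * Z (fst i) (snd i) \<omega>)"
      by (rule ext, unfold B dbl split_beta Z_def) (rule refl)
    have P': "P \<epsilon> = (\<lambda>\<omega>. \<Sum>i\<in>J \<epsilon>. w \<epsilon> (h \<epsilon>) (snd i) * X\<Delta> \<epsilon> (fst i - 1) (snd i) \<omega> * hm.noise a \<epsilon> (k\<^sub>\<epsilon> \<epsilon> (fst i) (snd i)) \<omega>)"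
      by (rule ext) (simp add: P_def split_beta)
    have Im: "I \<epsilon> \<in> borel_measurable M" "integrable M (\<lambda>\<omega>. (I \<epsilon> \<omega>)\<^sup>2)"
      unfolding I' by (intro hm.square_integrable_sum_prod obs JD; assumption)+
    have Bm: "B \<epsilon> \<in> borel_measurable M" "integrable M (\<lambda>\<omega>. (B \<epsilon> \<omega>)\<^sup>2)"
      unfolding B' by (intro hm.square_integrable_sum_prod obs Zobs JD; assumption)+
    have Pm: "P \<epsilon> \<in> borel_measurable M" "integrable M (\<lambda>\<omega>. (P \<epsilon> \<omega>)\<^sup>2)"
      unfolding P' by (intro hm.square_integrable_sum_prod obs nobs JD; assumption)+
    have X'm: "X' \<epsilon> k x \<in> borel_measurable M" if "k \<le> N \<epsilon>" "x \<in> Xs \<epsilon>" for k x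
    proof -
      note t = test[OF that]
      have "(\<lambda>\<omega>. (-1) * X (dt (k\<^sub>\<epsilon> \<epsilon> k x)) \<omega> + (- \<epsilon>) * V (dt (k\<^sub>\<epsilon> \<epsilon> k x)) \<omega>) \<in> hm.observations"
        by (intro hm.lincomb hm.X_obs hm.V_obs hm.test_Cc_st hm.test_L2 t)
      from hm.measurable_G[OF this] show ?thesis
        by (rule measurable_cong[THEN iffD1, rotated]) (simp add: X' Y)
    qed
    have est': "est \<epsilon> = (\<lambda>\<omega>. inverse (I \<epsilon> \<omega>) * (\<Sum>i\<in>J \<epsilon>. w \<epsilon> (h \<epsilon>) (snd i) * X\<Delta> \<epsilon> (fst i - 1) (snd i) \<omega> * X' \<epsilon> (fst i) (snd i) \<omega>))"
      by (rule ext, unfold est dbl split_beta) (rule refl)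
    have em: "est \<epsilon> \<in> borel_measurable M"
      unfolding est' by (intro borel_measurable_times borel_measurable_inverse borel_measurable_sum borel_measurable_const
          Im X'm hm.measurable_G[OF obs] JD; assumption)
    \<comment> \<open>An equality, because the cross terms vanish exactly; the hypothesis on the
      expectation of \<open>QM\<close> therefore bounds the second moment of \<open>P\<close>
      directly.\<close>
    have var: "(\<integral>\<omega>. (P \<epsilon> \<omega>)\<^sup>2 \<partial>M) = (\<integral>\<omega>. QM \<epsilon> \<omega> \<partial>M)"
    proof -
      have "(\<integral>\<omega>. (P \<epsilon> \<omega>)\<^sup>2 \<partial>M) = \<sigma>K2 * (\<Sum>(k, x)\<in>J \<epsilon>. (w \<epsilon> (h \<epsilon>) x)\<^sup>2 * (\<integral>\<omega>. (X\<Delta> \<epsilon> (k - 1) x \<omega>)\<^sup>2 \<partial>M))"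
        using kg.estimator_martingale(2)[of "w \<epsilon> (h \<epsilon>)"] unfolding P_def X\<Delta>' k\<^sub>\<epsilon> J_def \<sigma>K2 a_def[symmetric] .
      also have "\<dots> = (\<integral>\<omega>. \<sigma>K2 * (\<Sum>i\<in>J \<epsilon>. (w \<epsilon> (h \<epsilon>) (snd i))\<^sup>2 * (X\<Delta> \<epsilon> (fst i - 1) (snd i) \<omega>)\<^sup>2) \<partial>M)"
      proof -
        have "(\<integral>\<omega>. (\<Sum>i\<in>J \<epsilon>. (w \<epsilon> (h \<epsilon>) (snd i))\<^sup>2 * (X\<Delta> \<epsilon> (fst i - 1) (snd i) \<omega>)\<^sup>2) \<partial>M)
          = (\<Sum>i\<in>J \<epsilon>. \<integral>\<omega>. (w \<epsilon> (h \<epsilon>) (snd i))\<^sup>2 * (X\<Delta> \<epsilon> (fst i - 1) (snd i) \<omega>)\<^sup>2 \<partial>M)"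
          by (intro Bochner_Integration.integral_sum integrable_mult_right hm.integrable_power_G obs JD; assumption)
        thus ?thesis by (simp add: split_beta)
      qed
      also have "\<dots> = (\<integral>\<omega>. QM \<epsilon> \<omega> \<partial>M)" by (unfold QM dbl split_beta) (rule refl)
      finally show ?thesis .
    qed
    \<comment> \<open>The regression equations hold almost surely one by one, hence simultaneously
      for the finitely many grid indices.\<close>
    have "AE \<omega> in M. \<forall>i\<in>J \<epsilon>. X' \<epsilon> (fst i) (snd i) \<omega> - \<theta> x\<^sub>0 * X\<Delta> \<epsilon> (fst i) (snd i) \<omega>
        = Z (fst i) (snd i) \<omega> + hm.noise a \<epsilon> (k\<^sub>\<epsilon> \<epsilon> (fst i) (snd i)) \<omega>"
    proof (rule eventually_ball_finite, use g in \<open>simp add: J_def\<close>, rule ballI)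
      fix i assume "i \<in> J \<epsilon>"
      from hm.residual_AE[OF test[OF JD(1,3)[OF this]], of \<epsilon> a]
      show "AE \<omega> in M. X' \<epsilon> (fst i) (snd i) \<omega> - \<theta> x\<^sub>0 * X\<Delta> \<epsilon> (fst i) (snd i) \<omega>
        = Z (fst i) (snd i) \<omega> + hm.noise a \<epsilon> (k\<^sub>\<epsilon> \<epsilon> (fst i) (snd i)) \<omega>"
        by (simp add: X' X\<Delta> Y Z_def a_def)
    qed
    hence "AE \<omega> in M. I \<epsilon> \<omega> \<noteq> 0 \<longrightarrow> (est \<epsilon> \<omega> - \<theta> x\<^sub>0) * I \<epsilon> \<omega> = B \<epsilon> \<omega> + P \<epsilon> \<omega>"
    proof eventually_elim
      case (elim \<omega>)
      show ?case
      proof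
        assume "I \<epsilon> \<omega> \<noteq> 0"
        hence "(est \<epsilon> \<omega> - \<theta> x\<^sub>0) * I \<epsilon> \<omega> =
          (\<Sum>i\<in>J \<epsilon>. w \<epsilon> (h \<epsilon>) (snd i) * X\<Delta> \<epsilon> (fst i - 1) (snd i) \<omega> * X' \<epsilon> (fst i) (snd i) \<omega>) - \<theta> x\<^sub>0 * I \<epsilon> \<omega>"
          unfolding est' by (simp add: field_simps)
        also have "\<dots> = (\<Sum>i\<in>J \<epsilon>. w \<epsilon> (h \<epsilon>) (snd i) * X\<Delta> \<epsilon> (fst i - 1) (snd i) \<omega> * (X' \<epsilon> (fst i) (snd i) \<omega> - \<theta> x\<^sub>0 * X\<Delta> \<epsilon> (fst i) (snd i) \<omega>))"
          unfolding I' by (simp add: sum_distrib_left right_diff_distrib sum_subtractf mult_ac)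
        also have "\<dots> = (\<Sum>i\<in>J \<epsilon>. w \<epsilon> (h \<epsilon>) (snd i) * X\<Delta> \<epsilon> (fst i - 1) (snd i) \<omega> * (Z (fst i) (snd i) \<omega> + hm.noise a \<epsilon> (k\<^sub>\<epsilon> \<epsilon> (fst i) (snd i)) \<omega>))"
          using elim by (intro sum.cong) auto
        also have "\<dots> = B \<epsilon> \<omega> + P \<epsilon> \<omega>"
          unfolding B' P' by (simp add: distrib_left sum.distrib)
        finally show "(est \<epsilon> \<omega> - \<theta> x\<^sub>0) * I \<epsilon> \<omega> = B \<epsilon> \<omega> + P \<epsilon> \<omega>" .
      qed
    qed
    thus ?thesis using Im Bm Pm em var by blast
  qed
  have good: "\<forall>\<^sub>F \<epsilon> in at_right 0. I \<epsilon> \<in> borel_measurable M \<and> integrable M (\<lambda>\<omega>. (I \<epsilon> \<omega>)\<^sup>2) \<and>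
      B \<epsilon> \<in> borel_measurable M \<and> integrable M (\<lambda>\<omega>. (B \<epsilon> \<omega>)\<^sup>2) \<and>
      P \<epsilon> \<in> borel_measurable M \<and> integrable M (\<lambda>\<omega>. (P \<epsilon> \<omega>)\<^sup>2) \<and>
      est \<epsilon> \<in> borel_measurable M \<and>
      (\<integral>\<omega>. (P \<epsilon> \<omega>)\<^sup>2 \<partial>M) = (\<integral>\<omega>. QM \<epsilon> \<omega> \<partial>M) \<and>
      (AE \<omega> in M. I \<epsilon> \<omega> \<noteq> 0 \<longrightarrow> (est \<epsilon> \<omega> - \<theta> x\<^sub>0) * I \<epsilon> \<omega> = B \<epsilon> \<omega> + P \<epsilon> \<omega>)"
    using Nev grid by eventually_elim (rule pointwise, auto)

  \<comment> \<open>With an empty grid \<open>I\<close> would be identically zero, contradicting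
    that its mean is of order \<open>N\<close>. Positivity keeps the stochastic rate well
    defined.\<close>
  have cardpos: "\<forall>\<^sub>F \<epsilon> in at_right 0. real (card (Xs \<epsilon>)) > 0"
  proof -
    obtain q where q: "q > 0" "\<forall>\<^sub>F \<epsilon> in at_right 0. norm (\<integral>\<omega>. I \<epsilon> \<omega> \<partial>M) \<ge> q * norm (real (N \<epsilon>))"
      using bigthetaD2[OF a1] by (elim landau_omega.bigE)
    show ?thesis
      using q(2) Npos grid
    proof eventually_elim
      case (elim \<epsilon>)
      have "Xs \<epsilon> \<noteq> {}"
      proof
        assume "Xs \<epsilon> = {}"
        hence "(\<integral>\<omega>. I \<epsilon> \<omega> \<partial>M) = 0" by (simp add: I)
        thus False using elim q(1) by (simp add: mult_le_0_iff)
      qed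
      thus ?case using elim by (simp add: card_gt_0_iff)
    qed
  qed

  \<comment> \<open>Separate rates for the stochastic error and the bias\<close>
  define r1 where "r1 = (\<lambda>\<epsilon>. 1 / sqrt (real (N \<epsilon>) * real (card (Xs \<epsilon>)) * h \<epsilon> ^ DIM('a)))"
  \<comment> \<open>\<open>R2\<close> is the bias over \<open>I\<close>, and \<open>R1\<close> is
    defined as the remainder, so that the splitting also holds where I = 0. There \<open>R2\<close>
    is 0 by the convention \<open>inverse 0 = 0\<close>; elsewhere \<open>R1\<close> equals P / I
    almost surely.\<close>
  define R2 where "R2 = (\<lambda>\<epsilon> \<omega>. inverse (I \<epsilon> \<omega>) * B \<epsilon> \<omega>)"
  define R1 where "R1 = (\<lambda>\<epsilon> \<omega>. est \<epsilon> \<omega> - \<theta> x\<^sub>0 - R2 \<epsilon> \<omega>)"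
  have r1pos: "\<forall>\<^sub>F \<epsilon> in at_right 0. r1 \<epsilon> > 0"
    using Npos cardpos hpos by eventually_elim (simp add: r1_def)
  have Im: "\<forall>\<^sub>F \<epsilon> in at_right 0. I \<epsilon> \<in> borel_measurable M \<and> integrable M (\<lambda>\<omega>. (I \<epsilon> \<omega>)\<^sup>2)"
    using good by eventually_elim blast
  have bR2: "bigo_prob M R2 (\<lambda>\<epsilon>. h \<epsilon> powr \<gamma>)"
  proof (rule bigo_prob_ratio[OF \<open>prob_space M\<close> _ Im _ _ _ Npos bigthetaD2[OF a1] a2])
    show "\<forall>\<^sub>F \<epsilon> in at_right 0. R2 \<epsilon> \<in> borel_measurable M"
      using good by eventually_elim (auto simp: R2_def)
    show "\<forall>\<^sub>F \<epsilon> in at_right 0. B \<epsilon> \<in> borel_measurable M \<and> integrable M (\<lambda>\<omega>. (B \<epsilon> \<omega>)\<^sup>2)"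
      using good by eventually_elim blast
    show "\<forall>\<^sub>F \<epsilon> in at_right 0. AE \<omega> in M. I \<epsilon> \<omega> \<noteq> 0 \<longrightarrow> R2 \<epsilon> \<omega> * I \<epsilon> \<omega> = B \<epsilon> \<omega>"
      by (simp add: R2_def)
    show "\<forall>\<^sub>F \<epsilon> in at_right 0. h \<epsilon> powr \<gamma> > 0" using hpos by eventually_elim simp
    have "(\<lambda>\<epsilon>. h \<epsilon> powr (2 * \<gamma>) * (real (N \<epsilon>))\<^sup>2) = (\<lambda>\<epsilon>. (h \<epsilon> powr \<gamma> * real (N \<epsilon>))\<^sup>2)"
      by (simp add: power_mult_distrib power2_eq_square fun_eq_iff flip: powr_add)
    thus "(\<lambda>\<epsilon>. \<integral>\<omega>. (B \<epsilon> \<omega>)\<^sup>2 \<partial>M) \<in> O[at_right 0](\<lambda>\<epsilon>. (h \<epsilon> powr \<gamma> * real (N \<epsilon>))\<^sup>2)"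
      using c by simp
  qed
  have bR1: "bigo_prob M R1 r1"
  proof (rule bigo_prob_ratio[OF \<open>prob_space M\<close> _ Im _ _ r1pos Npos bigthetaD2[OF a1] a2])
    show "\<forall>\<^sub>F \<epsilon> in at_right 0. R1 \<epsilon> \<in> borel_measurable M"
      using good by eventually_elim (auto simp: R1_def R2_def)
    show "\<forall>\<^sub>F \<epsilon> in at_right 0. P \<epsilon> \<in> borel_measurable M \<and> integrable M (\<lambda>\<omega>. (P \<epsilon> \<omega>)\<^sup>2)"
      using good by eventually_elim blast
    show "\<forall>\<^sub>F \<epsilon> in at_right 0. AE \<omega> in M. I \<epsilon> \<omega> \<noteq> 0 \<longrightarrow> R1 \<epsilon> \<omega> * I \<epsilon> \<omega> = P \<epsilon> \<omega>"
      using good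
    proof eventually_elim
      case (elim \<epsilon>)
      hence "AE \<omega> in M. I \<epsilon> \<omega> \<noteq> 0 \<longrightarrow> (est \<epsilon> \<omega> - \<theta> x\<^sub>0) * I \<epsilon> \<omega> = B \<epsilon> \<omega> + P \<epsilon> \<omega>" by blast
      thus ?case by eventually_elim (auto simp: R1_def R2_def left_diff_distrib)
    qed
    have "(\<lambda>\<epsilon>. \<integral>\<omega>. (P \<epsilon> \<omega>)\<^sup>2 \<partial>M) \<in> \<Theta>[at_right 0](\<lambda>\<epsilon>. \<integral>\<omega>. QM \<epsilon> \<omega> \<partial>M)"
      by (rule bigthetaI_cong) (use good in eventually_elim, blast)
    also note b
    \<comment> \<open>The rate \<open>r1\<close> is made for this: (r1 N)^2 = N / (card h^d)
      wherever the three factors are positive.\<close>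
    also have "(\<lambda>\<epsilon>. real (N \<epsilon>) / (real (card (Xs \<epsilon>)) * h \<epsilon> ^ DIM('a))) \<in> \<Theta>[at_right 0](\<lambda>\<epsilon>. (r1 \<epsilon> * real (N \<epsilon>))\<^sup>2)"
    proof (rule bigthetaI_cong)
      show "\<forall>\<^sub>F \<epsilon> in at_right 0. real (N \<epsilon>) / (real (card (Xs \<epsilon>)) * h \<epsilon> ^ DIM('a)) = (r1 \<epsilon> * real (N \<epsilon>))\<^sup>2"
        using Npos cardpos hpos
        by eventually_elim (simp add: r1_def power_mult_distrib power_divide field_simps power2_eq_square)
    qed
    finally show "(\<lambda>\<epsilon>. \<integral>\<omega>. (P \<epsilon> \<omega>)\<^sup>2 \<partial>M) \<in> O[at_right 0](\<lambda>\<epsilon>. (r1 \<epsilon> * real (N \<epsilon>))\<^sup>2)" .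
  qed
  have split: "est \<epsilon> \<omega> - \<theta> x\<^sub>0 = R1 \<epsilon> \<omega> + R2 \<epsilon> \<omega>" for \<epsilon> \<omega> by (simp add: R1_def)
  have bsum: "bigo_prob M (\<lambda>\<epsilon> \<omega>. est \<epsilon> \<omega> - \<theta> x\<^sub>0) (\<lambda>\<epsilon>. \<bar>r1 \<epsilon>\<bar> + \<bar>h \<epsilon> powr \<gamma>\<bar>)"
    unfolding split by (rule bigo_prob_add[OF \<open>prob_space M\<close> bR1 bR2])
  have first: "bigo_prob M (\<lambda>\<epsilon> \<omega>. est \<epsilon> \<omega> - \<theta> x\<^sub>0) (\<lambda>\<epsilon>. r1 \<epsilon> + h \<epsilon> powr \<gamma>)"
  proof (rule bigo_prob_mono[OF \<open>prob_space M\<close> bsum])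
    show "(\<lambda>\<epsilon>. \<bar>r1 \<epsilon>\<bar> + \<bar>h \<epsilon> powr \<gamma>\<bar>) \<in> O[at_right 0](\<lambda>\<epsilon>. r1 \<epsilon> + h \<epsilon> powr \<gamma>)"
      by (rule bigthetaD1, rule bigthetaI_cong) (use r1pos in \<open>eventually_elim, simp\<close>)
  qed

  \<comment> \<open>Explicit rates and the optimal bandwidth\<close>
  have dpos: "d > 0" by (simp add: d_def)
  note opt = optimal_bandwidth[OF \<open>\<gamma> \<ge> 1\<close> dpos \<open>h \<in> \<Theta>[at_right 0](\<lambda>\<epsilon>. \<epsilon> powr ((2 + d) / (4 * \<gamma> + 2 * d)))\<close> hpos]
  show ?thesis
  proof (intro conjI impI)
    show "bigo_prob M (\<lambda>\<epsilon> \<omega>. est \<epsilon> \<omega> - \<theta> x\<^sub>0)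
       (\<lambda>\<epsilon>. 1 / sqrt (real (N \<epsilon>) * real (card (Xs \<epsilon>)) * h \<epsilon> ^ DIM('a)) + h \<epsilon> powr \<gamma>)"
      using first by (simp add: r1_def)
    show "(\<lambda>\<epsilon>. real (N \<epsilon>)) \<in> \<Theta>[at_right 0](\<lambda>\<epsilon>. 1 / \<epsilon>)" by (rule N\<Theta>)
    assume card: "(\<lambda>\<epsilon>. real (card (Xs \<epsilon>))) \<in> \<Theta>[at_right 0](\<lambda>\<epsilon>. \<epsilon> powr (- d / 2))"
    have r1\<Theta>: "r1 \<in> \<Theta>[at_right 0](\<lambda>\<epsilon>. \<epsilon> powr (1 / 2 + d / 4) * h \<epsilon> powr (- d / 2))"
      using stochastic_error_rate[OF N\<Theta> Npos _ cardpos hpos, of "DIM('a)"] card unfolding r1_def d_def by simp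
    have bR1': "bigo_prob M R1 (\<lambda>\<epsilon>. \<epsilon> powr (1 / 2 + d / 4) * h \<epsilon> powr (- d / 2))"
      by (rule bigo_prob_mono[OF \<open>prob_space M\<close> bR1 bigthetaD1[OF r1\<Theta>]])
    show "\<exists>R1 R2. (\<forall>\<epsilon>>0. \<forall>\<omega>\<in>space M. est \<epsilon> \<omega> - \<theta> x\<^sub>0 = R1 \<epsilon> \<omega> + R2 \<epsilon> \<omega>) \<and>
             bigo_prob M R1 (\<lambda>\<epsilon>. \<epsilon> powr (1 / 2 + d / 4) * h \<epsilon> powr (- d / 2)) \<and>
             bigo_prob M R2 (\<lambda>\<epsilon>. h \<epsilon> powr \<gamma>)"
      using split bR1' bR2 by blast
    show "\<forall>g. (\<forall>\<^sub>F \<epsilon> in at_right 0. g \<epsilon> > 0) \<longrightarrow>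
             (\<lambda>\<epsilon>. \<epsilon> powr (1 / 2 + d / 4) * h \<epsilon> powr (- d / 2) + h \<epsilon> powr \<gamma>)
               \<in> O[at_right 0](\<lambda>\<epsilon>. \<epsilon> powr (1 / 2 + d / 4) * g \<epsilon> powr (- d / 2) + g \<epsilon> powr \<gamma>)"
      \<comment> \<open>Both error terms at \<open>h\<close> are of the balanced order, and no
        positive bandwidth g brings their sum below that order.\<close>
      using landau_o.big_trans[OF sum_in_bigo(1)[OF opt(1,2)] opt(3)] by blast
    have "r1 \<in> O[at_right 0](\<lambda>\<epsilon>. \<epsilon> powr ((2 + d) * \<gamma> / (4 * \<gamma> + 2 * d)))"
      by (rule landau_o.big_trans[OF bigthetaD1[OF r1\<Theta>] opt(1)])
    hence "(\<lambda>\<epsilon>. \<bar>r1 \<epsilon>\<bar> + \<bar>h \<epsilon> powr \<gamma>\<bar>) \<in> O[at_right 0](\<lambda>\<epsilon>. \<epsilon> powr ((2 + d) * \<gamma> / (4 * \<gamma> + 2 * d)))"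
      using opt(2) by (intro sum_in_bigo) (simp_all)
    thus "bigo_prob M (\<lambda>\<epsilon> \<omega>. est \<epsilon> \<omega> - \<theta> x\<^sub>0)
            (\<lambda>\<epsilon>. \<epsilon> powr ((2 + d) * \<gamma> / (4 * \<gamma> + 2 * d)))"
      by (rule bigo_prob_mono[OF \<open>prob_space M\<close> bsum])
  qed
qed

end
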